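(* Let $k$ be a field of characteristic not $2$. Let $C_1,C_2,C_3\subset\mathbb{P}^2_k$ be three circles whose centers do not lie on a shared line. Assume that no two of $C_1,C_2,C_3$ are tangent, and that the cones $Q_1,Q_2,Q_3\subset\mathbb{P}^3_k$ of circles tangent to $C_1,C_2,C_3$ meet transversely. Let $S$ be a non-degenerate circle tangent to $C_1,C_2,C_3$, corresponding to $s\in Q_1\cap Q_2\cap Q_3$, and assume that the field of definition $k(s)$ of $S$ is separable over $k$. Let $(a_i,b_i)$ be the center of $C_i$, $(a_s,b_s)$ the center of $S$, and $(x_i,y_i)$ the point at which $C_i$ and $S$ are tangent. Let $$u_i=(a_i-x_i)(a_i-a_s)+(b_i-y_i)(b_i-b_s),\qquad v_i=(a_i-x_i)(x_i-a_s)+(b_i-y_i)(y_i-b_s),$$ and define $$\mathrm{Area}(s):=\sum_{\substack{\{i,m,n\}=\{1,2,3\}\\ m<n}}(-1)^{i+1}u_iv_mv_n\big((a_m-a_s)(b_n-b_s)-(a_n-a_s)(b_m-b_s)\big).$$ Then $$\beta_S=\mathrm{Tr}_{k(s)/k}\langle\mathrm{Area}(s)\rangle\quad\text{in }\mathrm{GW}(k),$$ where $\beta_S\in\mathrm{GW}(k)$ is the local index at $S$ defined in the context.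
   Context: $\mathrm{GW}(k)$ is the Grothendieck--Witt group of isomorphism classes of symmetric non-degenerate bilinear forms over $k$; $\langle a\rangle$ is the class of $(x,y)\mapsto axy$. For a finite separable extension $L/k$, $\mathrm{Tr}_{L/k}:\mathrm{GW}(L)\to\mathrm{GW}(k)$ is post-composition with the field trace. Circles. A circle in $\mathbb{P}^2_k$ (coordinates $[x:y:z]$) is a conic of the form $C(p)=\mathbb{V}(p_0(x^2+y^2)+z(p_1x+p_2y+p_3z))$ with $p=[p_0:p_1:p_2:p_3]\in\mathbb{P}^3$. Thus the moduli space of circles is identified with $\mathbb{P}^3_k$ (coordinates $[c_0:c_1:c_2:c_3]$), and the field of definition of $C(p)$ is the residue field $k(p)$. The circle is degenerate if $p_0=0$. A non-degenerate circle has center $[a:b:1]$ (also written $(a,b)$) and radius squared $r^2$, where $p_1/p_0=-2a$, $p_2/p_0=-2b$, $p_3/p_0=a^2+b^2-r^2$. The given circles $C_i$ are non-degenerate and defined over $k$ (so $a_i,b_i,r_i^2\in k$). Tangency. The space of circles tangent to the non-degenerate circle $C_i$ with center $[a_i:b_i:1]$ and radius squared $r_i^2$ is the quadric cone $Q_i=\mathbb{V}(q_i)\subset\mathbb{P}^3_k$, where $$q_i=(a_iX_i+b_iY_i+Z_i)^2-r_i^2(X_i^2+Y_i^2),$$ $X_i=c_1+2a_ic_0$, $Y_i=c_2+2b_ic_0$, $Z_i=c_3-(a_i^2+b_i^2-r_i^2)c_0$. A circle $C(s)$ tangent to $C_i$ is a point $s\in Q_i$. The point of tangency $(x_i,y_i)$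 of $S$ and $C_i$ is a point of the affine plane $z=1$ lying on both $S$ and $C_i$. The cones meet transversely if their gradient vectors are linearly independent at every point of $Q_1\cap Q_2\cap Q_3$. Local index. $\beta_S$ is the local index at $s$ of the section $\sigma=(q_1,q_2,q_3)$ of the relatively oriented bundle $\mathcal{O}(2)^{\oplus 3}\to\mathbb{P}^3_k$; since $c_0(s)\neq0$, it equals $\deg^{\mathbb{A}^1}_s(q_1/c_0^2,q_2/c_0^2,q_3/c_0^2)\in\mathrm{GW}(k)$ in the affine coordinates $(c_1/c_0,c_2/c_0,c_3/c_0)$. Local $\mathbb{A}^1$-degree. For $f=(f_1,\ldots,f_n):\mathbb{A}^n_k\to\mathbb{A}^n_k$ with isolated zero at a closed point $p$ with maximal ideal $\mathfrak m$, $\deg^{\mathbb{A}^1}_p(f)$ is the class of the Scheja--Storch form on $A=k[x_1,\ldots,x_n]_{\mathfrak{m}}/(f_1,\ldots,f_n)$: write $f_j(X)-f_j(Y)=\sum_i\Delta_{ij}(X_i-Y_i)$ with $\Delta_{ij}\in k[X,Y]$, let $\sum_l a_l\otimes b_l\in A\otimes_kA$ be the image of $\det(\Delta_{ij})$, let $\eta:A\to k$ be the unique $k$-linear map with $\sum_l\eta(a_l)b_l=1$; the form is $(x,y)\mapsto\eta(xy)$. *)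

theory Defs
  imports
    "Jordan_Normal_Form.Determinant"
    "HOL-Algebra.QuotRing"
    "HOL-Algebra.Generated_Fields"
    "HOL-Algebra.Algebraic_Closure_Type"
    "HOL-Computational_Algebra.Fraction_Field"
    "HOL-Library.Poly_Mapping"
begin

section \<open>The Grothendieck--Witt group\<close>

text \<open>
  A symmetric non-degenerate bilinear form over \<open>k\<close> is given by its Gram matrix with respect to a
  basis, i.e. as a form on \<open>k\<^sup>n\<close>, with \<open>n\<close> arbitrary. Forms on other finite-dimensional
  \<open>k\<close>-spaces enter through \<open>gw_class\<close> below.
\<close>

typedef (overloaded) 'a bilin_form =
  "{M :: 'a::field mat. square_mat M \<and> transpose_mat M = M \<and> det M \<noteq> 0}"
proof
  show "1\<^sub>m 0 \<in> {M :: 'a mat. square_mat M \<and> transpose_mat M = M \<and> det M \<noteq> 0}"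
    by simp
qed

setup_lifting type_definition_bilin_form

definition congruent_mat :: "'a::field mat \<Rightarrow> 'a mat \<Rightarrow> bool" where
  "congruent_mat M N \<longleftrightarrow>
     (\<exists>P \<in> carrier_mat (dim_row M) (dim_row M). det P \<noteq> 0 \<and> N = transpose_mat P * M * P)"

definition orth_sum_mat :: "'a::zero mat \<Rightarrow> 'a mat \<Rightarrow> 'a mat" where
  "orth_sum_mat M N =
     four_block_mat M (0\<^sub>m (dim_row M) (dim_col N)) (0\<^sub>m (dim_row N) (dim_col M)) N"

lemma congruent_mat_refl:
  assumes "square_mat M" shows "congruent_mat M M"
proof -
  have M: "M \<in> carrier_mat (dim_row M) (dim_row M)" using assms by auto
  have "M = transpose_mat (1\<^sub>m (dim_row M)) * M * 1\<^sub>m (dim_row M)"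
    using M by (metis left_mult_one_mat right_mult_one_mat transpose_one)
  then show ?thesis unfolding congruent_mat_def
    using one_carrier_mat det_one zero_neq_one by metis
qed

lemma congruent_mat_sym:
  assumes "square_mat M" "congruent_mat M N" shows "congruent_mat N M"
proof -
  define n where "n = dim_row M"
  have M: "M \<in> carrier_mat n n" using assms(1) by (auto simp: n_def)
  obtain P where P: "P \<in> carrier_mat n n" "det P \<noteq> 0" "N = transpose_mat P * M * P"
    using assms(2) by (auto simp: congruent_mat_def n_def)
  obtain Q where Q: "Q \<in> carrier_mat n n" "Q * P = 1\<^sub>m n" "P * Q = 1\<^sub>m n"
    using det_non_zero_imp_unit[OF P(1,2), of "()"]
    unfolding Units_def ring_mat_def by auto
  have dQ: "det Q \<noteq> 0"
    using det_mult[OF P(1) Q(1)] Q(3) by auto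
  have "transpose_mat Q * N * Q = (transpose_mat Q * transpose_mat P) * M * (P * Q)"
  proof -
    have "transpose_mat Q * N * Q = transpose_mat Q * (transpose_mat P * M * P) * Q"
      using P by simp
    also have "\<dots> = transpose_mat Q * (transpose_mat P * (M * P)) * Q"
      using P M Q by (simp add: assoc_mult_mat[of _ n n _ n _ n])
    also have "\<dots> = (transpose_mat Q * transpose_mat P) * (M * P) * Q"
      using P M Q by (subst assoc_mult_mat[of "transpose_mat Q" n n "transpose_mat P" n "M * P" n]) auto
    also have "\<dots> = (transpose_mat Q * transpose_mat P) * ((M * P) * Q)"
      using P M Q by (intro assoc_mult_mat[of _ n n _ n _ n]) auto
    also have "(M * P) * Q = M * (P * Q)"
      using P M Q by (intro assoc_mult_mat[of _ n n _ n _ n]) auto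
    also have "(transpose_mat Q * transpose_mat P) * (M * (P * Q)) =
        (transpose_mat Q * transpose_mat P) * M * (P * Q)"
      using P M Q by (intro assoc_mult_mat[of _ n n _ n _ n, symmetric]) auto
    finally show ?thesis .
  qed
  also have "transpose_mat Q * transpose_mat P = transpose_mat (P * Q)"
    using P Q by (intro transpose_mult[symmetric]) auto
  finally have "transpose_mat Q * N * Q = M" using Q M by simp
  moreover have "dim_row N = n" using P by simp
  ultimately show ?thesis unfolding congruent_mat_def using Q dQ by metis
qed

lemma congruent_mat_trans:
  assumes "square_mat M" "congruent_mat M N" "congruent_mat N L" shows "congruent_mat M L"
proof -
  define n where "n = dim_row M"
  have M: "M \<in> carrier_mat n n" using assms(1) by (auto simp: n_def)
  obtain P where P: "P \<in> carrier_mat n n" "det P \<noteq> 0" "N = transpose_mat P * M * P"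
    using assms(2) by (auto simp: congruent_mat_def n_def)
  have "dim_row N = n" using P by simp
  then obtain Q where Q: "Q \<in> carrier_mat n n" "det Q \<noteq> 0" "L = transpose_mat Q * N * Q"
    using assms(3) by (auto simp: congruent_mat_def)
  have "L = transpose_mat Q * (transpose_mat P * (M * P)) * Q"
    using P M Q by (simp add: assoc_mult_mat[of _ n n _ n _ n])
  also have "\<dots> = (transpose_mat Q * transpose_mat P) * (M * P) * Q"
    using P M Q by (subst assoc_mult_mat[of "transpose_mat Q" n n "transpose_mat P" n "M * P" n]) auto
  also have "\<dots> = (transpose_mat Q * transpose_mat P) * ((M * P) * Q)"
    using P M Q by (intro assoc_mult_mat[of _ n n _ n _ n]) auto
  also have "(M * P) * Q = M * (P * Q)"
    using P M Q by (intro assoc_mult_mat[of _ n n _ n _ n]) auto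
  also have "(transpose_mat Q * transpose_mat P) * (M * (P * Q)) =
      (transpose_mat Q * transpose_mat P) * M * (P * Q)"
    using P M Q by (intro assoc_mult_mat[of _ n n _ n _ n, symmetric]) auto
  also have "transpose_mat Q * transpose_mat P = transpose_mat (P * Q)"
    using P Q by (intro transpose_mult[symmetric]) auto
  finally have "L = transpose_mat (P * Q) * M * (P * Q)" .
  moreover have "det (P * Q) \<noteq> 0" using det_mult[OF P(1) Q(1)] P Q by simp
  ultimately show ?thesis unfolding congruent_mat_def n_def[symmetric]
    using P(1) Q(1) by (intro bexI[of _ "P * Q"]) auto
qed

lemma congruent_orth_sum:
  assumes sq: "square_mat M" "square_mat N" and c: "congruent_mat M M'" "congruent_mat N N'"
  shows "congruent_mat (orth_sum_mat M N) (orth_sum_mat M' N')"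
proof -
  define m n where "m = dim_row M" and "n = dim_row N"
  have M: "M \<in> carrier_mat m m" and N: "N \<in> carrier_mat n n"
    using sq by (auto simp: m_def n_def)
  obtain P where P: "P \<in> carrier_mat m m" "det P \<noteq> 0" "M' = transpose_mat P * M * P"
    using c(1) by (auto simp: congruent_mat_def m_def)
  obtain Q where Q: "Q \<in> carrier_mat n n" "det Q \<noteq> 0" "N' = transpose_mat Q * N * Q"
    using c(2) by (auto simp: congruent_mat_def n_def)
  define R where "R = four_block_mat P (0\<^sub>m m n) (0\<^sub>m n m) Q"
  have R: "R \<in> carrier_mat (m + n) (m + n)"
    unfolding R_def using P Q by (intro four_block_carrier_mat) auto
  have dR: "det R \<noteq> 0"
    unfolding R_def using det_four_block_mat_upper_right_zero[OF P(1) refl zero_carrier_mat Q(1)]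
      P Q by simp
  have S: "orth_sum_mat M N = four_block_mat M (0\<^sub>m m n) (0\<^sub>m n m) N"
    using M N by (auto simp: orth_sum_mat_def)
  have "transpose_mat R * orth_sum_mat M N * R =
      four_block_mat (transpose_mat P * M * P) (0\<^sub>m m n) (0\<^sub>m n m) (transpose_mat Q * N * Q)"
  proof -
    have "transpose_mat R = four_block_mat (transpose_mat P) (0\<^sub>m m n) (0\<^sub>m n m) (transpose_mat Q)"
      unfolding R_def using P Q by (subst transpose_four_block_mat[of _ m m _ n _ n]) auto
    then have "transpose_mat R * orth_sum_mat M N =
        four_block_mat (transpose_mat P * M) (0\<^sub>m m n) (0\<^sub>m n m) (transpose_mat Q * N)"
      unfolding S using P Q M N
      by (simp, subst mult_four_block_mat[of _ m m _ n _ n _ _ m _ n]) auto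
    then show ?thesis unfolding R_def using P Q M N
      by (simp, subst mult_four_block_mat[of _ m m _ n _ n _ _ m _ n]) auto
  qed
  also have "\<dots> = orth_sum_mat M' N'"
    using P Q by (simp add: orth_sum_mat_def)
  finally have eq: "orth_sum_mat M' N' = transpose_mat R * orth_sum_mat M N * R" ..
  have "dim_row (orth_sum_mat M N) = m + n" using M N by (simp add: orth_sum_mat_def)
  then show ?thesis unfolding congruent_mat_def using R dR eq by metis
qed

lemma congruent_orth_sum_comm:
  assumes sq: "square_mat M" "square_mat N"
  shows "congruent_mat (orth_sum_mat M N) (orth_sum_mat N M)"
proof -
  define m n where "m = dim_row M" and "n = dim_row N"
  have M: "M \<in> carrier_mat m m" and N: "N \<in> carrier_mat n n"
    using sq by (auto simp: m_def n_def)
  define R :: "'a mat" where "R = four_block_mat (0\<^sub>m m n) (1\<^sub>m m) (1\<^sub>m n) (0\<^sub>m n m)"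
  have R: "R \<in> carrier_mat (m + n) (m + n)"
    unfolding R_def carrier_mat_def by (auto simp: four_block_mat_def Let_def)
  have tR: "transpose_mat R = four_block_mat (0\<^sub>m n m) (1\<^sub>m n) (1\<^sub>m m) (0\<^sub>m m n)"
    unfolding R_def by (subst transpose_four_block_mat[of _ m n _ m _ n]) auto
  have "transpose_mat R * R = four_block_mat (1\<^sub>m n) (0\<^sub>m n m) (0\<^sub>m m n) (1\<^sub>m m)"
    unfolding tR unfolding R_def
    by (subst mult_four_block_mat[of _ n m _ n _ m _ _ n _ m]) auto
  then have RR: "transpose_mat R * R = 1\<^sub>m (m + n)"
    by (simp add: add.commute)
  have dR: "det R \<noteq> 0"
  proof
    assume "det R = 0"
    then have "det (transpose_mat R * R) = 0"
      using det_mult[of "transpose_mat R" "m + n" R] R by simp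
    then show False using RR by simp
  qed
  have S: "orth_sum_mat M N = four_block_mat M (0\<^sub>m m n) (0\<^sub>m n m) N"
    using M N by (auto simp: orth_sum_mat_def)
  have "transpose_mat R * orth_sum_mat M N = four_block_mat (0\<^sub>m n m) N M (0\<^sub>m m n)"
    unfolding S tR using M N by (subst mult_four_block_mat[of _ n m _ n _ m _ _ m _ n]) auto
  then have "transpose_mat R * orth_sum_mat M N * R =
      four_block_mat N (0\<^sub>m n m) (0\<^sub>m m n) M"
    unfolding R_def using M N
    by (simp, subst mult_four_block_mat[of _ n m _ n _ m _ _ n _ m]) auto
  also have "\<dots> = orth_sum_mat N M"
    using M N by (simp add: orth_sum_mat_def)
  finally have eq: "orth_sum_mat N M = transpose_mat R * orth_sum_mat M N * R" ..
  have "dim_row (orth_sum_mat M N) = m + n" using M N by (simp add: orth_sum_mat_def)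
  then show ?thesis unfolding congruent_mat_def using R dR eq by metis
qed

lift_definition isometric :: "'a::field bilin_form \<Rightarrow> 'a bilin_form \<Rightarrow> bool" is congruent_mat .

lift_definition orth_sum :: "'a::field bilin_form \<Rightarrow> 'a bilin_form \<Rightarrow> 'a bilin_form" is orth_sum_mat
proof -
  fix M N :: "'a mat"
  define m n where "m = dim_row M" and "n = dim_row N"
  assume "square_mat M \<and> transpose_mat M = M \<and> det M \<noteq> 0"
    and "square_mat N \<and> transpose_mat N = N \<and> det N \<noteq> 0"
  then have M: "M \<in> carrier_mat m m" "transpose_mat M = M" "det M \<noteq> 0"
    and N: "N \<in> carrier_mat n n" "transpose_mat N = N" "det N \<noteq> 0"
    by (auto simp: m_def n_def)
  have S: "orth_sum_mat M N = four_block_mat M (0\<^sub>m m n) (0\<^sub>m n m) N"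
    using M(1) N(1) by (auto simp: orth_sum_mat_def)
  have "det (orth_sum_mat M N) \<noteq> 0"
    unfolding S using det_four_block_mat_upper_right_zero[OF M(1) refl zero_carrier_mat N(1)] M N
    by simp
  moreover have "transpose_mat (orth_sum_mat M N) = orth_sum_mat M N"
    unfolding S using M N by (subst transpose_four_block_mat[of _ m m _ n _ n]) auto
  moreover have "square_mat (orth_sum_mat M N)"
    unfolding S using M(1) N(1) by auto
  ultimately show "square_mat (orth_sum_mat M N) \<and>
      transpose_mat (orth_sum_mat M N) = orth_sum_mat M N \<and> det (orth_sum_mat M N) \<noteq> 0"
    by blast
qed

lift_definition zero_form :: "'a::field bilin_form" is "1\<^sub>m 0"
  by simp

quotient_type (overloaded) 'a isometry_class = "'a::field bilin_form" / isometric
proof (rule equivpI)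
  show "reflp (isometric :: 'a bilin_form \<Rightarrow> _)"
    by (rule reflpI, transfer) (simp add: congruent_mat_refl)
  show "symp (isometric :: 'a bilin_form \<Rightarrow> _)"
    by (rule sympI, transfer) (blast intro: congruent_mat_sym)
  show "transp (isometric :: 'a bilin_form \<Rightarrow> _)"
    by (rule transpI, transfer) (blast intro: congruent_mat_trans)
qed

instantiation isometry_class :: (field) comm_monoid_add
begin

lift_definition zero_isometry_class :: "'a isometry_class" is zero_form .

lift_definition plus_isometry_class ::
  "'a isometry_class \<Rightarrow> 'a isometry_class \<Rightarrow> 'a isometry_class" is orth_sum
  by transfer (blast intro: congruent_orth_sum)

instance
proof
  fix a b c :: "'a isometry_class"
  have "isometric (orth_sum (orth_sum A B) C) (orth_sum A (orth_sum B C))"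
    for A B C :: "'a bilin_form"
  proof transfer
    fix A B C :: "'a mat"
    assume "square_mat A \<and> transpose_mat A = A \<and> det A \<noteq> 0"
      and "square_mat B \<and> transpose_mat B = B \<and> det B \<noteq> 0"
      and "square_mat C \<and> transpose_mat C = C \<and> det C \<noteq> 0"
    then have "square_mat (orth_sum_mat (orth_sum_mat A B) C)"
      by (simp add: orth_sum_mat_def)
    moreover have "orth_sum_mat (orth_sum_mat A B) C = orth_sum_mat A (orth_sum_mat B C)"
      unfolding orth_sum_mat_def by (rule assoc_four_block_mat[symmetric])
    ultimately show "congruent_mat (orth_sum_mat (orth_sum_mat A B) C) (orth_sum_mat A (orth_sum_mat B C))"
      using congruent_mat_refl by metis
  qed
  then show "a + b + c = a + (b + c)"
    by transfer
  have "isometric (orth_sum A B) (orth_sum B A)" for A B :: "'a bilin_form"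
    by transfer (blast intro: congruent_orth_sum_comm)
  then show "a + b = b + a"
    by transfer
  have "isometric (orth_sum zero_form A) A" for A :: "'a bilin_form"
  proof transfer
    fix A :: "'a mat"
    assume A: "square_mat A \<and> transpose_mat A = A \<and> det A \<noteq> 0"
    have "orth_sum_mat (1\<^sub>m 0) A = A"
      unfolding orth_sum_mat_def by (rule eq_matI) auto
    then show "congruent_mat (orth_sum_mat (1\<^sub>m 0) A) A"
      using A congruent_mat_refl by metis
  qed
  then show "0 + a = a"
    by transfer
qed

end

text \<open>
  \<open>GW(k)\<close> is the group completion of the monoid of isometry classes under orthogonal sum; a pair
  \<open>(a, b)\<close> stands for the formal difference \<open>a - b\<close>.
\<close>

definition gw_rel ::
  "'a::field isometry_class \<times> 'a isometry_class \<Rightarrow> 'a isometry_class \<times> 'a isometry_class \<Rightarrow> bool"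
  where "gw_rel = (\<lambda>(a, b) (c, d). \<exists>e. a + d + e = c + b + e)"

quotient_type (overloaded) 'a gw = "'a::field isometry_class \<times> 'a isometry_class" / gw_rel
proof (rule equivpI)
  show "reflp (gw_rel :: 'a isometry_class \<times> _ \<Rightarrow> _)"
    by (auto simp: reflp_def gw_rel_def)
  show "symp (gw_rel :: 'a isometry_class \<times> _ \<Rightarrow> _)"
    by (rule sympI) (auto simp: gw_rel_def, metis)
  show "transp (gw_rel :: 'a isometry_class \<times> _ \<Rightarrow> _)"
  proof (rule transpI, clarsimp simp: gw_rel_def)
    fix a b c d f g e e' :: "'a isometry_class"
    assume 1: "a + d + e = c + b + e" and 2: "c + g + e' = f + d + e'"
    have "a + g + (d + e + c + e') = (a + d + e) + (c + g + e')" by (simp add: ac_simps)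
    also have "\<dots> = (c + b + e) + (f + d + e')" by (simp only: 1 2)
    also have "\<dots> = f + b + (d + e + c + e')" by (simp add: ac_simps)
    finally show "\<exists>e. a + g + e = f + b + e" by blast
  qed
qed

instantiation gw :: (field) ab_group_add
begin

lift_definition zero_gw :: "'a gw" is "(0, 0)" .

lift_definition plus_gw :: "'a gw \<Rightarrow> 'a gw \<Rightarrow> 'a gw" is "\<lambda>(a, b) (c, d). (a + c, b + d)"
proof (clarsimp simp: gw_rel_def)
  fix a b c d a' b' c' d' e e' :: "'a isometry_class"
  assume 1: "a + d + e = c + b + e" and 2: "a' + d' + e' = c' + b' + e'"
  have "a + a' + (d + d') + (e + e') = (a + d + e) + (a' + d' + e')" by (simp add: ac_simps)
  also have "\<dots> = (c + b + e) + (c' + b' + e')" by (simp only: 1 2)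
  also have "\<dots> = c + c' + (b + b') + (e + e')" by (simp add: ac_simps)
  finally show "\<exists>e. a + a' + (d + d') + e = c + c' + (b + b') + e" by blast
qed

lift_definition uminus_gw :: "'a gw \<Rightarrow> 'a gw" is "\<lambda>(a, b). (b, a)"
  by (clarsimp simp: gw_rel_def) (metis add.commute)

definition minus_gw :: "'a gw \<Rightarrow> 'a gw \<Rightarrow> 'a gw" where "minus_gw x y = x + (- y)"

instance
proof
  fix a b c :: "'a gw"
  show "a + b + c = a + (b + c)"
    by transfer (auto simp: gw_rel_def ac_simps)
  show "a + b = b + a"
    by transfer (auto simp: gw_rel_def ac_simps)
  show "0 + a = a"
    by transfer (auto simp: gw_rel_def ac_simps)
  show "- a + a = 0"
    by transfer (auto simp: gw_rel_def ac_simps)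
  show "a - b = a + - b"
    by (simp add: minus_gw_def)
qed

end

lift_definition gw_of_form :: "'a::field bilin_form \<Rightarrow> 'a gw"
  is "\<lambda>q. (abs_isometry_class q, 0)" .


section \<open>Forms on finite-dimensional \<open>k\<close>-spaces\<close>

text \<open>
  A \<open>k\<close>-vector space is a \<^type>\<open>module\<close> record whose scalars are the elements of the type \<open>'k\<close>.
  (\<open>mult\<close> and \<open>one\<close> of the record are the ring operations of the \<open>k\<close>-algebra in question.)
\<close>

definition is_basis :: "('k::field, 'v) module \<Rightarrow> 'v list \<Rightarrow> bool" where
  "is_basis V bs \<longleftrightarrow> set bs \<subseteq> carrier V \<and>
     (\<forall>v \<in> carrier V. \<exists>!c. c \<in> carrier_vec (length bs) \<and>
        v = (\<Oplus>\<^bsub>V\<^esub>i\<in>{..<length bs}. vec_index c i \<odot>\<^bsub>V\<^esub> (bs ! i)))"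

definition coords :: "('k::field, 'v) module \<Rightarrow> 'v list \<Rightarrow> 'v \<Rightarrow> 'k vec" where
  "coords V bs v = (THE c. c \<in> carrier_vec (length bs) \<and>
     v = (\<Oplus>\<^bsub>V\<^esub>i\<in>{..<length bs}. vec_index c i \<odot>\<^bsub>V\<^esub> (bs ! i)))"

definition endo_trace :: "('k::field, 'v) module \<Rightarrow> ('v \<Rightarrow> 'v) \<Rightarrow> 'k" where
  "endo_trace V \<phi> =
     (let bs = (SOME bs. is_basis V bs) in \<Sum>i<length bs. vec_index (coords V bs (\<phi> (bs ! i))) i)"

text \<open>
  The class in \<open>GW(k)\<close> of a symmetric non-degenerate bilinear form \<open>\<beta>\<close> on the finite-dimensional
  space \<open>V\<close>; a change of basis changes the Gram matrix within its isometry class.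
\<close>

definition gw_class :: "('k::field, 'v) module \<Rightarrow> ('v \<Rightarrow> 'v \<Rightarrow> 'k) \<Rightarrow> 'k gw" where
  "gw_class V \<beta> =
     (let bs = (SOME bs. is_basis V bs) in
        gw_of_form (Abs_bilin_form
          (mat (length bs) (length bs) (\<lambda>(i, j). \<beta> (bs ! i) (bs ! j)))))"

definition linear_functional :: "('k::field, 'v) module \<Rightarrow> ('v \<Rightarrow> 'k) \<Rightarrow> bool" where
  "linear_functional V \<eta> \<longleftrightarrow>
     (\<forall>u \<in> carrier V. \<forall>v \<in> carrier V. \<eta> (u \<oplus>\<^bsub>V\<^esub> v) = \<eta> u + \<eta> v) \<and>
     (\<forall>c. \<forall>v \<in> carrier V. \<eta> (c \<odot>\<^bsub>V\<^esub> v) = c * \<eta> v)"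


section \<open>Polynomials in several variables\<close>

type_synonym 'a mpoly = "(nat \<Rightarrow>\<^sub>0 nat) \<Rightarrow>\<^sub>0 'a"

definition mconst :: "'a::zero \<Rightarrow> 'a mpoly" where
  "mconst c = Poly_Mapping.single 0 c"

definition mvar :: "nat \<Rightarrow> 'a::zero_neq_one mpoly" where
  "mvar i = Poly_Mapping.single (Poly_Mapping.single i 1) 1"

definition meval :: "('a::zero \<Rightarrow> 'b::comm_semiring_1) \<Rightarrow> (nat \<Rightarrow> 'b) \<Rightarrow> 'a mpoly \<Rightarrow> 'b" where
  "meval \<phi> \<sigma> p =
     (\<Sum>m\<in>Poly_Mapping.keys p. \<phi> (Poly_Mapping.lookup p m) *
        (\<Prod>i\<in>Poly_Mapping.keys m. \<sigma> i ^ Poly_Mapping.lookup m i))"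

definition mpderiv :: "nat \<Rightarrow> 'a::comm_semiring_1 mpoly \<Rightarrow> 'a mpoly" where
  "mpderiv j p =
     (\<Sum>m\<in>Poly_Mapping.keys p. Poly_Mapping.single (m - Poly_Mapping.single j 1)
        (of_nat (Poly_Mapping.lookup m j) * Poly_Mapping.lookup p m))"

text \<open>\<open>polys n\<close> is \<open>k[x\<^sub>1, \<dots>, x\<^sub>n]\<close>.\<close>

definition polys :: "nat \<Rightarrow> 'a::zero mpoly set" where
  "polys n = {p. \<forall>m\<in>Poly_Mapping.keys p. Poly_Mapping.keys m \<subseteq> {1..n}}"


section \<open>The local \<open>\<bbbA>\<^sup>1\<close>-degree\<close>

text \<open>
  A closed point of \<open>\<bbbA>\<^sup>n\<close> is a maximal ideal \<open>\<mm>\<close> of \<open>k[x\<^sub>1, \<dots>, x\<^sub>n]\<close>. The localization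
  \<open>k[x\<^sub>1, \<dots>, x\<^sub>n]\<^sub>\<mm>\<close> is taken inside the field of fractions.
\<close>

definition localization :: "nat \<Rightarrow> 'k::field mpoly set \<Rightarrow> 'k mpoly fract ring" where
  "localization n \<mm> =
     \<lparr>carrier = {Fract g h | g h. g \<in> polys n \<and> h \<in> polys n \<and> h \<notin> \<mm>},
      monoid.mult = (*), one = 1, ring.zero = 0, add = (+)\<rparr>"

definition zero_ideal ::
  "nat \<Rightarrow> 'k::field mpoly set \<Rightarrow> (nat \<Rightarrow> 'k mpoly) \<Rightarrow> 'k mpoly fract set" where
  "zero_ideal n \<mm> f = genideal (localization n \<mm>) ((\<lambda>i. Fract (f i) 1) ` {1..n})"

definition residue_class ::
  "nat \<Rightarrow> 'k::field mpoly set \<Rightarrow> (nat \<Rightarrow> 'k mpoly) \<Rightarrow> 'k mpoly \<Rightarrow> 'k mpoly fract set" where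
  "residue_class n \<mm> f g = zero_ideal n \<mm> f +>\<^bsub>localization n \<mm>\<^esub> Fract g 1"

text \<open>The \<open>k\<close>-algebra \<open>A = k[x\<^sub>1, \<dots>, x\<^sub>n]\<^sub>\<mm> / (f\<^sub>1, \<dots>, f\<^sub>n)\<close>.\<close>

definition local_algebra ::
  "nat \<Rightarrow> 'k::field mpoly set \<Rightarrow> (nat \<Rightarrow> 'k mpoly) \<Rightarrow> ('k, 'k mpoly fract set) module" where
  "local_algebra n \<mm> f =
     (let A = localization n \<mm> Quot zero_ideal n \<mm> f in
        \<lparr>carrier = carrier A, monoid.mult = monoid.mult A, one = \<one>\<^bsub>A\<^esub>, ring.zero = \<zero>\<^bsub>A\<^esub>, add = add A,
         module.smult = (\<lambda>c a. residue_class n \<mm> f (mconst c) \<otimes>\<^bsub>A\<^esub> a)\<rparr>)"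

text \<open>
  \<open>k[X, Y]\<close> is \<open>k[x\<^sub>1, \<dots>, x\<^bsub>2n\<^esub>]\<close>, with \<open>X\<^sub>i = x\<^sub>i\<close> and \<open>Y\<^sub>i = x\<^bsub>n+i\<^esub>\<close>; so \<open>g \<in> polys n\<close>
  is its own copy \<open>g(X)\<close>, and \<open>in_Y n g\<close> is \<open>g(Y)\<close>.
\<close>

definition in_Y :: "nat \<Rightarrow> 'k::comm_ring_1 mpoly \<Rightarrow> 'k mpoly" where
  "in_Y n g = meval mconst (\<lambda>i. mvar (n + i)) g"

definition difference_coeffs ::
  "nat \<Rightarrow> (nat \<Rightarrow> 'k::field mpoly) \<Rightarrow> (nat \<Rightarrow> nat \<Rightarrow> 'k mpoly) \<Rightarrow> bool" where
  "difference_coeffs n f \<Delta> \<longleftrightarrow>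
     (\<forall>i\<in>{1..n}. \<forall>j\<in>{1..n}. \<Delta> i j \<in> polys (2 * n)) \<and>
     (\<forall>j\<in>{1..n}. f j - in_Y n (f j) = (\<Sum>i\<in>{1..n}. \<Delta> i j * (mvar i - mvar (n + i))))"

text \<open>
  An expression \<open>det \<Delta> = \<Sum>\<^sub>l g\<^sub>l(X) h\<^sub>l(Y)\<close>, which exists because \<open>k[X, Y] = k[X] \<otimes> k[Y]\<close>,
  exhibits the image of \<open>det \<Delta>\<close> in \<open>A \<otimes>\<^sub>k A\<close> as \<open>\<Sum>\<^sub>l a\<^sub>l \<otimes> b\<^sub>l\<close> with \<open>a\<^sub>l\<close>, \<open>b\<^sub>l\<close> the residue
  classes of \<open>g\<^sub>l\<close>, \<open>h\<^sub>l\<close>. For linear \<open>\<eta>\<close> the element \<open>\<Sum>\<^sub>l \<eta>(a\<^sub>l) b\<^sub>l = (\<eta> \<otimes> id)(\<Sum>\<^sub>l a\<^sub>l \<otimes> b\<^sub>l)\<close>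
  does not depend on the expression.
\<close>

definition scheja_storch_functional ::
  "nat \<Rightarrow> 'k::field mpoly set \<Rightarrow> (nat \<Rightarrow> 'k mpoly) \<Rightarrow> (nat \<Rightarrow> nat \<Rightarrow> 'k mpoly) \<Rightarrow>
     ('k mpoly fract set \<Rightarrow> 'k) \<Rightarrow> bool" where
  "scheja_storch_functional n \<mm> f \<Delta> \<eta> \<longleftrightarrow>
     (let A = local_algebra n \<mm> f; r = residue_class n \<mm> f in
        linear_functional A \<eta> \<and>
        (\<exists>gs hs. length gs = length hs \<and> set gs \<subseteq> polys n \<and> set hs \<subseteq> polys n \<and>
           det (mat n n (\<lambda>(i, j). \<Delta> (Suc i) (Suc j))) = (\<Sum>l<length gs. gs ! l * in_Y n (hs ! l)) \<and>
           (\<Oplus>\<^bsub>A\<^esub>l\<in>{..<length gs}. \<eta> (r (gs ! l)) \<odot>\<^bsub>A\<^esub> r (hs ! l)) = \<one>\<^bsub>A\<^esub>))"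

text \<open>The class is independent of the choice of \<open>\<Delta>\<close>, and \<open>\<eta>\<close> is determined on \<open>A\<close> by \<open>\<Delta>\<close>.\<close>

definition local_A1_degree ::
  "nat \<Rightarrow> 'k::field mpoly set \<Rightarrow> (nat \<Rightarrow> 'k mpoly) \<Rightarrow> 'k gw" where
  "local_A1_degree n \<mm> f =
     (THE w. \<exists>\<Delta> \<eta>. difference_coeffs n f \<Delta> \<and> scheja_storch_functional n \<mm> f \<Delta> \<eta> \<and>
        w = gw_class (local_algebra n \<mm> f) (\<lambda>u v. \<eta> (u \<otimes>\<^bsub>local_algebra n \<mm> f\<^esub> v)))"


section \<open>Extension fields inside the algebraic closure and the trace form\<close>

definition field_extension :: "'k::field alg_closure set \<Rightarrow> ('k, 'k alg_closure) module" where
  "field_extension L =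
     \<lparr>carrier = L, monoid.mult = (*), one = 1, ring.zero = 0, add = (+), module.smult = (\<lambda>c z. to_ac c * z)\<rparr>"

definition separable_extension :: "'k::field alg_closure set \<Rightarrow> bool" where
  "separable_extension L \<longleftrightarrow>
     (\<forall>z\<in>L. \<exists>p :: 'k poly. Factorial_Ring.irreducible p \<and> poly (map_poly to_ac p) z = 0 \<and>
        rsquarefree (map_poly to_ac p))"

definition field_trace :: "'k::field alg_closure set \<Rightarrow> 'k alg_closure \<Rightarrow> 'k" where
  "field_trace L a = endo_trace (field_extension L) (\<lambda>z. a * z)"

definition rank_one_form :: "'a::field \<Rightarrow> 'a \<Rightarrow> 'a \<Rightarrow> 'a" where
  "rank_one_form a = (\<lambda>z w. a * z * w)"

text \<open>
  \<open>gw_trace L \<beta>\<close> is the class \<open>Tr\<^bsub>L/k\<^esub>[\<beta>]\<close>, for \<open>\<beta>\<close> a non-degenerate symmetric \<open>L\<close>-bilinear form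
  on the one-dimensional space \<open>L\<close>.
\<close>

definition gw_trace ::
  "'k::field alg_closure set \<Rightarrow> ('k alg_closure \<Rightarrow> 'k alg_closure \<Rightarrow> 'k alg_closure) \<Rightarrow> 'k gw" where
  "gw_trace L \<beta> = gw_class (field_extension L) (\<lambda>z w. field_trace L (\<beta> z w))"


section \<open>Circles\<close>

text \<open>
  A point of \<open>\<bbbP>\<^sup>3\<close> is given by homogeneous coordinates \<open>p 0, \<dots>, p 3\<close>, not all zero; values
  \<open>p i\<close> with \<open>i > 3\<close> are never used. A closed point of \<open>\<bbbP>\<^sup>3\<^sub>k\<close> is given by any geometric point
  over it, i.e. by coordinates in the algebraic closure of \<open>k\<close>.
\<close>

definition circle_form :: "(nat \<Rightarrow> 'a::field) \<Rightarrow> 'a \<Rightarrow> 'a \<Rightarrow> 'a \<Rightarrow> 'a" where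
  "circle_form p x y z = p 0 * (x\<^sup>2 + y\<^sup>2) + z * (p 1 * x + p 2 * y + p 3 * z)"

definition center_x :: "(nat \<Rightarrow> 'a::field) \<Rightarrow> 'a" where
  "center_x p = - (p 1 / p 0) / 2"

definition center_y :: "(nat \<Rightarrow> 'a::field) \<Rightarrow> 'a" where
  "center_y p = - (p 2 / p 0) / 2"

definition radius_sq :: "(nat \<Rightarrow> 'a::field) \<Rightarrow> 'a" where
  "radius_sq p = (center_x p)\<^sup>2 + (center_y p)\<^sup>2 - p 3 / p 0"

definition residue_field :: "(nat \<Rightarrow> 'k::field alg_closure) \<Rightarrow> 'k alg_closure set" where
  "residue_field s = generate_field ring_of_type_algebra
     (range to_ac \<union> {s i / s j | i j. i \<le> 3 \<and> j \<le> 3 \<and> s j \<noteq> 0})"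

text \<open>In \<open>k[c\<^sub>0, \<dots>, c\<^sub>3]\<close>, the variable \<open>c\<^sub>j\<close> is \<open>mvar j\<close>.\<close>

definition tangency_quadric :: "(nat \<Rightarrow> 'k::field) \<Rightarrow> 'k mpoly" where
  "tangency_quadric p =
     (let a = center_x p; b = center_y p; r2 = radius_sq p;
          X\<^sub>p = mvar 1 + mconst (2 * a) * mvar 0;
          Y\<^sub>p = mvar 2 + mconst (2 * b) * mvar 0;
          Z\<^sub>p = mvar 3 - mconst (a\<^sup>2 + b\<^sup>2 - r2) * mvar 0
      in (mconst a * X\<^sub>p + mconst b * Y\<^sub>p + Z\<^sub>p)\<^sup>2 - mconst r2 * (X\<^sub>p\<^sup>2 + Y\<^sub>p\<^sup>2))"

definition tangency_cone :: "(nat \<Rightarrow> 'k::field) \<Rightarrow> (nat \<Rightarrow> 'k alg_closure) set" where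
  "tangency_cone p =
     {c. (\<exists>j\<in>{0..3}. c j \<noteq> 0) \<and> meval to_ac c (tangency_quadric p) = 0}"

definition meet_transversely :: "(nat \<Rightarrow> nat \<Rightarrow> 'k::field) \<Rightarrow> bool" where
  "meet_transversely C \<longleftrightarrow>
     (\<forall>c \<in> (\<Inter>i\<in>{1..3}. tangency_cone (C i)). \<forall>t :: nat \<Rightarrow> 'k alg_closure.
        (\<forall>j\<in>{0..3}. (\<Sum>i\<in>{1..3}. t i * meval to_ac c (mpderiv j (tangency_quadric (C i)))) = 0) \<longrightarrow>
        (\<forall>i\<in>{1..3}. t i = 0))"

text \<open>
  The affine chart \<open>c\<^sub>0 \<noteq> 0\<close> has coordinates \<open>x\<^sub>i = c\<^sub>i / c\<^sub>0\<close>; here \<open>q / c\<^sub>0\<^sup>2\<close> is \<open>q\<close> with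
  \<open>c\<^sub>0\<close> replaced by \<open>1\<close>.
\<close>

definition chart_point_ideal :: "(nat \<Rightarrow> 'k::field alg_closure) \<Rightarrow> 'k mpoly set" where
  "chart_point_ideal s = {g \<in> polys 3. meval to_ac (\<lambda>i. s i / s 0) g = 0}"

definition dehomogenize :: "'k::field mpoly \<Rightarrow> 'k mpoly" where
  "dehomogenize q = meval mconst (\<lambda>i. if i = 0 then 1 else mvar i) q"

text \<open>
  The local index at \<open>s\<close>, \<open>s 0 \<noteq> 0\<close>, of the section \<open>(q\<^sub>1, q\<^sub>2, q\<^sub>3)\<close> of \<open>\<O>(2)\<^sup>3\<close>, computed in
  the standard chart.
\<close>

definition local_index :: "(nat \<Rightarrow> nat \<Rightarrow> 'k::field) \<Rightarrow> (nat \<Rightarrow> 'k alg_closure) \<Rightarrow> 'k gw" where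
  "local_index C s =
     local_A1_degree 3 (chart_point_ideal s) (\<lambda>i. dehomogenize (tangency_quadric (C i)))"

text \<open>In the following, \<open>(a, b)\<close> and \<open>(x, y)\<close> are families of points indexed by \<open>{1, 2, 3}\<close>.\<close>

definition area_u ::
  "(nat \<Rightarrow> 'a::field) \<Rightarrow> (nat \<Rightarrow> 'a) \<Rightarrow> 'a \<Rightarrow> 'a \<Rightarrow> (nat \<Rightarrow> 'a) \<Rightarrow> (nat \<Rightarrow> 'a) \<Rightarrow> nat \<Rightarrow> 'a" where
  "area_u a b as bs x y i = (a i - x i) * (a i - as) + (b i - y i) * (b i - bs)"

definition area_v ::
  "(nat \<Rightarrow> 'a::field) \<Rightarrow> (nat \<Rightarrow> 'a) \<Rightarrow> 'a \<Rightarrow> 'a \<Rightarrow> (nat \<Rightarrow> 'a) \<Rightarrow> (nat \<Rightarrow> 'a) \<Rightarrow> nat \<Rightarrow> 'a" where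
  "area_v a b as bs x y i = (a i - x i) * (x i - as) + (b i - y i) * (y i - bs)"

definition area :: "(nat \<Rightarrow> 'a::field) \<Rightarrow> (nat \<Rightarrow> 'a) \<Rightarrow> 'a \<Rightarrow> 'a \<Rightarrow> (nat \<Rightarrow> 'a) \<Rightarrow> (nat \<Rightarrow> 'a) \<Rightarrow> 'a" where
  "area a b as bs x y =
     (let u = area_u a b as bs x y; v = area_v a b as bs x y in
        \<Sum>(i, m, n) \<in> {(i, m, n). {i, m, n} = {1, 2, 3} \<and> m < n}.
          (-1) ^ (i + 1) * u i * v m * v n *
          ((a m - as) * (b n - bs) - (a n - as) * (b m - bs)))"

end

theory Submission
  imports Defs
begin


text \<open>
  The zero \<open>s\<close> of \<open>f = (q\<^sub>1, q\<^sub>2, q\<^sub>3)\<close> is simple, and its local degree is \<open>Tr\<langle>J\<rangle>\<close> for the Jacobian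
  determinant \<open>J\<close> at \<open>s\<close>. By Cramer's rule, \<open>det \<Delta>\<close> multiplies \<open>X\<^sub>i - Y\<^sub>i\<close> into the ideal
  \<open>(f\<^sub>j(X) - f\<^sub>j(Y))\<close>. Substituting \<open>Y = s\<close> and contracting the coefficients with a \<open>k\<close>-linear
  functional of the algebraic closure gives a polynomial that does not vanish at \<open>s\<close> and multiplies
  the maximal ideal into \<open>(f\<^sub>j)\<close>; so the local algebra is \<open>L = k(s)\<close>. The same relation says that
  the image \<open>\<Sum> a\<^sub>l \<otimes> b\<^sub>l\<close> of \<open>det \<Delta>\<close> in \<open>L \<otimes> L\<close> is annihilated by \<open>z \<otimes> 1 - 1 \<otimes> z\<close>. Hence
  \<open>z = \<Sum> a\<^sub>l \<eta>(b\<^sub>l z)\<close>, multiplication by \<open>w\<close> is a sum of operators of rank one, and its trace is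
  \<open>\<eta>(w \<Sum> a\<^sub>l b\<^sub>l) = \<eta>(w J)\<close>. So \<open>\<eta>(u v) = Tr(u v / J)\<close>, which is isometric to \<open>Tr(J u v)\<close>.

  In the affine chart, the gradient of \<open>q\<^sub>i\<close> at \<open>s\<close> is \<open>4 u\<^sub>i (x\<^sub>i, y\<^sub>i, 1)\<close>. Since
  \<open>u\<^sub>i (x\<^sub>i - a\<^sub>s, y\<^sub>i - b\<^sub>s) = v\<^sub>i (a\<^sub>i - a\<^sub>s, b\<^sub>i - b\<^sub>s)\<close>, it follows that \<open>J = 64 Area(s)\<close>.
\<close>

section \<open>Polynomials in several variables\<close>

text \<open>\<open>local_A1_degree\<close> is a description over all pairs (\<open>\<Delta>\<close>,
  \<open>\<eta>\<close>), so an admissible pair has to be constructed and all pairs must give one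
  class. Tensor products are never formed: an identity in L \<otimes> L is stated as the family of
  identities obtained by applying k-linear functionals of the closure to the second factor. The
  definition normalizes \<open>\<eta>\<close> on the first factor, whereas the rank-one expansion
  needs it on the second; \<open>contraction_symmetric\<close> bridges the two. The degree of L over
  k is not known beforehand: finite dimension comes out of the same expansion, since the elements
  a_l occurring in it span L. The scaling that relates the trace forms is multiplication by 1/(c d)
  whenever J = c d^2; since 64 = 8^2, this allows c = Area(s) and d = 8. Transversality concerns
  four partial derivatives on projective space; Euler's relation, together with the vanishing of the
  quadrics at s, eliminates the one in direction c_0 and leaves the 3 by 3 Jacobian of the
  chart.\<close>

lemma mpoly_eq_sum_single:
  "p = (\<Sum>m\<in>Poly_Mapping.keys p. Poly_Mapping.single m (Poly_Mapping.lookup p m))"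
  by (rule poly_mapping_eqI)
    (auto simp: lookup_sum lookup_single when_def in_keys_iff sum.delta)

lemma mconst_0 [simp]: "mconst 0 = 0"
  and mconst_1 [simp]: "mconst 1 = 1"
  and mconst_add: "mconst (a + b) = mconst a + mconst b"
  and mconst_mult: "mconst (c * d) = mconst c * mconst d"
  for a b :: "'a::monoid_add" and c d :: "'b::semiring_0"
  by (simp_all add: mconst_def single_add mult_single)

lemma mconst_hom: "comm_ring_hom (mconst :: 'a::comm_ring_1 \<Rightarrow> _)"
  by unfold_locales (auto simp: mconst_add mconst_mult)

lemma mvar_power: "mvar i ^ n = Poly_Mapping.single (Poly_Mapping.single i n) (1::'a::comm_semiring_1)"
proof (induction n)
  case 0 then show ?case by (simp add: single_one[symmetric] del: single_one)
next
  case (Suc n) then show ?case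
    by (simp add: mvar_def mult_single single_add[symmetric])
qed

lemma single_eq_prod_mvar:
  "Poly_Mapping.single m c =
     mconst c * (\<Prod>i\<in>Poly_Mapping.keys m. mvar i ^ Poly_Mapping.lookup m i)"
  for c :: "'a::comm_semiring_1"
proof (induction m rule: update_induct)
  case const then show ?case by (simp add: mconst_def)
next
  case (update f a b)
  have u: "Poly_Mapping.update a b f = f + Poly_Mapping.single a b"
    using update(1) by (intro poly_mapping_eqI)
      (auto simp: lookup_update lookup_add lookup_single when_def in_keys_iff)
  have k: "Poly_Mapping.keys (Poly_Mapping.update a b f) = insert a (Poly_Mapping.keys f)"
    using update by (simp add: keys_update)
  have "(\<Prod>i\<in>Poly_Mapping.keys f. mvar i ^ Poly_Mapping.lookup (Poly_Mapping.update a b f) i) =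
      (\<Prod>i\<in>Poly_Mapping.keys f. mvar i ^ Poly_Mapping.lookup f i :: 'a mpoly)"
    using update(1) by (intro prod.cong) (auto simp: lookup_update)
  then have "mconst c * (\<Prod>i\<in>Poly_Mapping.keys (Poly_Mapping.update a b f).
       mvar i ^ Poly_Mapping.lookup (Poly_Mapping.update a b f) i) = Poly_Mapping.single f c * mvar a ^ b"
    using update(1,3) k by (simp add: lookup_update ac_simps)
  also have "\<dots> = Poly_Mapping.single (Poly_Mapping.update a b f) c"
    by (simp add: mvar_power mult_single u)
  finally show ?case ..
qed

section \<open>The subring of polynomials in the first n variables, and induction on it\<close>

lemma polys_add: "p \<in> polys n \<Longrightarrow> q \<in> polys n \<Longrightarrow> p + q \<in> polys n"
  for p q :: "'a::monoid_add mpoly"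
  using keys_add[of p q] by (fastforce simp: polys_def)

lemma polys_mult: "p \<in> polys n \<Longrightarrow> q \<in> polys n \<Longrightarrow> p * q \<in> polys n"
  for p q :: "'a::semiring_0 mpoly"
proof -
  assume p: "p \<in> polys n" and q: "q \<in> polys n"
  show "p * q \<in> polys n"
    unfolding polys_def
  proof clarify
    fix m i assume "m \<in> Poly_Mapping.keys (p * q)" and i: "i \<in> Poly_Mapping.keys m"
    then obtain a b where "m = a + b" "a \<in> Poly_Mapping.keys p" "b \<in> Poly_Mapping.keys q"
      using keys_mult[of p q] by blast
    then show "i \<in> {1..n}" using i keys_add[of a b] p q by (fastforce simp: polys_def)
  qed
qed

lemma polys_mconst [simp]: "mconst c \<in> polys n"
  by (simp add: polys_def mconst_def)

lemma polys_0 [simp]: "0 \<in> polys n"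
  and polys_1 [simp]: "1 \<in> polys n"
  by (simp_all add: polys_def)

lemma polys_mvar: "i \<in> {1..n} \<Longrightarrow> mvar i \<in> polys n"
  by (auto simp: polys_def mvar_def split: if_splits)

lemma polys_uminus: "p \<in> polys n \<Longrightarrow> - p \<in> polys n" for p :: "'a::comm_ring_1 mpoly"
proof -
  have "mconst (- 1) = (- 1 :: 'a mpoly)" by (simp add: mconst_def single_uminus)
  then show "p \<in> polys n \<Longrightarrow> - p \<in> polys n" using polys_mult[of "mconst (- 1)" n p] by (metis mult_minus1 polys_mconst)
qed

lemma polys_diff: "p \<in> polys n \<Longrightarrow> q \<in> polys n \<Longrightarrow> p - q \<in> polys n" for p q :: "'a::comm_ring_1 mpoly"
  using polys_add[of p n "- q"] polys_uminus[of q n] by simp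

lemma polys_sum: "(\<And>i. i \<in> I \<Longrightarrow> f i \<in> polys n) \<Longrightarrow> sum f I \<in> polys n"
  for f :: "_ \<Rightarrow> 'a::comm_monoid_add mpoly"
  by (induction I rule: infinite_finite_induct) (auto intro: polys_add)

lemma polys_prod: "(\<And>i. i \<in> I \<Longrightarrow> f i \<in> polys n) \<Longrightarrow> prod f I \<in> polys n"
  for f :: "_ \<Rightarrow> 'a::comm_semiring_1 mpoly"
  by (induction I rule: infinite_finite_induct) (auto intro: polys_mult)

lemma polys_mono: "m \<le> n \<Longrightarrow> polys m \<subseteq> polys n"
  by (fastforce simp: polys_def)

text \<open>The variable case is demanded only for variables that occur in p. This is what lets
  \<open>polys_induct\<close> restrict its variable case to indices in {1..n}.\<close>

lemma mpoly_induct_vars: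
  fixes p :: "'a::comm_semiring_1 mpoly"
  assumes vars: "\<And>m i. m \<in> Poly_Mapping.keys p \<Longrightarrow> i \<in> Poly_Mapping.keys m \<Longrightarrow> P (mvar i)"
    and const: "\<And>c. P (mconst c)"
    and add: "\<And>p q. P p \<Longrightarrow> P q \<Longrightarrow> P (p + q)"
    and mult: "\<And>p q. P p \<Longrightarrow> P q \<Longrightarrow> P (p * q)"
  shows "P p"
proof -
  have 0: "P 0" and 1: "P 1" using const[of 0] const[of 1] by simp_all
  have pow: "P (q ^ k)" if "P q" for q k by (induction k) (auto simp: 1 intro: that mult)
  have pr: "P (\<Prod>i\<in>I. f i)" if "\<And>i. i \<in> I \<Longrightarrow> P (f i)" for I and f :: "nat \<Rightarrow> _"
    using that by (induction I rule: infinite_finite_induct) (auto simp: 1 intro: mult)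
  have su: "P (\<Sum>i\<in>I. f i)" if "\<And>i. i \<in> I \<Longrightarrow> P (f i)" for I and f :: "(nat \<Rightarrow>\<^sub>0 nat) \<Rightarrow> _"
    using that by (induction I rule: infinite_finite_induct) (auto simp: 0 intro: add)
  show ?thesis
    by (subst mpoly_eq_sum_single, rule su, subst single_eq_prod_mvar, intro mult const pr pow vars)
qed

lemma mpoly_induct [case_names const var add mult]:
  fixes p :: "'a::comm_semiring_1 mpoly"
  assumes "\<And>c. P (mconst c)" "\<And>i. P (mvar i)"
    "\<And>p q. P p \<Longrightarrow> P q \<Longrightarrow> P (p + q)" "\<And>p q. P p \<Longrightarrow> P q \<Longrightarrow> P (p * q)"
  shows "P p"
  by (rule mpoly_induct_vars) (use assms in auto)

lemma polys_induct [consumes 1, case_names const var add mult]: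
  fixes p :: "'a::comm_semiring_1 mpoly"
  assumes p: "p \<in> polys n" and "\<And>c. P (mconst c)" "\<And>i. i \<in> {1..n} \<Longrightarrow> P (mvar i)"
    "\<And>p q. p \<in> polys n \<Longrightarrow> q \<in> polys n \<Longrightarrow> P p \<Longrightarrow> P q \<Longrightarrow> P (p + q)"
    "\<And>p q. p \<in> polys n \<Longrightarrow> q \<in> polys n \<Longrightarrow> P p \<Longrightarrow> P q \<Longrightarrow> P (p * q)"
  shows "P p"
proof -
  have "p \<in> polys n \<and> P p"
  proof (rule mpoly_induct_vars)
    fix m i assume "m \<in> Poly_Mapping.keys p" "i \<in> Poly_Mapping.keys m"
    then have "i \<in> {1..n}" using p unfolding polys_def by blast
    then show "mvar i \<in> polys n \<and> P (mvar i)" using assms(3) polys_mvar by simp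
  qed (simp_all add: assms polys_add polys_mult)
  then show ?thesis by simp
qed

subsection \<open>Evaluation\<close>

lemma meval_single:
  assumes "\<phi> 0 = 0"
  shows "meval \<phi> \<sigma> (Poly_Mapping.single m c) =
    \<phi> c * (\<Prod>i\<in>Poly_Mapping.keys m. \<sigma> i ^ Poly_Mapping.lookup m i)"
  using assms by (cases "c = 0") (simp_all add: meval_def)

text \<open>\<open>meval\<close> sums over the support of its argument, which changes under
  addition. Enlarging the index set by zero terms makes sums for different polynomials comparable;
  \<open>prod_keys_superset\<close> does the same for exponents.\<close>

lemma meval_superset:
  assumes "\<phi> 0 = 0" "finite M" "Poly_Mapping.keys p \<subseteq> M"
  shows "meval \<phi> \<sigma> p = (\<Sum>m\<in>M. \<phi> (Poly_Mapping.lookup p m) *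
        (\<Prod>i\<in>Poly_Mapping.keys m. \<sigma> i ^ Poly_Mapping.lookup m i))"
  unfolding meval_def using assms
  by (intro sum.mono_neutral_left) (auto simp: in_keys_iff)

lemma prod_keys_superset:
  assumes "finite I" "Poly_Mapping.keys m \<subseteq> I"
  shows "(\<Prod>i\<in>Poly_Mapping.keys m. \<sigma> i ^ Poly_Mapping.lookup m i) =
    (\<Prod>i\<in>I. (\<sigma> i :: 'b::comm_semiring_1) ^ Poly_Mapping.lookup m i)"
  using assms by (intro prod.mono_neutral_left) (auto simp: in_keys_iff)

lemma prod_keys_add:
  "(\<Prod>i\<in>Poly_Mapping.keys (m + m'). \<sigma> i ^ Poly_Mapping.lookup (m + m') i) =
    (\<Prod>i\<in>Poly_Mapping.keys m. \<sigma> i ^ Poly_Mapping.lookup m i) *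
    (\<Prod>i\<in>Poly_Mapping.keys m'. (\<sigma> i :: 'b::comm_semiring_1) ^ Poly_Mapping.lookup m' i)"
proof -
  define I where "I = Poly_Mapping.keys m \<union> Poly_Mapping.keys m'"
  have "finite I" "Poly_Mapping.keys m \<subseteq> I" "Poly_Mapping.keys m' \<subseteq> I"
    "Poly_Mapping.keys (m + m') \<subseteq> I"
    using keys_add[of m m'] by (auto simp: I_def)
  then have "(\<Prod>i\<in>Poly_Mapping.keys k. \<sigma> i ^ Poly_Mapping.lookup k i) = (\<Prod>i\<in>I. \<sigma> i ^ Poly_Mapping.lookup k i)"
    if "k \<in> {m, m', m + m'}" for k
    using that by (intro prod_keys_superset) auto
  then show ?thesis
    by (simp only: insert_iff simp_thms) (simp only: lookup_add power_add prod.distrib)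
qed

context comm_ring_hom
begin

lemma meval_add: "meval hom \<sigma> (p + q) = meval hom \<sigma> p + meval hom \<sigma> q"
proof -
  define M where "M = Poly_Mapping.keys p \<union> Poly_Mapping.keys q"
  have "finite M" "Poly_Mapping.keys p \<subseteq> M" "Poly_Mapping.keys q \<subseteq> M"
    "Poly_Mapping.keys (p + q) \<subseteq> M"
    using keys_add[of p q] by (auto simp: M_def)
  then show ?thesis
    by (simp add: meval_superset[of hom M] lookup_add hom_add distrib_right sum.distrib)
qed

lemma meval_zero [simp]: "meval hom \<sigma> 0 = 0"
  by (simp add: meval_def)

lemma meval_sum: "meval hom \<sigma> (\<Sum>i\<in>I. f i) = (\<Sum>i\<in>I. meval hom \<sigma> (f i))"
  by (induction I rule: infinite_finite_induct) (simp_all add: meval_add)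

lemma meval_single_mult:
  "meval hom \<sigma> (Poly_Mapping.single m c * Poly_Mapping.single m' c') =
   meval hom \<sigma> (Poly_Mapping.single m c) * meval hom \<sigma> (Poly_Mapping.single m' c')"
  by (simp add: mult_single meval_single prod_keys_add hom_mult ac_simps)

lemma meval_mult: "meval hom \<sigma> (p * q) = meval hom \<sigma> p * meval hom \<sigma> q"
proof -
  have "meval hom \<sigma> (p * q) = meval hom \<sigma>
    ((\<Sum>m\<in>Poly_Mapping.keys p. Poly_Mapping.single m (Poly_Mapping.lookup p m)) *
     (\<Sum>m\<in>Poly_Mapping.keys q. Poly_Mapping.single m (Poly_Mapping.lookup q m)))"
    using mpoly_eq_sum_single by metis
  also have "\<dots> =
    meval hom \<sigma> (\<Sum>m\<in>Poly_Mapping.keys p. Poly_Mapping.single m (Poly_Mapping.lookup p m)) *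
    meval hom \<sigma> (\<Sum>m\<in>Poly_Mapping.keys q. Poly_Mapping.single m (Poly_Mapping.lookup q m))"
    by (simp add: sum_product meval_sum meval_single_mult)
  finally show ?thesis using mpoly_eq_sum_single by metis
qed

lemma meval_mconst [simp]: "meval hom \<sigma> (mconst c) = hom c"
  by (simp add: mconst_def meval_single)

lemma meval_mvar [simp]: "meval hom \<sigma> (mvar i) = \<sigma> i"
  by (simp add: mvar_def meval_single)

lemma meval_hom: "comm_ring_hom (meval hom \<sigma>)"
proof unfold_locales
  show "meval hom \<sigma> 1 = 1"
    using meval_mconst[of \<sigma> 1] by simp
qed (simp_all add: meval_add meval_mult)

text \<open>Both sides are ring homomorphisms that agree on constants and variables. The lemma
  serves to compose substitutions, above all with \<phi> = \<open>mconst\<close>, where the inner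
  evaluation is a substitution of polynomials.\<close>

lemma hom_meval:
  assumes "comm_ring_hom \<phi>"
  shows "hom (meval \<phi> \<tau> p) = meval (\<lambda>c. hom (\<phi> c)) (\<lambda>i. hom (\<tau> i)) p"
proof -
  interpret \<phi>: comm_ring_hom \<phi> by fact
  interpret c: comm_ring_hom "\<lambda>c. hom (\<phi> c)"
    by unfold_locales (simp_all add: \<phi>.hom_add \<phi>.hom_mult hom_add hom_mult)
  show ?thesis
    by (induction p rule: mpoly_induct)
     (simp_all add: \<phi>.meval_add \<phi>.meval_mult hom_add hom_mult c.meval_add c.meval_mult)
qed

end

lemma meval_cong:
  assumes "p \<in> polys n" "\<And>i. i \<in> {1..n} \<Longrightarrow> \<sigma> i = \<tau> i"
  shows "meval \<phi> \<sigma> p = meval \<phi> \<tau> p"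
  unfolding meval_def
proof (intro sum.cong refl arg_cong2[where f = "(*)"] prod.cong)
  fix m i assume "m \<in> Poly_Mapping.keys p" "i \<in> Poly_Mapping.keys m"
  then have "i \<in> {1..n}" using assms(1) unfolding polys_def by blast
  then show "\<sigma> i ^ Poly_Mapping.lookup m i = \<tau> i ^ Poly_Mapping.lookup m i" by (simp add: assms(2))
qed

lemma to_ac_hom: "comm_ring_hom to_ac"
  by unfold_locales auto


section \<open>Finite extensions as vector spaces\<close>

text \<open>With the closure as a vector space over the type 'k, spans, independence and dimension
  become available. The lemmas below translate the record-based \<open>is_basis\<close> and
  \<open>coords\<close> into these notions.\<close>

interpretation ac: vector_space "\<lambda>c z. to_ac c * z :: 'k::field alg_closure"
  by unfold_locales (simp_all add: algebra_simps)

lemma abelian_monoid_field_extension: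
  assumes "ac.subspace L"
  shows "abelian_monoid (field_extension L)"
  using assms by (intro abelian_monoidI)
    (auto simp: field_extension_def ac.subspace_0 ac.subspace_add algebra_simps)

lemma finsum_field_extension:
  assumes L: "ac.subspace L" and "finite I" "f \<in> I \<rightarrow> L"
  shows "(\<Oplus>\<^bsub>field_extension L\<^esub>i\<in>I. f i) = (\<Sum>i\<in>I. f i)"
proof -
  interpret abelian_monoid "field_extension L" by (rule abelian_monoid_field_extension[OF L])
  show ?thesis using assms(2,3)
  proof (induction I rule: finite_induct)
    case empty
    have "\<zero>\<^bsub>field_extension L\<^esub> = 0" by (simp add: field_extension_def)
    then show ?case using finsum_empty[of f] by simp
  next
    case (insert i I)
    then have "f \<in> I \<rightarrow> carrier (field_extension L)" "f i \<in> carrier (field_extension L)"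
      by (auto simp: field_extension_def)
    then have "(\<Oplus>\<^bsub>field_extension L\<^esub>i\<in>insert i I. f i) =
        f i \<oplus>\<^bsub>field_extension L\<^esub> (\<Oplus>\<^bsub>field_extension L\<^esub>i\<in>I. f i)"
      using insert by (intro finsum_insert) auto
    then show ?case using insert by (simp add: field_extension_def)
  qed
qed

definition lincomb :: "'k::field vec \<Rightarrow> 'k alg_closure list \<Rightarrow> 'k alg_closure" where
  "lincomb c bs = (\<Sum>i<length bs. to_ac (c $ i) * bs ! i)"

lemma finsum_lincomb:
  assumes "ac.subspace L" "set bs \<subseteq> L"
  shows "(\<Oplus>\<^bsub>field_extension L\<^esub>i\<in>{..<length bs}. c $ i \<odot>\<^bsub>field_extension L\<^esub> (bs ! i)) = lincomb c bs"
proof -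
  have "(\<lambda>i. to_ac (c $ i) * bs ! i) \<in> {..<length bs} \<rightarrow> L"
    using assms by (auto intro!: ac.subspace_scale)
  then show ?thesis
    using finsum_field_extension[OF assms(1), of "{..<length bs}" "\<lambda>i. to_ac (c $ i) * bs ! i"]
    by (simp add: field_extension_def lincomb_def)
qed

lemma is_basis_field_extension_iff:
  assumes "ac.subspace L"
  shows "is_basis (field_extension L) bs \<longleftrightarrow> set bs \<subseteq> L \<and>
    (\<forall>v\<in>L. \<exists>!c. c \<in> carrier_vec (length bs) \<and> v = lincomb c bs)"
proof (cases "set bs \<subseteq> L")
  case True
  then show ?thesis
    unfolding is_basis_def finsum_lincomb[OF assms True] by (simp add: field_extension_def)
qed (simp add: is_basis_def field_extension_def)

lemma lincomb_diff:
  "c \<in> carrier_vec (length bs) \<Longrightarrow> d \<in> carrier_vec (length bs) \<Longrightarrow>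
    lincomb (c - d) bs = lincomb c bs - lincomb d bs"
  by (simp add: lincomb_def sum_subtractf[symmetric] algebra_simps)

lemma lincomb_distinct:
  assumes "distinct bs"
  shows "lincomb (vec (length bs) (\<lambda>i. u (bs ! i))) bs = (\<Sum>b\<in>set bs. to_ac (u b) * b)"
  using sum.reindex_bij_betw[OF bij_betw_nth[OF assms refl refl], of "\<lambda>b. to_ac (u b) * b"]
  by (simp add: lincomb_def)

text \<open>Uniqueness of coefficient vectors carries two facts at once: a repeated entry of the
  list would give two unit vectors with the same combination, and a dependency would give a second
  combination for 0. Existence of coefficients is the spanning property.\<close>

lemma is_basis_iff_independent:
  assumes L: "ac.subspace L"
  shows "is_basis (field_extension L) bs \<longleftrightarrow>
    distinct bs \<and> \<not> ac.dependent (set bs) \<and> ac.span (set bs) = L"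
proof
  assume B: "is_basis (field_extension L) bs"
  then have bs: "set bs \<subseteq> L"
    and ex1: "\<And>v. v \<in> L \<Longrightarrow> \<exists>!c. c \<in> carrier_vec (length bs) \<and> v = lincomb c bs"
    using is_basis_field_extension_iff[OF L] by auto
  have uniq: "c = d" if "c \<in> carrier_vec (length bs)" "d \<in> carrier_vec (length bs)"
    "lincomb c bs = lincomb d bs" for c d
  proof -
    have "lincomb c bs \<in> L" unfolding lincomb_def
      using L bs by (intro ac.subspace_sum ac.subspace_scale) auto
    then show ?thesis using ex1[of "lincomb c bs"] that by auto
  qed
  have dist: "distinct bs"
  proof (rule ccontr)
    assume "\<not> distinct bs"
    then obtain i j where ij: "i < length bs" "j < length bs" "i \<noteq> j" "bs ! i = bs ! j"
      by (auto simp: distinct_conv_nth)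
    have "lincomb (unit_vec (length bs) i) bs = bs ! i" if "i < length bs" for i
      using that by (simp add: lincomb_def if_distrib[of to_ac] if_distrib[of "\<lambda>c. c * _"] cong: if_cong)
    then have "lincomb (unit_vec (length bs) i) bs = lincomb (unit_vec (length bs) j) bs"
      using ij by simp
    then have "unit_vec (length bs) i = (unit_vec (length bs) j :: 'a vec)"
      by (intro uniq) auto
    then show False using ij
      by (metis index_unit_vec(1) index_unit_vec(2) zero_neq_one)
  qed
  have "\<not> ac.dependent (set bs)"
  proof
    assume "ac.dependent (set bs)"
    then obtain u v where u: "v \<in> set bs" "u v \<noteq> 0" "(\<Sum>b\<in>set bs. to_ac (u b) * b) = 0"
      using ac.dependent_finite[of "set bs"] by blast
    then have "lincomb (vec (length bs) (\<lambda>i. u (bs ! i))) bs = lincomb (0\<^sub>v (length bs)) bs"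
      using lincomb_distinct[OF dist, of u] by (simp add: lincomb_def)
    then have "vec (length bs) (\<lambda>i. u (bs ! i)) = 0\<^sub>v (length bs)"
      by (intro uniq) auto
    moreover obtain i where "i < length bs" "bs ! i = v" using u(1) by (auto simp: in_set_conv_nth)
    ultimately show False using u(2) by (metis index_vec index_zero_vec(1))
  qed
  moreover have "L \<subseteq> ac.span (set bs)"
  proof
    fix v assume "v \<in> L"
    then obtain c where c: "v = lincomb c bs" using ex1 by blast
    have "to_ac (c $ i) * bs ! i \<in> ac.span (set bs)" if "i < length bs" for i
      using ac.span_scale[OF ac.span_base[OF nth_mem[OF that]]] .
    then show "v \<in> ac.span (set bs)"
      unfolding c lincomb_def by (intro ac.span_sum) simp
  qed
  ultimately show "distinct bs \<and> \<not> ac.dependent (set bs) \<and> ac.span (set bs) = L"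
    using dist ac.span_minimal[OF bs L] by auto
next
  assume A: "distinct bs \<and> \<not> ac.dependent (set bs) \<and> ac.span (set bs) = L"
  show "is_basis (field_extension L) bs"
    unfolding is_basis_field_extension_iff[OF L]
  proof (intro conjI ballI)
    show "set bs \<subseteq> L" using A ac.span_superset by blast
    fix v assume "v \<in> L"
    then obtain u where u: "v = (\<Sum>b\<in>set bs. to_ac (u b) * b)"
      using A ac.span_finite[of "set bs"] by blast
    show "\<exists>!c. c \<in> carrier_vec (length bs) \<and> v = lincomb c bs"
    proof (rule ex1I conjI)+
      show "vec (length bs) (\<lambda>i. u (bs ! i)) \<in> carrier_vec (length bs)" by simp
      show "v = lincomb (vec (length bs) (\<lambda>i. u (bs ! i))) bs"
        using u lincomb_distinct A by metis
      fix c assume c: "c \<in> carrier_vec (length bs) \<and> v = lincomb c bs"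
      \<comment> \<open>The description finds the position of b in the list, which is unique because
        the list is distinct; so w is the difference of the two coefficient vectors, seen as a
        function on the basis.\<close>
      define w where "w b = (c - vec (length bs) (\<lambda>i. u (bs ! i))) $ (THE i. i < length bs \<and> bs ! i = b)" for b
      have w: "w (bs ! i) = c $ i - u (bs ! i)" if "i < length bs" for i
      proof -
        have "(THE j. j < length bs \<and> bs ! j = bs ! i) = i"
          using that A by (intro the_equality) (auto simp: nth_eq_iff_index_eq)
        then show ?thesis using that c by (simp add: w_def)
      qed
      have "vec (length bs) (\<lambda>i. w (bs ! i)) = c - vec (length bs) (\<lambda>i. u (bs ! i))"
        using c w by (intro eq_vecI) auto
      then have "(\<Sum>b\<in>set bs. to_ac (w b) * b) = lincomb c bs - lincomb (vec (length bs) (\<lambda>i. u (bs ! i))) bs"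
        using lincomb_distinct[of bs w] lincomb_diff[of c bs "vec (length bs) (\<lambda>i. u (bs ! i))"] A c
        by simp
      also have "\<dots> = 0" using c u lincomb_distinct[of bs u] A by simp
      finally have 0: "(\<Sum>b\<in>set bs. to_ac (w b) * b) = 0" .
      have "w b = 0" if "b \<in> set bs" for b
        using ac.independentD[of "set bs" "set bs" w b] A 0 that by simp
      then have "c $ i = u (bs ! i)" if "i < length bs" for i
        using w[OF that] nth_mem[OF that] by simp
      then show "c = vec (length bs) (\<lambda>i. u (bs ! i))"
        using c by (intro eq_vecI) simp_all
    qed
  qed
qed

lemma finite_span_ex_basis:
  assumes "finite S" "ac.span S = L"
  shows "\<exists>bs. is_basis (field_extension L) bs"
proof -
  have L: "ac.subspace L" using assms(2) ac.subspace_span by blast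
  obtain B where B: "B \<subseteq> S" "\<not> ac.dependent B" "S \<subseteq> ac.span B"
    using ac.maximal_independent_subset[of S] by blast
  then have "ac.span B = L"
    using assms(2) by (metis ac.span_mono ac.span_span subset_antisym)
  moreover obtain bs where "distinct bs" "set bs = B"
    using B(1) assms(1) finite_subset finite_distinct_list by metis
  ultimately show ?thesis using B(2) is_basis_iff_independent[OF L] by blast
qed

lemma basis_length_unique:
  assumes L: "ac.subspace L" and "is_basis (field_extension L) bs" "is_basis (field_extension L) bs'"
  shows "length bs = length bs'"
  using assms(2,3) unfolding is_basis_iff_independent[OF L]
  by (metis ac.dim_eq_card distinct_card)

subsection \<open>Coordinates\<close>

lemma coords_basis:
  assumes L: "ac.subspace L" and B: "is_basis (field_extension L) bs" and "v \<in> L"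
  shows "coords (field_extension L) bs v \<in> carrier_vec (length bs)"
    and "lincomb (coords (field_extension L) bs v) bs = v"
proof -
  have bs: "set bs \<subseteq> L" and e: "\<exists>!c. c \<in> carrier_vec (length bs) \<and> v = lincomb c bs"
    using assms is_basis_field_extension_iff[OF L] by auto
  from theI'[OF e] show "coords (field_extension L) bs v \<in> carrier_vec (length bs)"
    "lincomb (coords (field_extension L) bs v) bs = v"
    unfolding coords_def finsum_lincomb[OF L bs] by auto
qed

lemma coords_eqI:
  assumes L: "ac.subspace L" and B: "is_basis (field_extension L) bs" and "v \<in> L"
    and "c \<in> carrier_vec (length bs)" "lincomb c bs = v"
  shows "coords (field_extension L) bs v = c"
proof -
  have bs: "set bs \<subseteq> L" and e: "\<exists>!c. c \<in> carrier_vec (length bs) \<and> v = lincomb c bs"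
    using assms is_basis_field_extension_iff[OF L] by auto
  show ?thesis unfolding coords_def finsum_lincomb[OF L bs]
    using the1_equality[OF e] assms by blast
qed

text \<open>Linearity is demanded on L only, because a functional carried over from the local
  algebra has arbitrary values outside L.\<close>

definition ac_linear_on :: "'k::field alg_closure set \<Rightarrow> ('k alg_closure \<Rightarrow> 'k) \<Rightarrow> bool" where
  "ac_linear_on L \<eta> \<longleftrightarrow> (\<forall>u\<in>L. \<forall>v\<in>L. \<eta> (u + v) = \<eta> u + \<eta> v) \<and>
     (\<forall>c. \<forall>v\<in>L. \<eta> (to_ac c * v) = c * \<eta> v)"

lemma ac_linear_on_sum:
  assumes "ac.subspace L" "ac_linear_on L \<eta>" "\<And>i. i \<in> I \<Longrightarrow> f i \<in> L"
  shows "\<eta> (\<Sum>i\<in>I. to_ac (c i) * f i) = (\<Sum>i\<in>I. c i * \<eta> (f i))"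
proof -
  have 0: "\<eta> 0 = 0"
    using assms(2) ac.subspace_0[OF assms(1)] unfolding ac_linear_on_def
    by (metis mult_zero_left to_ac_0)
  show ?thesis using assms(3)
  proof (induction I rule: infinite_finite_induct)
    case (insert i I)
    have "(\<Sum>i\<in>I. to_ac (c i) * f i) \<in> L" "to_ac (c i) * f i \<in> L"
      using insert assms(1) by (auto intro!: ac.subspace_sum ac.subspace_scale)
    then show ?case using insert assms(2) by (simp add: ac_linear_on_def)
  qed (simp_all add: 0)
qed

lemma ac_linear_on_lincomb:
  assumes "ac.subspace L" "ac_linear_on L \<eta>" "set bs \<subseteq> L"
  shows "\<eta> (lincomb c bs) = (\<Sum>i<length bs. c $ i * \<eta> (bs ! i))"
  unfolding lincomb_def using assms by (intro ac_linear_on_sum) auto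

lemma coords_linear:
  assumes L: "ac.subspace L" and B: "is_basis (field_extension L) bs" and i: "i < length bs"
  shows "ac_linear_on L (\<lambda>v. coords (field_extension L) bs v $ i)"
  unfolding ac_linear_on_def
proof (intro conjI allI ballI)
  let ?c = "coords (field_extension L) bs"
  note cb = coords_basis[OF L B]
  show "?c (u + v) $ i = ?c u $ i + ?c v $ i" if u: "u \<in> L" and v: "v \<in> L" for u v
  proof -
    have "?c (u + v) = ?c u + ?c v"
    proof (rule coords_eqI[OF L B])
      have "lincomb (?c u + ?c v) bs = lincomb (?c u) bs + lincomb (?c v) bs"
        using cb(1)[OF u] cb(1)[OF v] by (simp add: lincomb_def sum.distrib[symmetric] algebra_simps)
      then show "lincomb (?c u + ?c v) bs = u + v" using cb(2) u v by simp
    qed (use u v cb L in \<open>auto intro: ac.subspace_add\<close>)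
    then show ?thesis using cb(1)[OF v] i by simp
  qed
  show "?c (to_ac a * v) $ i = a * ?c v $ i" if v: "v \<in> L" for a v
  proof -
    have "?c (to_ac a * v) = a \<cdot>\<^sub>v ?c v"
    proof (rule coords_eqI[OF L B])
      have "lincomb (a \<cdot>\<^sub>v ?c v) bs = to_ac a * lincomb (?c v) bs"
        using cb(1)[OF v] by (simp add: lincomb_def sum_distrib_left algebra_simps)
      then show "lincomb (a \<cdot>\<^sub>v ?c v) bs = to_ac a * v" using cb(2) v by simp
    qed (use v cb L in \<open>auto intro: ac.subspace_scale\<close>)
    then show ?thesis using cb(1)[OF v] i by simp
  qed
qed

text \<open>In any basis, the operator z \<mapsto> \<Lambda>(z) b has trace \<Sum>_i \<Lambda>(b_i)
  c_i, where the c_i are the coordinates of b, and by linearity this is \<Lambda>(b). The basis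
  chosen in \<open>endo_trace\<close> thus disappears from the result.\<close>

lemma endo_trace_sum_rank_one:
  assumes L: "ac.subspace L" and ex: "\<exists>bs. is_basis (field_extension L) bs"
    and lam: "\<And>l. l < N \<Longrightarrow> ac_linear_on L (\<lambda>z. \<Lambda> l z)" and b: "\<And>l. l < N \<Longrightarrow> b l \<in> L"
    and \<phi>: "\<And>z. z \<in> L \<Longrightarrow> \<phi> z = (\<Sum>l<N. to_ac (\<Lambda> l z) * b l)"
  shows "endo_trace (field_extension L) \<phi> = (\<Sum>l<N. \<Lambda> l (b l))"
proof -
  define bs where "bs = (SOME bs. is_basis (field_extension L) bs)"
  have B: "is_basis (field_extension L) bs" using someI_ex[OF ex] by (simp add: bs_def)
  let ?c = "coords (field_extension L) bs"
  have bs: "set bs \<subseteq> L" using B is_basis_field_extension_iff[OF L] by blast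
  have "endo_trace (field_extension L) \<phi> = (\<Sum>i<length bs. ?c (\<phi> (bs ! i)) $ i)"
    by (simp add: endo_trace_def bs_def Let_def)
  also have "\<dots> = (\<Sum>i<length bs. \<Sum>l<N. \<Lambda> l (bs ! i) * ?c (b l) $ i)"
  proof (intro sum.cong refl)
    fix i assume i: "i \<in> {..<length bs}"
    then have "bs ! i \<in> L" using bs by auto
    then show "?c (\<phi> (bs ! i)) $ i = (\<Sum>l<N. \<Lambda> l (bs ! i) * ?c (b l) $ i)"
      using \<phi> ac_linear_on_sum[OF L coords_linear[OF L B], of i "{..<N}" b "\<lambda>l. \<Lambda> l (bs ! i)"] b i by simp
  qed
  also have "\<dots> = (\<Sum>l<N. \<Sum>i<length bs. ?c (b l) $ i * \<Lambda> l (bs ! i))"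
    by (subst sum.swap) (simp add: mult.commute)
  also have "\<dots> = (\<Sum>l<N. \<Lambda> l (b l))"
    using ac_linear_on_lincomb[OF L lam bs] coords_basis(2)[OF L B b] by (intro sum.cong refl) (metis lessThan_iff)
  finally show ?thesis .
qed

subsection \<open>Classes of forms\<close>

lemma gw_of_form_cong:
  assumes "square_mat M" "transpose_mat M = M" "det M \<noteq> 0" "congruent_mat M N"
    and "square_mat N" "transpose_mat N = N" "det N \<noteq> 0"
  shows "gw_of_form (Abs_bilin_form M) = gw_of_form (Abs_bilin_form N)"
proof -
  have "isometric (Abs_bilin_form M) (Abs_bilin_form N)"
    using assms by (subst isometric.abs_eq) (auto simp: eq_onp_def)
  then have "abs_isometry_class (Abs_bilin_form M) = abs_isometry_class (Abs_bilin_form N)"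
    by (simp add: isometry_class.abs_eq_iff)
  then show ?thesis by (simp add: gw_of_form_def)
qed

definition nondegenerate_form :: "'k::field alg_closure set \<Rightarrow> ('k alg_closure \<Rightarrow> 'k alg_closure \<Rightarrow> 'k) \<Rightarrow> bool" where
  "nondegenerate_form L \<beta> \<longleftrightarrow> (\<forall>u\<in>L. ac_linear_on L (\<beta> u)) \<and> (\<forall>u\<in>L. \<forall>v\<in>L. \<beta> u v = \<beta> v u) \<and>
     (\<forall>u\<in>L. (\<forall>v\<in>L. \<beta> u v = 0) \<longrightarrow> u = 0)"

abbreviation gram :: "('v \<Rightarrow> 'v \<Rightarrow> 'k) \<Rightarrow> 'v list \<Rightarrow> 'k mat" where
  "gram \<beta> bs \<equiv> mat (length bs) (length bs) (\<lambda>(i, j). \<beta> (bs ! i) (bs ! j))"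

text \<open>A null vector of the Gram matrix is the coordinate vector of an element orthogonal to
  every basis element, hence to all of L.\<close>

lemma gram_nondegenerate:
  assumes L: "ac.subspace L" and B: "is_basis (field_extension L) bs" and \<beta>: "nondegenerate_form L \<beta>"
  shows "transpose_mat (gram \<beta> bs) = gram \<beta> bs" "det (gram \<beta> bs) \<noteq> 0"
proof -
  have bs: "set bs \<subseteq> L" using B is_basis_field_extension_iff[OF L] by blast
  then have bsi: "bs ! i \<in> L" if "i < length bs" for i using that by auto
  show "transpose_mat (gram \<beta> bs) = gram \<beta> bs"
    using \<beta> bsi by (intro eq_matI) (auto simp: nondegenerate_form_def)
  show "det (gram \<beta> bs) \<noteq> 0"
  proof
    let ?n = "length bs"
    have G: "gram \<beta> bs \<in> carrier_mat ?n ?n" by simp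
    assume "det (gram \<beta> bs) = 0"
    then obtain v where v: "v \<in> carrier_vec ?n" "v \<noteq> 0\<^sub>v ?n" "gram \<beta> bs *\<^sub>v v = 0\<^sub>v ?n"
      using det_0_iff_vec_prod_zero_field[OF G] by blast
    define u where "u = lincomb v bs"
    have u: "u \<in> L" unfolding u_def lincomb_def
      using L bsi by (intro ac.subspace_sum ac.subspace_scale) auto
    have bu: "\<beta> (bs ! i) u = 0" if i: "i < ?n" for i
    proof -
      have "\<beta> (bs ! i) u = (\<Sum>j<?n. v $ j * \<beta> (bs ! i) (bs ! j))"
        using \<beta> bsi[OF i] by (simp add: u_def nondegenerate_form_def ac_linear_on_lincomb[OF L _ bs])
      also have "\<dots> = (gram \<beta> bs *\<^sub>v v) $ i"
        using i v(1) by (simp add: scalar_prod_def lessThan_atLeast0 mult.commute)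
      finally show ?thesis using v(3) i by simp
    qed
    have "\<beta> u w = 0" if w: "w \<in> L" for w
    proof -
      let ?c = "coords (field_extension L) bs w"
      have "\<beta> u (lincomb ?c bs) = (\<Sum>j<?n. ?c $ j * \<beta> u (bs ! j))"
        using \<beta> u by (simp add: nondegenerate_form_def ac_linear_on_lincomb[OF L _ bs])
      also have "\<dots> = 0" using bu \<beta> u bsi by (intro sum.neutral) (auto simp: nondegenerate_form_def)
      finally show ?thesis using coords_basis(2)[OF L B w] by simp
    qed
    then have "u = 0" using \<beta> u by (auto simp: nondegenerate_form_def)
    then have "lincomb v bs = lincomb (0\<^sub>v ?n) bs" by (simp add: u_def lincomb_def)
    then have "v = 0\<^sub>v ?n"
      using coords_eqI[OF L B u v(1)] coords_eqI[OF L B u, of "0\<^sub>v ?n"] u_def by simp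
    then show False using v(2) by simp
  qed
qed

lemma gram_congruent:
  assumes L: "ac.subspace L" and B: "is_basis (field_extension L) bs" and B': "is_basis (field_extension L) bs'"
    and \<beta>: "nondegenerate_form L \<beta>"
  shows "congruent_mat (gram \<beta> bs) (gram \<beta> bs')"
proof -
  define n where "n = length bs"
  have n: "length bs = n" "length bs' = n" using basis_length_unique[OF L B B'] by (simp_all add: n_def)
  have bs: "set bs \<subseteq> L" and bs': "set bs' \<subseteq> L"
    using B B' is_basis_field_extension_iff[OF L] by auto
  have bsi: "bs ! i \<in> L" "bs' ! i \<in> L" if "i < n" for i
    using that bs bs' n by (auto simp: subset_iff)
  let ?c = "coords (field_extension L) bs" and ?c' = "coords (field_extension L) bs'"
  \<comment> \<open>Column j of P holds the coordinates of the j-th new basis element in the old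
    basis. Q is the change in the other direction and yields the invertibility of P.\<close>
  define P where "P = mat n n (\<lambda>(i, j). ?c (bs' ! j) $ i)"
  define Q where "Q = mat n n (\<lambda>(i, j). ?c' (bs ! j) $ i)"
  have P: "P \<in> carrier_mat n n" and Q: "Q \<in> carrier_mat n n" by (auto simp: P_def Q_def)
  have PQ: "P * Q = 1\<^sub>m n"
  proof (rule eq_matI)
    fix i j assume "i < dim_row (1\<^sub>m n :: 'a mat)" "j < dim_col (1\<^sub>m n :: 'a mat)"
    then have i: "i < n" and j: "j < n" by auto
    have "(P * Q) $$ (i, j) = (\<Sum>l<n. ?c' (bs ! j) $ l * ?c (bs' ! l) $ i)"
      using i j P Q by (simp add: P_def Q_def scalar_prod_def lessThan_atLeast0 mult.commute)
    also have "\<dots> = ?c (lincomb (?c' (bs ! j)) bs') $ i"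
      using ac_linear_on_lincomb[OF L coords_linear[OF L B] bs'] i n by simp
    also have "\<dots> = ?c (bs ! j) $ i" using coords_basis(2)[OF L B'] bsi j by simp
    also have "?c (bs ! j) = unit_vec n j"
    proof (rule coords_eqI[OF L B bsi(1)[OF j]])
      show "lincomb (unit_vec n j) bs = bs ! j"
        using j n by (simp add: lincomb_def if_distrib[of to_ac] if_distrib[of "\<lambda>c. c * _"] cong: if_cong)
    qed (use n in auto)
    finally show "(P * Q) $$ (i, j) = 1\<^sub>m n $$ (i, j)" using i j by simp
  qed (use P Q in auto)
  have "det P * det Q = 1" using det_mult[OF P Q] PQ by simp
  then have dP: "det P \<noteq> 0" by auto
  have G: "gram \<beta> bs \<in> carrier_mat n n" using n by simp
  have "gram \<beta> bs' = transpose_mat P * gram \<beta> bs * P"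
  proof (rule eq_matI)
    fix j l assume "j < dim_row (transpose_mat P * gram \<beta> bs * P)" "l < dim_col (transpose_mat P * gram \<beta> bs * P)"
    then have j: "j < n" and l: "l < n" using P by auto
    have lin: "ac_linear_on L (\<beta> u)" and sym: "\<beta> u v = \<beta> v u" if "u \<in> L" "v \<in> L" for u v
      using \<beta> that by (auto simp: nondegenerate_form_def)
    have e: "\<beta> u (bs' ! l) = (\<Sum>m<n. P $$ (m, l) * \<beta> u (bs ! m))" if u: "u \<in> L" and l: "l < n" for u l
    proof -
      have "\<beta> u (lincomb (?c (bs' ! l)) bs) = (\<Sum>m<n. ?c (bs' ! l) $ m * \<beta> u (bs ! m))"
        using ac_linear_on_lincomb[OF L lin[OF u u] bs] n by simp
      then show ?thesis using coords_basis(2)[OF L B] bsi l by (simp add: P_def)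
    qed
    have "\<beta> (bs' ! j) (bs' ! l) = (\<Sum>m<n. P $$ (m, l) * \<beta> (bs ! m) (bs' ! j))"
      using e[OF bsi(2)[OF j] l] sym bsi j by simp
    also have "\<dots> = (\<Sum>m<n. P $$ (m, l) * (\<Sum>i<n. P $$ (i, j) * \<beta> (bs ! m) (bs ! i)))"
      using e[OF bsi(1) j] by simp
    also have "\<dots> = (transpose_mat P * gram \<beta> bs * P) $$ (j, l)"
    proof -
      have "(transpose_mat P * gram \<beta> bs * P) $$ (j, l) =
          (\<Sum>m<n. (transpose_mat P * gram \<beta> bs) $$ (j, m) * P $$ (m, l))"
        using P G j l n by (simp add: scalar_prod_def lessThan_atLeast0)
      also have "\<dots> = (\<Sum>m<n. P $$ (m, l) * (\<Sum>i<n. P $$ (i, j) * \<beta> (bs ! m) (bs ! i)))"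
        using P j n sym bsi by (intro sum.cong refl)
          (simp add: scalar_prod_def lessThan_atLeast0 mult.commute)
      finally show ?thesis ..
    qed
    finally show "gram \<beta> bs' $$ (j, l) = (transpose_mat P * gram \<beta> bs * P) $$ (j, l)"
      using j l n by simp
  qed (use P n in auto)
  then show ?thesis unfolding congruent_mat_def using P dP n by (intro bexI[of _ P]) auto
qed

section \<open>Transport of forms along linear bijections\<close>

lemma linear_bij_finsum:
  assumes V: "abelian_monoid V"
    and add: "\<And>u v. u \<in> carrier V \<Longrightarrow> v \<in> carrier V \<Longrightarrow> \<psi> (u \<oplus>\<^bsub>V\<^esub> v) = \<psi> u + \<psi> v"
    and zero: "\<psi> \<zero>\<^bsub>V\<^esub> = (0 :: 'b::comm_monoid_add)"
    and "finite I" "f \<in> I \<rightarrow> carrier V"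
  shows "\<psi> (\<Oplus>\<^bsub>V\<^esub>i\<in>I. f i) = (\<Sum>i\<in>I. \<psi> (f i))"
proof -
  interpret abelian_monoid V by fact
  show ?thesis using assms(4,5)
  proof (induction I rule: finite_induct)
    case (insert i I)
    then have "f \<in> I \<rightarrow> carrier V" "f i \<in> carrier V" by auto
    with insert show ?case by (simp add: add)
  qed (simp add: zero)
qed

text \<open>A linear bijection carries bases to bases, so the bases selected on the two sides yield
  Gram matrices of the one form \<beta> in two bases of L, and these are congruent. Multiplicativity
  of \<psi> is not demanded: in the application \<psi> is an isomorphism of algebras followed by a
  scaling.\<close>

theorem gw_class_transport:
  fixes V :: "('k::field, 'v) module" and \<psi> :: "'v \<Rightarrow> 'k alg_closure"
  assumes V: "abelian_monoid V" and L: "ac.subspace L"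
    and smult: "\<And>c v. v \<in> carrier V \<Longrightarrow> c \<odot>\<^bsub>V\<^esub> v \<in> carrier V"
    and \<psi>_add: "\<And>u v. u \<in> carrier V \<Longrightarrow> v \<in> carrier V \<Longrightarrow> \<psi> (u \<oplus>\<^bsub>V\<^esub> v) = \<psi> u + \<psi> v"
    and \<psi>_zero: "\<psi> \<zero>\<^bsub>V\<^esub> = 0"
    and \<psi>_smult: "\<And>c v. v \<in> carrier V \<Longrightarrow> \<psi> (c \<odot>\<^bsub>V\<^esub> v) = to_ac c * \<psi> v"
    and bij: "bij_betw \<psi> (carrier V) L"
    and form: "\<And>u v. u \<in> carrier V \<Longrightarrow> v \<in> carrier V \<Longrightarrow> \<alpha> u v = \<beta> (\<psi> u) (\<psi> v)"
    and \<beta>: "nondegenerate_form L \<beta>" and ex: "\<exists>bs. is_basis (field_extension L) bs"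
  shows "gw_class V \<alpha> = gw_class (field_extension L) \<beta>"
proof -
  have fs: "\<psi> (\<Oplus>\<^bsub>V\<^esub>i\<in>{..<length bs}. vec_index c i \<odot>\<^bsub>V\<^esub> (bs ! i)) = lincomb c (map \<psi> bs)"
    "(\<Oplus>\<^bsub>V\<^esub>i\<in>{..<length bs}. vec_index c i \<odot>\<^bsub>V\<^esub> (bs ! i)) \<in> carrier V"
    if bs: "set bs \<subseteq> carrier V" for bs c
  proof -
    have f: "(\<lambda>i. vec_index c i \<odot>\<^bsub>V\<^esub> (bs ! i)) \<in> {..<length bs} \<rightarrow> carrier V"
      using bs smult by (auto dest: nth_mem)
    show "\<psi> (\<Oplus>\<^bsub>V\<^esub>i\<in>{..<length bs}. vec_index c i \<odot>\<^bsub>V\<^esub> (bs ! i)) = lincomb c (map \<psi> bs)"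
      using linear_bij_finsum[of V \<psi>, OF V \<psi>_add \<psi>_zero _ f] bs by (simp add: lincomb_def \<psi>_smult subset_iff)
    show "(\<Oplus>\<^bsub>V\<^esub>i\<in>{..<length bs}. vec_index c i \<odot>\<^bsub>V\<^esub> (bs ! i)) \<in> carrier V"
      using abelian_monoid.finsum_closed[OF V f] .
  qed
  have inj: "\<psi> u = \<psi> v \<longleftrightarrow> u = v" if "u \<in> carrier V" "v \<in> carrier V" for u v
    using bij that by (auto simp: bij_betw_def inj_on_def)
  have im: "\<psi> ` carrier V = L" using bij by (simp add: bij_betw_def)
  have iff: "is_basis V bs \<longleftrightarrow> is_basis (field_extension L) (map \<psi> bs)" if bs: "set bs \<subseteq> carrier V" for bs
  proof -
    have "is_basis (field_extension L) (map \<psi> bs) \<longleftrightarrow>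
        (\<forall>v\<in>carrier V. \<exists>!c. c \<in> carrier_vec (length bs) \<and> \<psi> v = lincomb c (map \<psi> bs))"
    proof -
      have sub: "set (map \<psi> bs) \<subseteq> L" using bs im by auto
      show ?thesis
        unfolding is_basis_field_extension_iff[OF L]
        using sub by (simp only: simp_thms length_map ball_simps(9) im[symmetric])
    qed
    also have "\<dots> \<longleftrightarrow> is_basis V bs"
      unfolding is_basis_def using bs fs(1)[OF bs, symmetric] inj[OF _ fs(2)[OF bs]] by simp
    finally show ?thesis ..
  qed
  obtain bs0 where bs0: "is_basis (field_extension L) bs0" using ex by blast
  then have "set bs0 \<subseteq> \<psi> ` carrier V" using im is_basis_field_extension_iff[OF L] by auto
  \<comment> \<open>Pulling back a basis of L shows that V has a basis, so that the choice in
    \<open>gw_class\<close> is meaningful.\<close>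
  define as0 where "as0 = map (inv_into (carrier V) \<psi>) bs0"
  have as0: "bs0 = map \<psi> as0" "set as0 \<subseteq> carrier V"
    using \<open>set bs0 \<subseteq> \<psi> ` carrier V\<close>
    by (auto simp: as0_def map_idI f_inv_into_f subset_iff intro: inv_into_into)
  have "is_basis V as0" using iff as0 bs0 by simp
  define as where "as = (SOME bs. is_basis V bs)"
  have as: "is_basis V as" unfolding as_def by (rule someI) fact
  then have as': "set as \<subseteq> carrier V" by (simp add: is_basis_def)
  define bs where "bs = (SOME bs. is_basis (field_extension L) bs)"
  have bs: "is_basis (field_extension L) bs" unfolding bs_def by (rule someI) fact
  have b': "is_basis (field_extension L) (map \<psi> as)" using iff as as' by simp
  have "gram \<alpha> as = gram \<beta> (map \<psi> as)"
    using as' form by (intro eq_matI) (auto simp: subset_iff)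
  moreover have "gw_of_form (Abs_bilin_form (gram \<beta> (map \<psi> as))) = gw_of_form (Abs_bilin_form (gram \<beta> bs))"
    using gram_nondegenerate[OF L b' \<beta>] gram_nondegenerate[OF L bs \<beta>] gram_congruent[OF L b' bs \<beta>]
    by (intro gw_of_form_cong) simp_all
  ultimately show ?thesis unfolding gw_class_def Let_def as_def[symmetric] bs_def[symmetric] by simp
qed


section \<open>Derivatives and difference coefficients\<close>

lemma const_poly_hom: "comm_ring_hom (\<lambda>c. [:c:] :: 'a::comm_ring_1 poly)"
  by unfold_locales (simp_all add: one_pCons)

lemma pderiv_sum: "pderiv (\<Sum>i\<in>I. f i) = (\<Sum>i\<in>I. pderiv (f i))"
  by (induction I rule: infinite_finite_induct) (simp_all add: pderiv_add)

text \<open>The right-hand side is the derivative at t = 0 of p along the line \<sigma> + t e_j.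
  Partial derivatives are computed below through this formula, with the sum and product rules of
  univariate \<open>pderiv\<close>.\<close>

lemma meval_mpderiv:
  fixes \<phi> :: "'a::comm_ring_1 \<Rightarrow> 'b::idom"
  assumes "comm_ring_hom \<phi>"
  shows "meval \<phi> \<sigma> (mpderiv j p) =
    poly (pderiv (meval (\<lambda>c. [:\<phi> c:]) (\<lambda>i. [:\<sigma> i, if i = j then 1 else 0:]) p)) 0"
proof -
  interpret \<phi>: comm_ring_hom \<phi> by fact
  interpret c: comm_ring_hom "\<lambda>c. [:\<phi> c:]"
    by unfold_locales (simp_all add: \<phi>.hom_add \<phi>.hom_mult one_pCons)
  interpret k: comm_ring_hom "\<lambda>c. [:c:] :: 'b poly" by (rule const_poly_hom)
  let ?\<tau> = "\<lambda>i. [:\<sigma> i, if i = j then 1 else 0:]"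
  have single: "meval \<phi> \<sigma> (Poly_Mapping.single (m - Poly_Mapping.single j 1) (of_nat (Poly_Mapping.lookup m j) * c)) =
      poly (pderiv (meval (\<lambda>c. [:\<phi> c:]) ?\<tau> (Poly_Mapping.single m c))) 0" for m c
  proof -
    define I where "I = Poly_Mapping.keys m - {j}"
    define K where "K = (\<Prod>i\<in>I. \<sigma> i ^ Poly_Mapping.lookup m i)"
    define d where "d = Poly_Mapping.lookup m j"
    \<comment> \<open>For d = 0 the subtractions in \<open>?m\<close> and d - 1 are truncated, but
      then the factor \<open>of_nat\<close> d makes both sides vanish.\<close>
    let ?m = "m - Poly_Mapping.single j 1"
    have I: "finite I" "j \<notin> I" by (auto simp: I_def)
    have "(\<Prod>i\<in>Poly_Mapping.keys ?m. \<sigma> i ^ Poly_Mapping.lookup ?m i) =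
        (\<Prod>i\<in>insert j I. \<sigma> i ^ Poly_Mapping.lookup ?m i)"
      by (rule prod_keys_superset) (auto simp: I_def in_keys_iff lookup_minus lookup_single when_def)
    also have "\<dots> = \<sigma> j ^ (d - 1) * (\<Prod>i\<in>I. \<sigma> i ^ Poly_Mapping.lookup ?m i)"
      using I by (simp add: lookup_minus lookup_single d_def)
    also have "(\<Prod>i\<in>I. \<sigma> i ^ Poly_Mapping.lookup ?m i) = K"
      unfolding K_def using I by (intro prod.cong) (auto simp: lookup_minus lookup_single when_def)
    finally have l: "(\<Prod>i\<in>Poly_Mapping.keys ?m. \<sigma> i ^ Poly_Mapping.lookup ?m i) = \<sigma> j ^ (d - 1) * K" .
    have "(\<Prod>i\<in>Poly_Mapping.keys m. ?\<tau> i ^ Poly_Mapping.lookup m i) =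
        (\<Prod>i\<in>insert j I. ?\<tau> i ^ Poly_Mapping.lookup m i)"
      by (rule prod_keys_superset) (auto simp: I_def)
    also have "\<dots> = [:\<sigma> j, 1:] ^ d * (\<Prod>i\<in>I. ?\<tau> i ^ Poly_Mapping.lookup m i)"
      using I by (simp add: d_def)
    also have "(\<Prod>i\<in>I. ?\<tau> i ^ Poly_Mapping.lookup m i) = [:K:]"
      unfolding K_def k.hom_prod k.hom_power using I by (intro prod.cong) auto
    finally have "meval (\<lambda>c. [:\<phi> c:]) ?\<tau> (Poly_Mapping.single m c) = smult (\<phi> c * K) ([:\<sigma> j, 1:] ^ d)"
      by (simp add: meval_single mult.commute)
    moreover have "\<phi> (of_nat k) = of_nat k" for k by (induction k) (simp_all add: \<phi>.hom_add)
    ultimately show ?thesis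
      unfolding meval_single[where \<phi> = \<phi>, OF \<phi>.hom_zero] l
      by (simp add: pderiv_smult pderiv_power pderiv_pCons d_def \<phi>.hom_mult ac_simps)
  qed
  have "poly (pderiv (meval (\<lambda>c. [:\<phi> c:]) ?\<tau> p)) 0 =
      (\<Sum>m\<in>Poly_Mapping.keys p. poly (pderiv (meval (\<lambda>c. [:\<phi> c:]) ?\<tau>
          (Poly_Mapping.single m (Poly_Mapping.lookup p m)))) 0)"
    by (subst mpoly_eq_sum_single[of p]) (simp add: c.meval_sum pderiv_sum poly_sum)
  then show ?thesis unfolding mpderiv_def \<phi>.meval_sum single by simp
qed

section \<open>Two sets of variables and difference coefficients\<close>

lemma in_Y_hom: "comm_ring_hom (in_Y n :: 'k::comm_ring_1 mpoly \<Rightarrow> _)"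
  unfolding in_Y_def using comm_ring_hom.meval_hom[OF mconst_hom] .

lemma in_Y_mconst [simp]: "in_Y n (mconst c) = mconst c"
  and in_Y_mvar [simp]: "in_Y n (mvar i) = mvar (n + i)"
  for c :: "'k::comm_ring_1"
  unfolding in_Y_def by (rule comm_ring_hom.meval_mconst[OF mconst_hom] comm_ring_hom.meval_mvar[OF mconst_hom])+

lemma in_Y_polys: "h \<in> polys n \<Longrightarrow> in_Y n h \<in> polys (2 * n)" for h :: "'k::comm_ring_1 mpoly"
proof -
  interpret Y: comm_ring_hom "in_Y n :: 'k mpoly \<Rightarrow> _" by (rule in_Y_hom)
  show "h \<in> polys n \<Longrightarrow> in_Y n h \<in> polys (2 * n)"
    by (induction rule: polys_induct)
      (auto simp: Y.hom_add Y.hom_mult intro: polys_add polys_mult polys_mvar)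
qed

lemma polys_double: "g \<in> polys n \<Longrightarrow> g \<in> polys (2 * n)"
  using polys_mono[of n "2 * n"] by auto

text \<open>The set T of all such sums contains the constants and both kinds of variables and is
  closed under sums and products; a product of two terms regroups because \<open>in_Y\<close> is
  multiplicative.\<close>

lemma tensor_decomposition:
  fixes p :: "'k::comm_ring_1 mpoly"
  assumes "p \<in> polys (2 * n)"
  obtains gs hs where "length gs = length hs" "set gs \<subseteq> polys n" "set hs \<subseteq> polys n"
    "p = (\<Sum>l<length gs. gs ! l * in_Y n (hs ! l))"
proof -
  interpret Y: comm_ring_hom "in_Y n :: 'k mpoly \<Rightarrow> _" by (rule in_Y_hom)
  let ?S = "\<lambda>ps. \<Sum>(g, h)\<leftarrow>ps. g * in_Y n h"
  define T :: "'k mpoly set" where "T = {p. \<exists>ps. set ps \<subseteq> polys n \<times> polys n \<and> p = ?S ps}"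
  have T1: "g * in_Y n h \<in> T" if "g \<in> polys n" "h \<in> polys n" for g h
    unfolding T_def using that by (auto intro!: exI[of _ "[(g, h)]"])
  have T0: "0 \<in> T" unfolding T_def by (auto intro!: exI[of _ "[]"])
  have Tadd: "p + q \<in> T" if pq: "p \<in> T" "q \<in> T" for p q
  proof -
    obtain ps qs where "set ps \<subseteq> polys n \<times> polys n" "p = ?S ps" "set qs \<subseteq> polys n \<times> polys n" "q = ?S qs"
      using pq unfolding T_def by blast
    then show ?thesis unfolding T_def by (intro CollectI exI[of _ "ps @ qs"]) auto
  qed
  have Tl: "g * in_Y n h * ?S ps \<in> T" if "g \<in> polys n" "h \<in> polys n" "set ps \<subseteq> polys n \<times> polys n" for g h ps
    using that(3)
  proof (induction ps)
    case (Cons a ps)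
    obtain g' h' where a: "a = (g', h')" by (cases a)
    have "g * in_Y n h * ?S (a # ps) = (g * g') * in_Y n (h * h') + g * in_Y n h * ?S ps"
      by (simp add: a Y.hom_mult algebra_simps)
    then show ?case using Cons a that by (auto intro!: Tadd T1 polys_mult)
  qed (simp add: T0)
  have Tm: "?S ps * q \<in> T" if "set ps \<subseteq> polys n \<times> polys n" and q: "q \<in> T" for ps q
    using that(1)
  proof (induction ps)
    case (Cons a ps)
    obtain qs where "q = ?S qs" "set qs \<subseteq> polys n \<times> polys n" using q unfolding T_def by blast
    then have "fst a * in_Y n (snd a) * q \<in> T" using Cons by (auto intro!: Tl)
    then show ?case using Cons by (auto simp: distrib_right split_beta intro!: Tadd)
  qed (simp add: T0)
  have "p \<in> T" using assms
  proof (induction rule: polys_induct)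
    case (const c) then show ?case using T1[of "mconst c" 1] by (simp add: Y.hom_one)
  next
    case (var i)
    show ?case
    proof (cases "i \<le> n")
      case True then show ?thesis using T1[of "mvar i" 1] var polys_mvar[of i n] by (simp add: Y.hom_one)
    next
      case False
      then have "i - n \<in> {1..n}" using var by auto
      then show ?thesis using T1[of 1 "mvar (i - n)"] False polys_mvar[of "i - n" n] by simp
    qed
  next
    case (add p q) then show ?case by (intro Tadd)
  next
    case (mult p q)
    then show ?case using Tm unfolding T_def by blast
  qed
  then obtain ps where ps: "set ps \<subseteq> polys n \<times> polys n" "p = ?S ps" unfolding T_def by blast
  show thesis
  proof (rule that)
    show "set (map fst ps) \<subseteq> polys n" "set (map snd ps) \<subseteq> polys n" using ps(1) by auto
    show "p = (\<Sum>l<length (map fst ps). map fst ps ! l * in_Y n (map snd ps ! l))"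
      unfolding ps(2) by (simp add: sum_list_sum_nth lessThan_atLeast0 split_beta)
  qed simp
qed

text \<open>The induction rests on the telescoping identity p(X)q(X) - p(Y)q(Y) = (p(X) - p(Y)) q(X)
  + p(Y) (q(X) - q(Y)).\<close>

lemma difference_coeffs_exist:
  fixes f :: "nat \<Rightarrow> 'k::field mpoly"
  assumes "\<And>j. j \<in> {1..n} \<Longrightarrow> f j \<in> polys n"
  obtains \<Delta> where "difference_coeffs n f \<Delta>"
proof -
  interpret Y: comm_ring_hom "in_Y n :: 'k mpoly \<Rightarrow> _" by (rule in_Y_hom)
  have ex: "\<exists>\<delta>. (\<forall>i\<in>{1..n}. \<delta> i \<in> polys (2 * n)) \<and>
      p - in_Y n p = (\<Sum>i\<in>{1..n}. \<delta> i * (mvar i - mvar (n + i)))"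
    if "p \<in> polys n" for p :: "'k mpoly"
    using that
  proof (induction rule: polys_induct)
    case (const c) then show ?case by (intro exI[of _ "\<lambda>i. 0"]) simp
  next
    case (var i)
    then have "mvar i - mvar (n + i) = (\<Sum>j\<in>{1..n}. (if j = i then 1 else 0) * (mvar j - mvar (n + j)) :: 'k mpoly)"
      by (simp add: if_distrib[of "\<lambda>x. x * _"] cong: if_cong)
    then show ?case by (intro exI[of _ "\<lambda>j. if j = i then 1 else 0"]) simp
  next
    case (add p q)
    then obtain \<delta> \<epsilon> where "\<forall>i\<in>{1..n}. \<delta> i \<in> polys (2 * n)" "\<forall>i\<in>{1..n}. \<epsilon> i \<in> polys (2 * n)"
      "p - in_Y n p = (\<Sum>i\<in>{1..n}. \<delta> i * (mvar i - mvar (n + i)))"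
      "q - in_Y n q = (\<Sum>i\<in>{1..n}. \<epsilon> i * (mvar i - mvar (n + i)))" by blast
    moreover from this have "p + q - in_Y n (p + q) = (\<Sum>i\<in>{1..n}. (\<delta> i + \<epsilon> i) * (mvar i - mvar (n + i)))"
      by (simp add: distrib_right sum.distrib Y.hom_add) (metis add_diff_add)
    ultimately show ?case by (intro exI[of _ "\<lambda>i. \<delta> i + \<epsilon> i"]) (auto intro: polys_add)
  next
    case (mult p q)
    then obtain \<delta> \<epsilon> where d: "\<forall>i\<in>{1..n}. \<delta> i \<in> polys (2 * n)" "\<forall>i\<in>{1..n}. \<epsilon> i \<in> polys (2 * n)"
      "p - in_Y n p = (\<Sum>i\<in>{1..n}. \<delta> i * (mvar i - mvar (n + i)))"
      "q - in_Y n q = (\<Sum>i\<in>{1..n}. \<epsilon> i * (mvar i - mvar (n + i)))" by blast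
    have "p * q - in_Y n (p * q) = (p - in_Y n p) * q + in_Y n p * (q - in_Y n q)"
      by (simp add: Y.hom_mult algebra_simps)
    also have "\<dots> = (\<Sum>i\<in>{1..n}. (\<delta> i * q + in_Y n p * \<epsilon> i) * (mvar i - mvar (n + i)))"
      unfolding d(3,4) by (simp add: sum_distrib_left sum_distrib_right sum.distrib[symmetric] algebra_simps)
    finally show ?case
      using d mult(1,2) by (intro exI[of _ "\<lambda>i. \<delta> i * q + in_Y n p * \<epsilon> i"])
        (auto intro!: polys_add polys_mult in_Y_polys intro: polys_double)
  qed
  then have "\<forall>j\<in>{1..n}. \<exists>\<delta>. (\<forall>i\<in>{1..n}. \<delta> i \<in> polys (2 * n)) \<and>
      f j - in_Y n (f j) = (\<Sum>i\<in>{1..n}. \<delta> i * (mvar i - mvar (n + i)))"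
    using assms by blast
  then obtain D where "\<forall>j\<in>{1..n}. (\<forall>i\<in>{1..n}. D j i \<in> polys (2 * n)) \<and>
      f j - in_Y n (f j) = (\<Sum>i\<in>{1..n}. D j i * (mvar i - mvar (n + i)))"
    unfolding bchoice_iff by blast
  \<comment> \<open>The first index of \<open>\<Delta>\<close> counts variables and the second one
    polynomials, the reverse of the order in D.\<close>
  then show thesis by (intro that[of "\<lambda>i j. D j i"]) (simp add: difference_coeffs_def)
qed

lemma polys_det:
  fixes A :: "'k::comm_ring_1 mpoly mat"
  assumes "A \<in> carrier_mat n n" "\<And>i j. i < n \<Longrightarrow> j < n \<Longrightarrow> A $$ (i, j) \<in> polys N"
  shows "det A \<in> polys N"
proof -
  have sg: "signof p \<in> (polys N :: 'k mpoly set)" for p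
    by (simp add: sign_def polys_uminus)
  show ?thesis
    unfolding det_def'[OF assms(1)]
    by (intro polys_sum polys_mult polys_prod sg assms(2)) (auto dest: permutes_in_image)
qed

text \<open>
  By Cramer's rule, multiplication by \<open>det \<Delta>\<close> carries the ideal \<open>(X\<^sub>i - Y\<^sub>i)\<close>, which contains
  \<open>g(X) - g(Y)\<close>, into \<open>(f\<^sub>j(X) - f\<^sub>j(Y))\<close>.
\<close>

lemma det_difference_coeffs:
  fixes f :: "nat \<Rightarrow> 'k::field mpoly"
  assumes \<Delta>: "difference_coeffs n f \<Delta>" and g: "g \<in> polys n"
  obtains H where "det (mat n n (\<lambda>(i, j). \<Delta> (Suc i) (Suc j))) * (g - in_Y n g) =
    (\<Sum>j\<in>{1..n}. H j * (f j - in_Y n (f j)))"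
proof -
  define A where "A = mat n n (\<lambda>(i, j). \<Delta> (Suc i) (Suc j))"
  have A: "A \<in> carrier_mat n n" by (simp add: A_def)
  note adj = adj_mat[OF A]
  \<comment> \<open>For the constant family g, every column of coefficients represents g(X) - g(Y).
    Column 1 is available only for n \<ge> 1; for n = 0 the polynomial g is a constant and the
    difference is 0.\<close>
  obtain \<delta> where "difference_coeffs n (\<lambda>_. g) \<delta>"
    using difference_coeffs_exist[of n "\<lambda>_. g"] g by blast
  moreover define d where "d i = \<delta> i 1" for i
  ultimately have d: "g - in_Y n g = (\<Sum>i\<in>{1..n}. d i * (mvar i - mvar (n + i)))" if "n \<ge> 1"
    using that by (simp add: difference_coeffs_def)
  have sh: "(\<Sum>i\<in>{Suc 0..n}. F i) = (\<Sum>i<n. F (Suc i))" for F :: "nat \<Rightarrow> 'k mpoly"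
    by (simp add: sum.atLeast1_atMost_eq)
  define w :: "nat \<Rightarrow> 'k mpoly" where "w i = mvar (Suc i) - mvar (n + Suc i)" for i
  have F: "f (Suc j) - in_Y n (f (Suc j)) = (\<Sum>i<n. A $$ (i, j) * w i)" if "j < n" for j
    using \<Delta> that by (simp add: difference_coeffs_def sh A_def w_def)
  have cramer: "det A * w l = (\<Sum>j<n. adj_mat A $$ (j, l) * (f (Suc j) - in_Y n (f (Suc j))))" if l: "l < n" for l
  proof -
    have "(\<Sum>j<n. adj_mat A $$ (j, l) * (f (Suc j) - in_Y n (f (Suc j)))) =
        (\<Sum>j<n. \<Sum>i<n. A $$ (i, j) * adj_mat A $$ (j, l) * w i)"
      by (intro sum.cong refl) (simp add: F sum_distrib_left ac_simps)
    also have "\<dots> = (\<Sum>i<n. (\<Sum>j<n. A $$ (i, j) * adj_mat A $$ (j, l)) * w i)"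
      by (subst sum.swap) (simp add: sum_distrib_right)
    also have "\<dots> = (\<Sum>i<n. (A * adj_mat A) $$ (i, l) * w i)"
      using A adj(1) l by (intro sum.cong refl) (simp add: scalar_prod_def lessThan_atLeast0)
    also have "\<dots> = (\<Sum>i<n. (if i = l then det A else 0) * w i)"
      using l by (intro sum.cong refl) (simp add: adj(2))
    also have "\<dots> = det A * w l"
      using l by (simp add: if_distrib[of "\<lambda>x. x * _"] cong: if_cong)
    finally show ?thesis ..
  qed
  show thesis
  proof (cases "n = 0")
    case True
    then have "g - in_Y n g = 0"
      using g difference_coeffs_exist[of n "\<lambda>_. g"]
    proof -
      have "g = mconst (Poly_Mapping.lookup g 0)"
      proof (rule poly_mapping_eqI)
        fix m show "Poly_Mapping.lookup g m = Poly_Mapping.lookup (mconst (Poly_Mapping.lookup g 0)) m"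
          using g True by (cases "m = 0") (auto simp: polys_def mconst_def lookup_single in_keys_iff)
      qed
      then show ?thesis by (metis in_Y_mconst diff_self)
    qed
    then show thesis using True by (intro that[of "\<lambda>_. 0"]) simp
  next
    case False
    then have "det A * (g - in_Y n g) = (\<Sum>i<n. d (Suc i) * (det A * w i))"
      using d by (simp add: sh w_def sum_distrib_left ac_simps)
    also have "\<dots> = (\<Sum>i<n. \<Sum>j<n. d (Suc i) * (adj_mat A $$ (j, i) * (f (Suc j) - in_Y n (f (Suc j)))))"
      by (intro sum.cong refl) (simp add: cramer sum_distrib_left)
    also have "\<dots> = (\<Sum>j<n. (\<Sum>i<n. d (Suc i) * adj_mat A $$ (j, i)) * (f (Suc j) - in_Y n (f (Suc j))))"
      by (subst sum.swap) (simp add: sum_distrib_right mult.assoc)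
    also have "\<dots> = (\<Sum>j\<in>{1..n}. (\<Sum>i<n. d (Suc i) * adj_mat A $$ (j - 1, i)) * (f j - in_Y n (f j)))"
      by (simp add: sh)
    finally have e: "det A * (g - in_Y n g) =
        (\<Sum>j\<in>{1..n}. (\<Sum>i<n. d (Suc i) * adj_mat A $$ (j - 1, i)) * (f j - in_Y n (f j)))" .
    show thesis by (rule that[OF e[unfolded A_def]])
  qed
qed

text \<open>
  On the diagonal, \<open>\<Delta>\<close> is the Jacobian matrix: substitute \<open>X = s + t e\<^sub>i\<close>, \<open>Y = s\<close> and
  differentiate with respect to \<open>t\<close>.
\<close>

lemma difference_coeffs_diagonal:
  fixes f :: "nat \<Rightarrow> 'k::field mpoly" and \<phi> :: "'k \<Rightarrow> 'b::idom"
  assumes \<Delta>: "difference_coeffs n f \<Delta>" and \<phi>: "comm_ring_hom \<phi>"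
    and i: "i \<in> {1..n}" and j: "j \<in> {1..n}" and f: "f j \<in> polys n"
  shows "meval \<phi> (\<lambda>l. if l \<le> n then s l else s (l - n)) (\<Delta> i j) = meval \<phi> s (mpderiv i (f j))"
proof -
  interpret \<phi>: comm_ring_hom \<phi> by fact
  define C where "C = (\<lambda>c. [:\<phi> c:])"
  interpret c: comm_ring_hom C
    unfolding C_def by unfold_locales (simp_all add: \<phi>.hom_add \<phi>.hom_mult one_pCons)
  define \<tau> where "\<tau> = (\<lambda>l. if l \<le> n then [:s l, if l = i then 1 else 0:] else [:s (l - n):])"
  interpret E: comm_ring_hom "meval C \<tau>" by (rule c.meval_hom)
  have poly0: "comm_ring_hom (\<lambda>p :: 'b poly. poly p 0)" by unfold_locales auto
  have EY: "meval C \<tau> (in_Y n (f j)) = [:meval \<phi> s (f j):]"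
  proof -
    have "meval C \<tau> (in_Y n (f j)) = meval C (\<lambda>l. \<tau> (n + l)) (f j)"
      unfolding in_Y_def E.hom_meval[OF mconst_hom] by simp
    also have "\<dots> = meval C (\<lambda>l. [:s l:]) (f j)"
      by (rule meval_cong[OF f]) (auto simp: \<tau>_def)
    also have "\<dots> = [:meval \<phi> s (f j):]"
      unfolding comm_ring_hom.hom_meval[OF const_poly_hom \<phi>] C_def ..
    finally show ?thesis .
  qed
  have EX: "meval C \<tau> (f j) = meval C (\<lambda>l. [:s l, if l = i then 1 else 0:]) (f j)"
    by (rule meval_cong[OF f]) (auto simp: \<tau>_def)
  have "f j - in_Y n (f j) = (\<Sum>l\<in>{1..n}. \<Delta> l j * (mvar l - mvar (n + l)))"
    using \<Delta> j by (simp add: difference_coeffs_def)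
  then have "meval C \<tau> (f j) - meval C \<tau> (in_Y n (f j)) =
      (\<Sum>l\<in>{1..n}. meval C \<tau> (\<Delta> l j) * (\<tau> l - \<tau> (n + l)))"
    by (simp add: E.hom_minus[symmetric] E.hom_sum E.hom_mult) (simp add: E.hom_minus)
  also have "\<dots> = (\<Sum>l\<in>{1..n}. if l = i then meval C \<tau> (\<Delta> i j) * [:0, 1:] else 0)"
    by (intro sum.cong refl) (auto simp: \<tau>_def)
  also have "\<dots> = meval C \<tau> (\<Delta> i j) * [:0, 1:]" using i by simp
  finally have "meval C (\<lambda>l. [:s l, if l = i then 1 else 0:]) (f j) =
      [:meval \<phi> s (f j):] + meval C \<tau> (\<Delta> i j) * [:0, 1:]"
    unfolding EX EY by (simp add: algebra_simps)
  \<comment> \<open>The derivative of t h(t) at t = 0 is h(0), and at t = 0 the substitution \<tau>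
    puts both X and Y equal to s.\<close>
  then have "meval \<phi> s (mpderiv i (f j)) = poly (meval C \<tau> (\<Delta> i j)) 0"
    unfolding meval_mpderiv[OF \<phi>] C_def[symmetric] by (simp add: pderiv_add pderiv_mult pderiv_pCons)
  also have "\<dots> = meval \<phi> (\<lambda>l. poly (\<tau> l) 0) (\<Delta> i j)"
    unfolding comm_ring_hom.hom_meval[OF poly0 c.comm_ring_hom_axioms] by (simp add: C_def)
  also have "(\<lambda>l. poly (\<tau> l) 0) = (\<lambda>l. if l \<le> n then s l else s (l - n))"
    by (auto simp: \<tau>_def)
  finally show ?thesis ..
qed


section \<open>Functionals on finite extensions\<close>

interpretation ac_pair: vector_space_pair "\<lambda>c z. to_ac c * z :: 'k::field alg_closure" "(*) :: 'k \<Rightarrow> 'k \<Rightarrow> 'k"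
  by unfold_locales (simp_all add: algebra_simps)

lemma ac_linear_on_subset: "ac_linear_on M \<eta> \<Longrightarrow> L \<subseteq> M \<Longrightarrow> ac_linear_on L \<eta>"
  unfolding ac_linear_on_def by blast

lemma ac_linear_on_zero:
  assumes "ac.subspace L" "ac_linear_on L \<eta>"
  shows "\<eta> 0 = 0"
proof -
  have "\<eta> (to_ac 0 * 0) = 0 * \<eta> 0"
    using assms ac.subspace_0 unfolding ac_linear_on_def by blast
  then show ?thesis by simp
qed

lemma ac_linear_mult:
  assumes "ac_linear_on UNIV \<mu>"
  shows "ac_linear_on UNIV (\<lambda>z. \<mu> (z * w))"
  using assms unfolding ac_linear_on_def distrib_right mult.assoc by blast

text \<open>The functional to be analysed lives on L, while \<open>contract\<close> applies one to
  coefficients anywhere in the closure. Prescribing the values on a basis of L, which is an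
  independent set in the closure, gives an extension.\<close>

lemma ac_linear_extend:
  assumes L: "ac.subspace L" and \<eta>: "ac_linear_on L \<eta>"
  obtains \<mu> where "ac_linear_on UNIV \<mu>" "\<And>z. z \<in> L \<Longrightarrow> \<mu> z = \<eta> z"
proof -
  obtain B where B: "B \<subseteq> L" "\<not> ac.dependent B" "L \<subseteq> ac.span B"
    using ac.maximal_independent_subset[of L] by blast
  obtain g where g: "Vector_Spaces.linear (\<lambda>c z. to_ac c * z) (*) g" "\<forall>x\<in>B. g x = \<eta> x"
    using ac_pair.linear_independent_extend[OF B(2)] by blast
  interpret g: Vector_Spaces.linear "\<lambda>c z. to_ac c * z" "(*)" g by (rule g(1))
  have lin: "ac_linear_on UNIV g" unfolding ac_linear_on_def by (simp add: g.add g.scale)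
  have "ac.subspace {x \<in> L. g x = \<eta> x}"
    unfolding ac.subspace_def
  proof (intro conjI allI ballI impI)
    show "0 \<in> {x \<in> L. g x = \<eta> x}"
      using ac.subspace_0[OF L] ac_linear_on_zero[OF L \<eta>] ac_linear_on_zero[OF ac.subspace_UNIV lin] by simp
  qed (use \<eta> lin L in \<open>auto simp: ac_linear_on_def ac.subspace_add ac.subspace_scale\<close>)
  then have "ac.span B \<subseteq> {x \<in> L. g x = \<eta> x}" using B(1) g(2) by (intro ac.span_minimal) auto
  then show thesis using lin B(3) by (intro that[of g]) auto
qed

text \<open>Expanding each b_l in a basis of the closure over k writes the sum as \<Sum>_x x
  (\<Sum>_l a_l R_x(b_l)), with R_x the coordinate functional at x. Some inner sum is nonzero, and
  \<mu> is the corresponding R_x.\<close>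

lemma ac_linear_nonvanishing:
  fixes a b :: "nat \<Rightarrow> 'k::field alg_closure"
  assumes "(\<Sum>l<N. a l * b l) \<noteq> 0"
  obtains \<mu> where "ac_linear_on UNIV \<mu>" "(\<Sum>l<N. a l * to_ac (\<mu> (b l))) \<noteq> 0"
proof -
  define B :: "'k alg_closure set" where "B = ac.extend_basis {}"
  have B: "\<not> ac.dependent B" "ac.span B = UNIV"
    unfolding B_def using ac.independent_extend_basis ac.span_extend_basis ac.independent_empty by blast+
  let ?R = "ac.representation B"
  define F where "F = (\<Union>l<N. {x. ?R (b l) x \<noteq> 0})"
  have F: "finite F" unfolding F_def by (auto intro: ac.finite_representation)
  have b: "b l = (\<Sum>x\<in>F. to_ac (?R (b l) x) * x)" if "l < N" for l
  proof -
    have "b l = (\<Sum>x | ?R (b l) x \<noteq> 0. to_ac (?R (b l) x) * x)"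
      using ac.sum_nonzero_representation_eq[OF B(1), of "b l"] B(2) by simp
    also have "\<dots> = (\<Sum>x\<in>F. to_ac (?R (b l) x) * x)"
      using F that by (intro sum.mono_neutral_left) (auto simp: F_def)
    finally show ?thesis .
  qed
  have "(\<Sum>l<N. a l * b l) = (\<Sum>l<N. a l * (\<Sum>x\<in>F. to_ac (?R (b l) x) * x))"
    using b by (intro sum.cong refl) simp
  also have "\<dots> = (\<Sum>x\<in>F. x * (\<Sum>l<N. a l * to_ac (?R (b l) x)))"
    unfolding sum_distrib_left by (subst sum.swap) (simp only: mult.left_commute mult.commute)
  finally obtain x where "(\<Sum>l<N. a l * to_ac (?R (b l) x)) \<noteq> 0"
    using assms by (metis (mono_tags, lifting) mult_zero_right sum.neutral)
  moreover have "ac_linear_on UNIV (\<lambda>z. ?R z x)"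
    unfolding ac_linear_on_def using B by (simp add: ac.representation_add ac.representation_scale)
  ultimately show thesis using that by blast
qed

lemma subfield_sum_closed:
  fixes a :: "nat \<Rightarrow> 'k::field alg_closure"
  assumes "ac.subspace L" "\<And>u v. u \<in> L \<Longrightarrow> v \<in> L \<Longrightarrow> u * v \<in> L" "\<And>l. l < N \<Longrightarrow> a l \<in> L"
  shows "(\<Sum>l<N. to_ac (c l) * a l) \<in> L"
  using assms by (intro ac.subspace_sum ac.subspace_scale) auto

text \<open>
  The element \<open>\<Sum> a\<^sub>l \<otimes> b\<^sub>l\<close> of \<open>L \<otimes> L\<close> is annihilated by all \<open>z \<otimes> 1 - 1 \<otimes> z\<close>; contracting either
  factor with \<open>\<theta>\<close> then gives the same element of \<open>L\<close>, because \<open>\<theta>(x y)\<close> is a non-degenerate form.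
\<close>

lemma contraction_symmetric:
  fixes a b :: "nat \<Rightarrow> 'k::field alg_closure"
  assumes L: "ac.subspace L" and mult: "\<And>u v. u \<in> L \<Longrightarrow> v \<in> L \<Longrightarrow> u * v \<in> L"
    and inv: "\<And>u. u \<in> L \<Longrightarrow> inverse u \<in> L"
    and \<theta>: "ac_linear_on L \<theta>" and ab: "\<And>l. l < N \<Longrightarrow> a l \<in> L" "\<And>l. l < N \<Longrightarrow> b l \<in> L"
    and central: "\<And>z. z \<in> L \<Longrightarrow>
      (\<Sum>l<N. a l * to_ac (\<theta> (b l * z))) = z * (\<Sum>l<N. a l * to_ac (\<theta> (b l)))"
    and nz: "z0 \<in> L" "\<theta> z0 \<noteq> 0"
  shows "(\<Sum>l<N. a l * to_ac (\<theta> (b l))) = (\<Sum>l<N. to_ac (\<theta> (a l)) * b l)"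
proof (rule ccontr)
  define c where "c = (\<Sum>l<N. a l * to_ac (\<theta> (b l)))"
  define d where "d = (\<Sum>l<N. to_ac (\<theta> (a l)) * b l)"
  assume "(\<Sum>l<N. a l * to_ac (\<theta> (b l))) \<noteq> (\<Sum>l<N. to_ac (\<theta> (a l)) * b l)"
  then have cd: "c - d \<noteq> 0" by (simp add: c_def d_def)
  have "c = (\<Sum>l<N. to_ac (\<theta> (b l)) * a l)" by (simp add: c_def mult.commute)
  then have cL: "c \<in> L" and dL: "d \<in> L"
    unfolding d_def using ab by (auto intro!: subfield_sum_closed[OF L mult])
  \<comment> \<open>Both sides equal \<Sum> \<theta>(a_l) \<theta>(b_l z): the left one by
    \<open>central\<close>, the right one by linearity in the second factor.\<close>
  have eq: "\<theta> (z * c) = \<theta> (z * d)" if z: "z \<in> L" for z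
  proof -
    have "\<theta> (z * c) = \<theta> (\<Sum>l<N. to_ac (\<theta> (b l * z)) * a l)"
      using central[OF z] by (simp add: c_def mult.commute)
    also have "\<dots> = (\<Sum>l<N. \<theta> (a l) * \<theta> (b l * z))"
      using ac_linear_on_sum[OF L \<theta>, of "{..<N}" a] ab by (simp add: mult.commute)
    also have "\<dots> = \<theta> (\<Sum>l<N. to_ac (\<theta> (a l)) * (b l * z))"
      using ac_linear_on_sum[OF L \<theta>, of "{..<N}" "\<lambda>l. b l * z"] ab mult z by simp
    also have "(\<Sum>l<N. to_ac (\<theta> (a l)) * (b l * z)) = z * d"
      unfolding d_def sum_distrib_left by (simp only: mult_ac)
    finally show ?thesis .
  qed
  have diffL: "c - d \<in> L" using L cL dL by (rule ac.subspace_diff)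
  \<comment> \<open>This choice gives z (c - d) = z0, and \<theta> does not vanish there.\<close>
  define z where "z = z0 * inverse (c - d)"
  have z: "z \<in> L" using nz inv diffL mult by (simp add: z_def)
  have "z * c = z0 + z * d" using cd by (simp add: z_def field_simps)
  then have "\<theta> (z * c) = \<theta> z0 + \<theta> (z * d)"
    using \<theta> nz(1) mult[OF z dL] by (simp add: ac_linear_on_def)
  then show False using eq[OF z] nz(2) by simp
qed

text \<open>The assumption \<open>dual\<close> writes the identity of L as a sum of N operators of
  rank one. Hence the a_l span L, which provides the finite basis that the trace presupposes, and
  composing with multiplication by w makes \<open>endo_trace_sum_rank_one\<close>
  applicable.\<close>

lemma field_trace_dual_system:
  fixes a b :: "nat \<Rightarrow> 'k::field alg_closure"
  assumes L: "ac.subspace L" and mult: "\<And>u v. u \<in> L \<Longrightarrow> v \<in> L \<Longrightarrow> u * v \<in> L"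
    and \<theta>: "ac_linear_on L \<theta>" and ab: "\<And>l. l < N \<Longrightarrow> a l \<in> L" "\<And>l. l < N \<Longrightarrow> b l \<in> L"
    and dual: "\<And>z. z \<in> L \<Longrightarrow> (\<Sum>l<N. a l * to_ac (\<theta> (b l * z))) = z"
  shows "\<exists>bs. is_basis (field_extension L) bs"
    and "w \<in> L \<Longrightarrow> field_trace L w = \<theta> (w * (\<Sum>l<N. a l * b l))"
proof -
  have "ac.span (a ` {..<N}) = L"
  proof
    show "ac.span (a ` {..<N}) \<subseteq> L" using ab L by (intro ac.span_minimal) auto
    show "L \<subseteq> ac.span (a ` {..<N})"
    proof
      fix z assume "z \<in> L"
      then have z: "z = (\<Sum>l<N. to_ac (\<theta> (b l * z)) * a l)" using dual by (simp add: mult.commute)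
      have "to_ac (\<theta> (b l * z)) * a l \<in> ac.span (a ` {..<N})" if "l < N" for l
        using that by (intro ac.span_scale ac.span_base) auto
      then show "z \<in> ac.span (a ` {..<N})" by (subst z, intro ac.span_sum) simp
    qed
  qed
  then show ex: "\<exists>bs. is_basis (field_extension L) bs"
    by (rule finite_span_ex_basis[rotated]) simp
  assume w: "w \<in> L"
  have lin: "ac_linear_on L (\<lambda>z. \<theta> (b l * z))" if "l < N" for l
  proof -
    have e: "b l * (to_ac c * v) = to_ac c * (b l * v)" for c v by (simp only: mult_ac)
    show ?thesis
      using \<theta> mult[OF ab(2)[OF that]] unfolding ac_linear_on_def distrib_left e by blast
  qed
  have "field_trace L w = (\<Sum>l<N. \<theta> (b l * (w * a l)))"
    unfolding field_trace_def
  proof (rule endo_trace_sum_rank_one[OF L ex, where \<Lambda> = "\<lambda>l z. \<theta> (b l * z)" and b = "\<lambda>l. w * a l"])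
    show "w * z = (\<Sum>l<N. to_ac (\<theta> (b l * z)) * (w * a l))" if "z \<in> L" for z
    proof -
      have "w * z = w * (\<Sum>l<N. a l * to_ac (\<theta> (b l * z)))" by (simp only: dual[OF that])
      also have "\<dots> = (\<Sum>l<N. to_ac (\<theta> (b l * z)) * (w * a l))"
        unfolding sum_distrib_left by (intro sum.cong refl) (simp only: mult_ac)
      finally show ?thesis .
    qed
  qed (use lin w ab mult in auto)
  also have "\<dots> = (\<Sum>l<N. 1 * \<theta> (w * (a l * b l)))" by (simp only: mult_ac mult_1_left mult_1_right)
  also have "\<dots> = \<theta> (\<Sum>l<N. to_ac 1 * (w * (a l * b l)))"
    using ac_linear_on_sum[OF L \<theta>, of "{..<N}" "\<lambda>l. w * (a l * b l)" "\<lambda>_. 1"] ab w mult by simp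
  also have "(\<Sum>l<N. to_ac 1 * (w * (a l * b l))) = w * (\<Sum>l<N. a l * b l)"
    by (simp add: sum_distrib_left)
  finally show "field_trace L w = \<theta> (w * (\<Sum>l<N. a l * b l))" .
qed


section \<open>The local degree at a simple zero\<close>

locale simple_zero =
  fixes n :: nat and f :: "nat \<Rightarrow> 'k::field mpoly" and s :: "nat \<Rightarrow> 'k alg_closure"
  assumes f_polys: "j \<in> {1..n} \<Longrightarrow> f j \<in> polys n"
    and f_zero: "j \<in> {1..n} \<Longrightarrow> meval to_ac s (f j) = 0"
    and jacobian_nonzero: "det (mat n n (\<lambda>(i, j). meval to_ac s (mpderiv (Suc i) (f (Suc j))))) \<noteq> 0"
begin

abbreviation ev :: "'k mpoly \<Rightarrow> 'k alg_closure" where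
  "ev \<equiv> meval to_ac s"

abbreviation jacobian :: "'k alg_closure" where
  "jacobian \<equiv> det (mat n n (\<lambda>(i, j). ev (mpderiv (Suc i) (f (Suc j)))))"

definition point_ideal :: "'k mpoly set" where
  "point_ideal = {g \<in> polys n. ev g = 0}"

text \<open>Quotients of values make closure under inverses immediate, with no appeal to
  algebraicity of the coordinates, and they are exactly the values of fractions in the
  localization.\<close>

definition point_field :: "'k alg_closure set" where
  "point_field = {ev g / ev h | g h. g \<in> polys n \<and> h \<in> polys n \<and> ev h \<noteq> 0}"

sublocale ev: comm_ring_hom ev
  by (rule comm_ring_hom.meval_hom[OF to_ac_hom])

lemma ev_mconst [simp]: "ev (mconst c) = to_ac c"
  by (rule comm_ring_hom.meval_mconst[OF to_ac_hom])

lemma point_fieldI: "g \<in> polys n \<Longrightarrow> h \<in> polys n \<Longrightarrow> ev h \<noteq> 0 \<Longrightarrow> ev g / ev h \<in> point_field"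
  unfolding point_field_def by blast

lemma ev_in_point_field: "g \<in> polys n \<Longrightarrow> ev g \<in> point_field"
  using point_fieldI[of g 1] by simp

lemma point_field_mult: "u * v \<in> point_field" if u: "u \<in> point_field" and v: "v \<in> point_field"
proof -
  obtain g h where 1: "u = ev g / ev h" "g \<in> polys n" "h \<in> polys n" "ev h \<noteq> 0"
    using u unfolding point_field_def by blast
  obtain g' h' where 2: "v = ev g' / ev h'" "g' \<in> polys n" "h' \<in> polys n" "ev h' \<noteq> 0"
    using v unfolding point_field_def by blast
  have "u * v = ev (g * g') / ev (h * h')" using 1 2 by (simp add: ev.hom_mult)
  then show ?thesis using 1 2 point_fieldI[of "g * g'" "h * h'"] by (simp add: polys_mult ev.hom_mult)
qed

lemma point_field_add: "u + v \<in> point_field" if u: "u \<in> point_field" and v: "v \<in> point_field"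
proof -
  obtain g h where 1: "u = ev g / ev h" "g \<in> polys n" "h \<in> polys n" "ev h \<noteq> 0"
    using u unfolding point_field_def by blast
  obtain g' h' where 2: "v = ev g' / ev h'" "g' \<in> polys n" "h' \<in> polys n" "ev h' \<noteq> 0"
    using v unfolding point_field_def by blast
  have "u + v = ev (g * h' + g' * h) / ev (h * h')"
    using 1 2 by (simp add: ev.hom_mult ev.hom_add add_frac_eq)
  then show ?thesis
    using 1 2 point_fieldI[of "g * h' + g' * h" "h * h'"] by (simp add: polys_mult polys_add ev.hom_mult)
qed

lemma point_field_inverse: "inverse u \<in> point_field" if u: "u \<in> point_field"
proof -
  obtain g h where 1: "u = ev g / ev h" "g \<in> polys n" "h \<in> polys n" "ev h \<noteq> 0"
    using u unfolding point_field_def by blast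
  show ?thesis
  proof (cases "ev g = 0")
    case True then show ?thesis using 1 ev_in_point_field[of 0] by simp
  next
    case False then show ?thesis using 1 point_fieldI[of h g] by simp
  qed
qed

lemma point_field_divide: "u \<in> point_field \<Longrightarrow> v \<in> point_field \<Longrightarrow> u / v \<in> point_field"
  unfolding divide_inverse by (intro point_field_mult point_field_inverse)

lemma to_ac_in_point_field: "to_ac c \<in> point_field"
  using ev_in_point_field[of "mconst c"] by simp

lemma subspace_point_field: "ac.subspace point_field"
  unfolding ac.subspace_def
  using ev_in_point_field[of 0] point_field_add point_field_mult[OF to_ac_in_point_field] by auto

subsection \<open>Specialization of the second set of variables\<close>

text \<open>For linear \<open>\<mu>\<close>, \<open>contract \<mu> (g(X) h(Y)) = \<mu>(h(s)) g(X)\<close>.\<close>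

definition spec_Y :: "'k mpoly \<Rightarrow> 'k alg_closure mpoly" where
  "spec_Y = meval (\<lambda>c. mconst (to_ac c)) (\<lambda>l. if l \<in> {1..n} then mvar l else mconst (s (l - n)))"

definition contract :: "('k alg_closure \<Rightarrow> 'k) \<Rightarrow> 'k mpoly \<Rightarrow> 'k mpoly" where
  "contract \<mu> p = Poly_Mapping.map \<mu> (spec_Y p)"

lemma mconst_to_ac_hom: "comm_ring_hom (\<lambda>c. mconst (to_ac c) :: 'k alg_closure mpoly)"
  by unfold_locales (simp_all add: mconst_add mconst_mult)

sublocale spec_Y: comm_ring_hom spec_Y
  unfolding spec_Y_def by (rule comm_ring_hom.meval_hom[OF mconst_to_ac_hom])

lemma spec_Y_mconst: "spec_Y (mconst c) = mconst (to_ac c)"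
  unfolding spec_Y_def by (rule comm_ring_hom.meval_mconst[OF mconst_to_ac_hom])

lemma spec_Y_mvar: "spec_Y (mvar i) = (if i \<in> {1..n} then mvar i else mconst (s (i - n)))"
  unfolding spec_Y_def by (rule comm_ring_hom.meval_mvar[OF mconst_to_ac_hom])

text \<open>Every index outside {1..n} is sent to a constant, including 0 and those above 2n. The
  bound therefore holds for all p, in particular for the coefficients H of
  \<open>det_difference_coeffs\<close>, whose variables are not controlled.\<close>

lemma spec_Y_polys: "spec_Y p \<in> polys n"
proof (induction p rule: mpoly_induct)
  case (var i) then show ?case using polys_mvar[of i n] by (auto simp: spec_Y_mvar)
qed (auto simp: spec_Y_mconst spec_Y.hom_add spec_Y.hom_mult intro: polys_add polys_mult)

lemma spec_Y_in_Y:
  assumes "h \<in> polys n"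
  shows "spec_Y (in_Y n h) = mconst (ev h)"
proof -
  have "spec_Y (in_Y n h) = meval (\<lambda>c. mconst (to_ac c)) (\<lambda>i. spec_Y (mvar (n + i))) h"
    unfolding in_Y_def spec_Y.hom_meval[OF mconst_hom] spec_Y_mconst ..
  also have "\<dots> = meval (\<lambda>c. mconst (to_ac c)) (\<lambda>i. mconst (s i)) h"
    by (rule meval_cong[OF assms]) (auto simp: spec_Y_mvar)
  also have "\<dots> = mconst (ev h)"
    using comm_ring_hom.hom_meval[OF mconst_hom to_ac_hom, of s h] by simp
  finally show ?thesis .
qed

section \<open>Contraction of polynomials with a linear functional\<close>

context
  fixes \<mu> :: "'k alg_closure \<Rightarrow> 'k"
  assumes \<mu>: "ac_linear_on UNIV \<mu>"
begin

lemma \<mu>_simps: "\<mu> 0 = 0" "\<mu> (u + v) = \<mu> u + \<mu> v" "\<mu> (to_ac c * v) = c * \<mu> v"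
  using \<mu> ac_linear_on_zero[OF ac.subspace_UNIV \<mu>] by (auto simp: ac_linear_on_def)

lemma lookup_map_\<mu>: "Poly_Mapping.lookup (Poly_Mapping.map \<mu> q) m = \<mu> (Poly_Mapping.lookup q m)"
  by (simp add: Poly_Mapping.map.rep_eq when_def \<mu>_simps)

lemma map_\<mu>_add: "Poly_Mapping.map \<mu> (p + q) = Poly_Mapping.map \<mu> p + Poly_Mapping.map \<mu> q"
  by (rule poly_mapping_eqI) (simp add: lookup_map_\<mu> lookup_add \<mu>_simps)

lemma map_\<mu>_single: "Poly_Mapping.map \<mu> (Poly_Mapping.single m a) = Poly_Mapping.single m (\<mu> a)"
  by (rule poly_mapping_eqI) (simp add: lookup_map_\<mu> lookup_single when_def \<mu>_simps)

lemma map_\<mu>_zero: "Poly_Mapping.map \<mu> 0 = (0 :: 'k mpoly)"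
  by (rule poly_mapping_eqI) (simp add: lookup_map_\<mu> \<mu>_simps)

lemma map_\<mu>_sum: "Poly_Mapping.map \<mu> (\<Sum>i\<in>I. F i :: 'k alg_closure mpoly) = (\<Sum>i\<in>I. Poly_Mapping.map \<mu> (F i))"
  by (induction I rule: infinite_finite_induct) (simp_all add: map_\<mu>_zero map_\<mu>_add)

lemma map_\<mu>_single_mult:
  "Poly_Mapping.map \<mu> (Poly_Mapping.single m (to_ac c) * q) = Poly_Mapping.single m c * Poly_Mapping.map \<mu> q"
  for q :: "'k alg_closure mpoly"
proof -
  have "Poly_Mapping.map \<mu> (Poly_Mapping.single m (to_ac c) *
      (\<Sum>k\<in>Poly_Mapping.keys q. Poly_Mapping.single k (Poly_Mapping.lookup q k))) =
    Poly_Mapping.single m c * Poly_Mapping.map \<mu>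
      (\<Sum>k\<in>Poly_Mapping.keys q. Poly_Mapping.single k (Poly_Mapping.lookup q k))"
    by (simp add: sum_distrib_left map_\<mu>_sum mult_single map_\<mu>_single \<mu>_simps)
  then show ?thesis using mpoly_eq_sum_single[of q] by simp
qed

text \<open>On \<open>polys n\<close> the map \<open>spec_Y\<close> only moves coefficients from k
  into the closure. Since \<mu> is k-linear, such a factor passes through it; so contraction is
  linear over k[X].\<close>

lemma map_\<mu>_spec_Y_mult:
  assumes "g \<in> polys n"
  shows "Poly_Mapping.map \<mu> (spec_Y g * q) = g * Poly_Mapping.map \<mu> q"
  using assms
proof (induction arbitrary: q rule: polys_induct)
  case (const c) then show ?case by (simp only: spec_Y_mconst) (simp only: mconst_def map_\<mu>_single_mult)
next
  case (var i)
  then have "spec_Y (mvar i) = Poly_Mapping.single (Poly_Mapping.single i 1) (to_ac 1)"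
    by (simp only: spec_Y_mvar if_True) (simp add: mvar_def)
  then show ?case by (simp only: map_\<mu>_single_mult) (simp only: mvar_def)
next
  case (add g h) then show ?case by (simp only: spec_Y.hom_add distrib_right map_\<mu>_add)
next
  case (mult g h) then show ?case by (simp only: spec_Y.hom_mult mult.assoc)
qed

lemma contract_mult: "g \<in> polys n \<Longrightarrow> contract \<mu> (g * p) = g * contract \<mu> p"
  by (simp add: contract_def spec_Y.hom_mult map_\<mu>_spec_Y_mult)

lemma contract_add: "contract \<mu> (p + q) = contract \<mu> p + contract \<mu> q"
  by (simp add: contract_def spec_Y.hom_add map_\<mu>_add)

lemma contract_sum: "contract \<mu> (\<Sum>i\<in>I. F i) = (\<Sum>i\<in>I. contract \<mu> (F i))"
  by (simp add: contract_def spec_Y.hom_sum map_\<mu>_sum)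

lemma contract_polys: "contract \<mu> p \<in> polys n"
proof -
  have "Poly_Mapping.keys (contract \<mu> p) \<subseteq> Poly_Mapping.keys (spec_Y p)"
    by (auto simp: contract_def in_keys_iff lookup_map_\<mu> \<mu>_simps intro: ccontr)
  then show ?thesis using spec_Y_polys[of p] unfolding polys_def by blast
qed

lemma contract_tensor:
  assumes "g \<in> polys n" "h \<in> polys n"
  shows "contract \<mu> (g * in_Y n h) = g * mconst (\<mu> (ev h))"
  using assms by (simp add: contract_mult) (simp add: contract_def spec_Y_in_Y mconst_def map_\<mu>_single)

lemma ev_contract_tensor_sum:
  assumes "set gs \<subseteq> polys n" "set hs \<subseteq> polys n" "length gs = length hs"
  shows "ev (contract \<mu> (\<Sum>l<length gs. gs ! l * in_Y n (hs ! l))) =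
    (\<Sum>l<length gs. ev (gs ! l) * to_ac (\<mu> (ev (hs ! l))))"
proof -
  have "gs ! l \<in> polys n" "hs ! l \<in> polys n" if "l < length gs" for l
    using that assms by (auto simp: subset_iff)
  then show ?thesis
    by (simp add: contract_sum ev.hom_sum contract_tensor ev.hom_mult)
qed

lemma contract_in_Y_zero:
  assumes "h \<in> polys n" "ev h = 0"
  shows "contract \<mu> (p * in_Y n h) = 0"
  using assms by (simp add: contract_def spec_Y.hom_mult spec_Y_in_Y map_\<mu>_zero)

text \<open>In the relation of \<open>det_difference_coeffs\<close>, the terms with f_j(Y) contract
  to 0 because f_j(s) = 0, and the factors g(X) and f_j(X) come out of the contraction. The
  remaining term with g(Y) vanishes if g(s) = 0; in general it is a contraction of D with \<mu>
  twisted by g(s).\<close>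

lemma contract_cramer:
  assumes \<Delta>: "difference_coeffs n f \<Delta>" and g: "g \<in> polys n"
  defines "D \<equiv> det (mat n n (\<lambda>(i, j). \<Delta> (Suc i) (Suc j)))"
  obtains W where "\<And>j. W j \<in> polys n"
    "g * contract \<mu> D = contract \<mu> (D * in_Y n g) + (\<Sum>j\<in>{1..n}. f j * W j)"
proof -
  obtain H where H: "D * (g - in_Y n g) = (\<Sum>j\<in>{1..n}. H j * (f j - in_Y n (f j)))"
    using det_difference_coeffs[OF \<Delta> g] unfolding D_def by blast
  have "g * D + (\<Sum>j\<in>{1..n}. H j * in_Y n (f j)) = D * in_Y n g + (\<Sum>j\<in>{1..n}. f j * H j)"
    using H by (simp add: right_diff_distrib sum_subtractf algebra_simps)
  then have "contract \<mu> (g * D + (\<Sum>j\<in>{1..n}. H j * in_Y n (f j))) =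
      contract \<mu> (D * in_Y n g + (\<Sum>j\<in>{1..n}. f j * H j))" by simp
  moreover have "contract \<mu> (\<Sum>j\<in>{1..n}. H j * in_Y n (f j)) = 0"
    unfolding contract_sum using f_polys f_zero by (intro sum.neutral ballI contract_in_Y_zero) auto
  moreover have "contract \<mu> (\<Sum>j\<in>{1..n}. f j * H j) = (\<Sum>j\<in>{1..n}. f j * contract \<mu> (H j))"
    unfolding contract_sum using f_polys by (intro sum.cong refl contract_mult)
  ultimately have "g * contract \<mu> D = contract \<mu> (D * in_Y n g) + (\<Sum>j\<in>{1..n}. f j * contract \<mu> (H j))"
    by (simp add: contract_add contract_mult[OF g])
  then show thesis by (rule that[OF contract_polys])
qed

end

text \<open>Putting X = Y = s turns the tensor expression into \<Sum> a_l b_l and the entries of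
  \<open>\<Delta>\<close> into partial derivatives, by \<open>difference_coeffs_diagonal\<close>.
  The sum is the image of det \<open>\<Delta>\<close> under multiplication L \<otimes> L
  \<rightarrow> L.\<close>

lemma ev_contract_det:
  assumes \<Delta>: "difference_coeffs n f \<Delta>"
    and gh: "set gs \<subseteq> polys n" "set hs \<subseteq> polys n" "length gs = length hs"
    and det: "det (mat n n (\<lambda>(i, j). \<Delta> (Suc i) (Suc j))) = (\<Sum>l<length gs. gs ! l * in_Y n (hs ! l))"
  shows "(\<Sum>l<length gs. ev (gs ! l) * ev (hs ! l)) = jacobian"
proof -
  define \<sigma> where "\<sigma> = (\<lambda>l. if l \<le> n then s l else s (l - n))"
  interpret E: comm_ring_hom "meval to_ac \<sigma>" by (rule comm_ring_hom.meval_hom[OF to_ac_hom])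
  have X: "meval to_ac \<sigma> g = ev g" if "g \<in> polys n" for g
    by (rule meval_cong[OF that]) (auto simp: \<sigma>_def)
  have Y: "meval to_ac \<sigma> (in_Y n g) = ev g" if "g \<in> polys n" for g
  proof -
    have "meval to_ac \<sigma> (in_Y n g) = meval to_ac (\<lambda>i. \<sigma> (n + i)) g"
      unfolding in_Y_def E.hom_meval[OF mconst_hom]
      by (simp add: comm_ring_hom.meval_mconst[OF to_ac_hom] comm_ring_hom.meval_mvar[OF to_ac_hom])
    also have "\<dots> = ev g" by (rule meval_cong[OF that]) (auto simp: \<sigma>_def)
    finally show ?thesis .
  qed
  have "(\<Sum>l<length gs. ev (gs ! l) * ev (hs ! l)) = meval to_ac \<sigma> (det (mat n n (\<lambda>(i, j). \<Delta> (Suc i) (Suc j))))"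
    unfolding det E.hom_sum E.hom_mult using gh X Y
    by (intro sum.cong refl) (auto simp: subset_iff)
  also have "\<dots> = det (map_mat (meval to_ac \<sigma>) (mat n n (\<lambda>(i, j). \<Delta> (Suc i) (Suc j))))"
    by simp
  also have "map_mat (meval to_ac \<sigma>) (mat n n (\<lambda>(i, j). \<Delta> (Suc i) (Suc j))) =
      mat n n (\<lambda>(i, j). ev (mpderiv (Suc i) (f (Suc j))))"
    using difference_coeffs_diagonal[OF \<Delta> to_ac_hom, of _ _ s] f_polys
    by (intro eq_matI) (auto simp: \<sigma>_def)
  finally show ?thesis .
qed

text \<open>This is the annihilation of \<Sum> a_l \<otimes> b_l by z \<otimes> 1 - 1 \<otimes> z,
  tested with all functionals \<mu> on the second factor. For z the value of a polynomial, it is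
  \<open>contract_cramer\<close> evaluated at s, where the terms with f_j vanish.\<close>

lemma central:
  assumes \<Delta>: "difference_coeffs n f \<Delta>"
    and gh: "set gs \<subseteq> polys n" "set hs \<subseteq> polys n" "length gs = length hs"
    and det: "det (mat n n (\<lambda>(i, j). \<Delta> (Suc i) (Suc j))) = (\<Sum>l<length gs. gs ! l * in_Y n (hs ! l))"
    and \<mu>: "ac_linear_on UNIV \<mu>" and z: "z \<in> point_field"
  shows "(\<Sum>l<length gs. ev (gs ! l) * to_ac (\<mu> (ev (hs ! l) * z))) =
    z * (\<Sum>l<length gs. ev (gs ! l) * to_ac (\<mu> (ev (hs ! l))))"
proof -
  let ?S = "\<lambda>\<mu>. \<Sum>l<length gs. ev (gs ! l) * to_ac (\<mu> (ev (hs ! l)))"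
  interpret Y: comm_ring_hom "in_Y n :: 'k mpoly \<Rightarrow> _" by (rule in_Y_hom)
  have poly: "?S (\<lambda>w. \<mu> (w * ev g)) = ev g * ?S \<mu>" if g: "g \<in> polys n" and \<mu>: "ac_linear_on UNIV \<mu>" for g \<mu>
  proof -
    define hs' where "hs' = map (\<lambda>h. h * g) hs"
    have hs': "set hs' \<subseteq> polys n" "length gs = length hs'" using gh g by (auto simp: hs'_def intro: polys_mult)
    define D where "D = (\<Sum>l<length gs. gs ! l * in_Y n (hs ! l))"
    have D': "D * in_Y n g = (\<Sum>l<length gs. gs ! l * in_Y n (hs' ! l))"
      unfolding D_def sum_distrib_right using gh by (intro sum.cong refl) (simp add: hs'_def Y.hom_mult mult.assoc)
    obtain W where W: "\<And>j. W j \<in> polys n"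
      "g * contract \<mu> D = contract \<mu> (D * in_Y n g) + (\<Sum>j\<in>{1..n}. f j * W j)"
      using contract_cramer[OF \<mu> \<Delta> g] unfolding det D_def by blast
    have "ev (\<Sum>j\<in>{1..n}. f j * W j) = 0"
      unfolding ev.hom_sum ev.hom_mult using f_zero by (intro sum.neutral) auto
    then have "ev g * ev (contract \<mu> D) = ev (contract \<mu> (D * in_Y n g))"
      using arg_cong[OF W(2), of ev] by (simp add: ev.hom_mult ev.hom_add)
    also have "\<dots> = (\<Sum>l<length gs. ev (gs ! l) * to_ac (\<mu> (ev (hs' ! l))))"
      unfolding D' by (rule ev_contract_tensor_sum[OF \<mu> gh(1) hs'])
    also have "\<dots> = ?S (\<lambda>w. \<mu> (w * ev g))"
      using gh(3) by (intro sum.cong refl) (simp add: hs'_def ev.hom_mult)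
    finally show ?thesis unfolding D_def ev_contract_tensor_sum[OF \<mu> gh] by simp
  qed
  obtain g h where gh': "z = ev g / ev h" "g \<in> polys n" "h \<in> polys n" "ev h \<noteq> 0"
    using z unfolding point_field_def by blast
  \<comment> \<open>A quotient z = g(s)/h(s) is reduced to polynomial values by twisting the
    functional: \<mu>(w z) = \<nu>(w g(s)) and \<mu>(w) = \<nu>(w h(s)). Both are instances of the
    polynomial case for \<nu>.\<close>
  define \<nu> where "\<nu> = (\<lambda>w. \<mu> (w * inverse (ev h)))"
  have \<nu>: "ac_linear_on UNIV \<nu>" unfolding \<nu>_def by (rule ac_linear_mult[OF \<mu>])
  have "\<mu> (w * z) = \<nu> (w * ev g)" for w unfolding \<nu>_def gh'(1) divide_inverse mult.assoc ..
  then have "?S (\<lambda>w. \<mu> (w * z)) = ev g * ?S \<nu>" using poly[OF gh'(2) \<nu>] by simp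
  moreover have "\<mu> w = \<nu> (w * ev h)" for w using gh'(4) by (simp add: \<nu>_def mult.assoc)
  then have "?S \<mu> = ev h * ?S \<nu>" using poly[OF gh'(3) \<nu>] by simp
  ultimately show ?thesis using gh' by simp
qed

end


context simple_zero
begin

subsection \<open>The local algebra is the residue field\<close>

lemma det_difference_coeffs_polys:
  assumes "difference_coeffs n f \<Delta>"
  shows "det (mat n n (\<lambda>(i, j). \<Delta> (Suc i) (Suc j))) \<in> polys (2 * n)"
  using assms by (intro polys_det[of _ n]) (auto simp: difference_coeffs_def)

lemma generators_kill_point_ideal:
  assumes "g \<in> polys n" "ev g = 0"
  obtains U W where "U \<in> polys n" "ev U \<noteq> 0" "\<And>j. W j \<in> polys n"
    "g * U = (\<Sum>j\<in>{1..n}. f j * W j)"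
proof -
  obtain \<Delta> where \<Delta>: "difference_coeffs n f \<Delta>" using difference_coeffs_exist f_polys by blast
  obtain gs hs where gh: "length gs = length hs" "set gs \<subseteq> polys n" "set hs \<subseteq> polys n"
    and det: "det (mat n n (\<lambda>(i, j). \<Delta> (Suc i) (Suc j))) = (\<Sum>l<length gs. gs ! l * in_Y n (hs ! l))"
    using tensor_decomposition[OF det_difference_coeffs_polys[OF \<Delta>]] by blast
  have "(\<Sum>l<length gs. ev (gs ! l) * ev (hs ! l)) \<noteq> 0"
    using ev_contract_det[OF \<Delta> gh(2,3,1) det] jacobian_nonzero by simp
  then obtain \<mu> where \<mu>: "ac_linear_on UNIV \<mu>"
    "(\<Sum>l<length gs. ev (gs ! l) * to_ac (\<mu> (ev (hs ! l)))) \<noteq> 0"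
    by (rule ac_linear_nonvanishing)
  obtain W where W: "\<And>j. W j \<in> polys n"
    "g * contract \<mu> (det (mat n n (\<lambda>(i, j). \<Delta> (Suc i) (Suc j)))) =
      contract \<mu> (det (mat n n (\<lambda>(i, j). \<Delta> (Suc i) (Suc j))) * in_Y n g) + (\<Sum>j\<in>{1..n}. f j * W j)"
    using contract_cramer[OF \<mu>(1) \<Delta> assms(1)] by blast
  show thesis
  proof (rule that)
    show "ev (contract \<mu> (det (mat n n (\<lambda>(i, j). \<Delta> (Suc i) (Suc j))))) \<noteq> 0"
      unfolding det ev_contract_tensor_sum[OF \<mu>(1) gh(2,3,1)] by (rule \<mu>(2))
    show "g * contract \<mu> (det (mat n n (\<lambda>(i, j). \<Delta> (Suc i) (Suc j)))) = (\<Sum>j\<in>{1..n}. f j * W j)"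
      using W(2) contract_in_Y_zero[OF \<mu>(1) assms] by simp
  qed (use W(1) contract_polys[OF \<mu>(1)] in auto)
qed

section \<open>The localization at s and the evaluation of fractions\<close>

abbreviation loc :: "'k mpoly fract ring" where
  "loc \<equiv> localization n point_ideal"

lemma loc_simps:
  "monoid.mult loc u v = u * v" "add loc u v = u + v" "\<one>\<^bsub>loc\<^esub> = 1" "\<zero>\<^bsub>loc\<^esub> = 0"
  by (simp_all add: localization_def)

lemma carrier_loc: "carrier loc = {Fract g h | g h. g \<in> polys n \<and> h \<in> polys n \<and> ev h \<noteq> 0}"
  by (auto simp: localization_def point_ideal_def)

lemma Fract_in_loc: "g \<in> polys n \<Longrightarrow> h \<in> polys n \<Longrightarrow> ev h \<noteq> 0 \<Longrightarrow> Fract g h \<in> carrier loc"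
  unfolding carrier_loc by blast

lemma loc_cases:
  assumes "z \<in> carrier loc"
  obtains g h where "z = Fract g h" "g \<in> polys n" "h \<in> polys n" "ev h \<noteq> 0" "h \<noteq> 0"
proof -
  obtain g h where gh: "z = Fract g h" "g \<in> polys n" "h \<in> polys n" "ev h \<noteq> 0"
    using assms unfolding carrier_loc by blast
  then have "h \<noteq> 0" using ev.hom_zero by metis
  then show thesis using that gh by blast
qed

lemma loc_add: "u \<in> carrier loc \<Longrightarrow> v \<in> carrier loc \<Longrightarrow> u + v \<in> carrier loc"
  by (elim loc_cases) (auto intro!: Fract_in_loc polys_add polys_mult simp: ev.hom_mult)

lemma loc_mult: "u \<in> carrier loc \<Longrightarrow> v \<in> carrier loc \<Longrightarrow> u * v \<in> carrier loc"
  by (elim loc_cases) (auto intro!: Fract_in_loc polys_mult simp: ev.hom_mult)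

lemma loc_uminus: "u \<in> carrier loc \<Longrightarrow> - u \<in> carrier loc"
  by (elim loc_cases) (auto intro!: Fract_in_loc polys_uminus)

lemma loc_one: "1 \<in> carrier loc"
  and loc_zero: "0 \<in> carrier loc"
  using Fract_in_loc[of 1 1] Fract_in_loc[of 0 1] by (simp_all add: fract_collapse)

lemma loc_cring: "cring loc"
proof (rule cringI)
  show "abelian_group loc"
  proof (rule abelian_groupI)
    show "\<exists>y\<in>carrier loc. y \<oplus>\<^bsub>loc\<^esub> x = \<zero>\<^bsub>loc\<^esub>" if "x \<in> carrier loc" for x
      using loc_uminus[OF that] by (intro bexI[of _ "- x"]) (simp_all add: loc_simps)
  qed (simp_all only: loc_simps loc_add loc_zero add.assoc add_0_left, simp only: add.commute)
  show "Group.comm_monoid loc"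
    by (rule comm_monoidI) (simp_all only: loc_simps loc_mult loc_one mult.assoc mult_1_left, simp only: mult.commute)
qed (simp only: loc_simps distrib_right)

text \<open>A fraction also has representations whose denominator vanishes at s; the description
  admits only the others, and cross-multiplication shows that these give one value.\<close>

definition fract_value :: "'k mpoly fract \<Rightarrow> 'k alg_closure" where
  "fract_value z = (THE w. \<exists>g h. g \<in> polys n \<and> h \<in> polys n \<and> ev h \<noteq> 0 \<and> z = Fract g h \<and> w = ev g / ev h)"

lemma fract_value_Fract:
  assumes "g \<in> polys n" "h \<in> polys n" "ev h \<noteq> 0"
  shows "fract_value (Fract g h) = ev g / ev h"
  unfolding fract_value_def
proof (rule the_equality)
  show "\<exists>g' h'. g' \<in> polys n \<and> h' \<in> polys n \<and> ev h' \<noteq> 0 \<and> Fract g h = Fract g' h' \<and> ev g / ev h = ev g' / ev h'"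
    using assms by blast
  fix w assume "\<exists>g' h'. g' \<in> polys n \<and> h' \<in> polys n \<and> ev h' \<noteq> 0 \<and> Fract g h = Fract g' h' \<and> w = ev g' / ev h'"
  then obtain g' h' where w: "ev h' \<noteq> 0" "Fract g h = Fract g' h'" "w = ev g' / ev h'" by blast
  have "h \<noteq> 0" "h' \<noteq> 0" using assms(3) w(1) by auto
  then have "g * h' = g' * h" using w(2) by (simp add: eq_fract)
  then have "ev g * ev h' = ev g' * ev h" by (metis ev.hom_mult)
  then show "w = ev g / ev h" using w assms(3) by (simp add: frac_eq_eq)
qed

lemma fract_value_hom: "ring_hom_ring loc ring_of_type_algebra fract_value"
proof (rule ring_hom_ringI2)
  show "ring loc" using loc_cring by (rule cring.axioms)
  show "ring (ring_of_type_algebra :: 'k alg_closure ring)" by (rule ring_from_type_algebra)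
  show "fract_value \<in> ring_hom loc ring_of_type_algebra"
  proof (rule ring_hom_memI)
    fix u v assume u: "u \<in> carrier loc" and v: "v \<in> carrier loc"
    obtain g h where 1: "u = Fract g h" "g \<in> polys n" "h \<in> polys n" "ev h \<noteq> 0" "h \<noteq> 0"
      using u by (rule loc_cases)
    obtain g' h' where 2: "v = Fract g' h'" "g' \<in> polys n" "h' \<in> polys n" "ev h' \<noteq> 0" "h' \<noteq> 0"
      using v by (rule loc_cases)
    show "fract_value (u \<otimes>\<^bsub>loc\<^esub> v) = fract_value u \<otimes>\<^bsub>ring_of_type_algebra\<^esub> fract_value v"
      using 1 2 by (simp add: loc_simps ring_of_type_algebra_def fract_value_Fract polys_mult ev.hom_mult)
    show "fract_value (u \<oplus>\<^bsub>loc\<^esub> v) = fract_value u \<oplus>\<^bsub>ring_of_type_algebra\<^esub> fract_value v"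
      using 1 2 by (simp add: loc_simps ring_of_type_algebra_def fract_value_Fract polys_mult polys_add
          ev.hom_mult ev.hom_add add_frac_eq)
  next
    show "fract_value \<one>\<^bsub>loc\<^esub> = \<one>\<^bsub>ring_of_type_algebra\<^esub>"
      using fract_value_Fract[of 1 1] by (simp add: loc_simps ring_of_type_algebra_def fract_collapse)
  qed (simp add: ring_of_type_algebra_def)
qed

abbreviation fiber_ideal :: "'k mpoly fract set" where
  "fiber_ideal \<equiv> zero_ideal n point_ideal f"

text \<open>The generators f_j vanish at s, which gives one inclusion. Conversely, if g(s) = 0 then
  g U = \<Sum> f_j W_j with U(s) \<noteq> 0, so g/h = \<Sum> (W_j / (U h)) f_j with coefficients in
  the localization.\<close>

lemma zero_ideal_eq_kernel: "fiber_ideal = a_kernel loc ring_of_type_algebra fract_value"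
proof
  interpret loc: cring loc by (rule loc_cring)
  interpret h: ring_hom_ring loc "ring_of_type_algebra :: 'k alg_closure ring" fract_value
    by (rule fract_value_hom)
  have zero: "\<zero>\<^bsub>ring_of_type_algebra\<^esub> = (0 :: 'k alg_closure)"
    by (simp add: ring_of_type_algebra_def)
  have kernel: "a_kernel loc ring_of_type_algebra fract_value = {z \<in> carrier loc. fract_value z = 0}"
    unfolding a_kernel_def' zero ..
  have gens: "(\<lambda>i. Fract (f i) 1) ` {1..n} \<subseteq> carrier loc"
    using f_polys by (auto intro!: Fract_in_loc)
  show "fiber_ideal \<subseteq> a_kernel loc ring_of_type_algebra fract_value"
    unfolding zero_ideal_def
  proof (rule loc.genideal_minimal[OF h.kernel_is_ideal])
    show "(\<lambda>i. Fract (f i) 1) ` {1..n} \<subseteq> a_kernel loc ring_of_type_algebra fract_value"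
    proof (rule image_subsetI)
      fix i assume i: "i \<in> {1..n}"
      have "fract_value (Fract (f i) 1) = 0"
        using fract_value_Fract[of "f i" 1] f_polys[OF i] f_zero[OF i] by simp
      moreover have "Fract (f i) 1 \<in> carrier loc" using gens i by blast
      ultimately show "Fract (f i) 1 \<in> a_kernel loc ring_of_type_algebra fract_value"
        unfolding kernel by blast
    qed
  qed
  interpret I: ideal fiber_ideal loc
    unfolding zero_ideal_def by (rule loc.genideal_ideal[OF gens])
  show "a_kernel loc ring_of_type_algebra fract_value \<subseteq> fiber_ideal"
  proof
    fix z assume "z \<in> a_kernel loc ring_of_type_algebra fract_value"
    then have z: "z \<in> carrier loc" "fract_value z = 0"
      unfolding kernel by blast+
    obtain g h where gh: "z = Fract g h" "g \<in> polys n" "h \<in> polys n" "ev h \<noteq> 0" "h \<noteq> 0"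
      using z(1) by (rule loc_cases)
    then have "ev g = 0" using z(2) by (simp add: fract_value_Fract)
    then obtain U W where U: "U \<in> polys n" "ev U \<noteq> 0" "\<And>j. W j \<in> polys n"
      "g * U = (\<Sum>j\<in>{1..n}. f j * W j)"
      using generators_kill_point_ideal gh(2) by blast
    have U0: "U \<noteq> 0" using U(2) by auto
    have d: "Fract (\<Sum>j\<in>T. f j * W j) (U * h) \<in> fiber_ideal" if "T \<subseteq> {1..n}" for T
      using finite_subset[OF that finite_atLeastAtMost] that
    proof (induction T rule: finite_induct)
      case empty
      then show ?case using I.zero_closed by (simp add: loc_simps fract_collapse)
    next
      case (insert j T)
      have "Fract (f j) 1 \<in> fiber_ideal"
        using loc.genideal_self[OF gens] insert(4) unfolding zero_ideal_def by auto
      moreover have "Fract (W j) (U * h) \<in> carrier loc"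
        using U gh by (intro Fract_in_loc) (auto simp: ev.hom_mult intro: polys_mult)
      ultimately have "Fract (W j) (U * h) * Fract (f j) 1 \<in> fiber_ideal"
        using I.I_l_closed unfolding loc_simps by blast
      moreover have "Fract (\<Sum>j\<in>T. f j * W j) (U * h) \<in> fiber_ideal" using insert by auto
      ultimately have "Fract (W j) (U * h) * Fract (f j) 1 + Fract (\<Sum>j\<in>T. f j * W j) (U * h) \<in> fiber_ideal"
        using I.a_closed unfolding loc_simps by blast
      moreover have "Fract (W j) (U * h) * Fract (f j) 1 + Fract (\<Sum>j\<in>T. f j * W j) (U * h) =
          Fract (\<Sum>j\<in>insert j T. f j * W j) (U * h)"
        using insert(1,2) U0 gh(5) by (simp add: eq_fract algebra_simps)
      ultimately show ?case by simp
    qed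
    have "Fract (\<Sum>j\<in>{1..n}. f j * W j) (U * h) = Fract g h"
      using U0 gh(5) unfolding U(4)[symmetric] by (simp add: eq_fract algebra_simps)
    then show "z \<in> fiber_ideal" using d[of "{1..n}"] gh(1) by simp
  qed
qed

section \<open>The local algebra and its isomorphism with the residue field\<close>

abbreviation A :: "('k, 'k mpoly fract set) module" where
  "A \<equiv> local_algebra n point_ideal f"

abbreviation res :: "'k mpoly \<Rightarrow> 'k mpoly fract set" where
  "res \<equiv> residue_class n point_ideal f"

text \<open>The isomorphism of the first isomorphism theorem: \<open>fract_value\<close> is constant
  on each coset of its kernel, so its image of a coset is a singleton.\<close>

definition alg_value :: "'k mpoly fract set \<Rightarrow> 'k alg_closure" where
  "alg_value u = the_elem (fract_value ` u)"

lemma local_algebra_simps: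
  "carrier A = carrier (loc Quot fiber_ideal)" "add A = add (loc Quot fiber_ideal)"
  "monoid.mult A = monoid.mult (loc Quot fiber_ideal)" "\<one>\<^bsub>A\<^esub> = \<one>\<^bsub>loc Quot fiber_ideal\<^esub>"
  "\<zero>\<^bsub>A\<^esub> = \<zero>\<^bsub>loc Quot fiber_ideal\<^esub>" "c \<odot>\<^bsub>A\<^esub> u = res (mconst c) \<otimes>\<^bsub>loc Quot fiber_ideal\<^esub> u"
  by (simp_all add: local_algebra_def Let_def)

lemma quot_cring: "cring (loc Quot fiber_ideal)"
proof -
  interpret h: ring_hom_ring loc "ring_of_type_algebra :: 'k alg_closure ring" fract_value
    by (rule fract_value_hom)
  show ?thesis unfolding zero_ideal_eq_kernel
    using ideal.quotient_is_cring[OF h.kernel_is_ideal loc_cring] .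
qed

lemma abelian_monoid_local_algebra: "abelian_monoid A"
proof -
  interpret Q: cring "loc Quot fiber_ideal" by (rule quot_cring)
  show ?thesis
    by (rule abelian_monoidI) (simp_all add: local_algebra_simps Q.a_assoc, rule Q.a_comm)
qed

lemma alg_value_coset: "z \<in> carrier loc \<Longrightarrow> alg_value (fiber_ideal +>\<^bsub>loc\<^esub> z) = fract_value z"
  unfolding alg_value_def zero_ideal_eq_kernel
  by (rule ring_hom_ring.the_elem_simp[OF fract_value_hom])

lemma coset_in_A: "z \<in> carrier loc \<Longrightarrow> fiber_ideal +>\<^bsub>loc\<^esub> z \<in> carrier A"
  unfolding local_algebra_simps FactRing_def A_RCOSETS_def' by auto

lemma A_cases:
  assumes "u \<in> carrier A"
  obtains z where "z \<in> carrier loc" "u = fiber_ideal +>\<^bsub>loc\<^esub> z"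
  using assms unfolding local_algebra_simps FactRing_def A_RCOSETS_def' by auto

lemma res_in_A: "g \<in> polys n \<Longrightarrow> res g \<in> carrier A"
  unfolding residue_class_def by (intro coset_in_A Fract_in_loc) auto

lemma alg_value_res: "g \<in> polys n \<Longrightarrow> alg_value (res g) = ev g"
  unfolding residue_class_def by (subst alg_value_coset) (auto intro: Fract_in_loc simp: fract_value_Fract)

lemma alg_value_hom: "alg_value \<in> ring_hom (loc Quot fiber_ideal) ring_of_type_algebra"
  unfolding zero_ideal_eq_kernel alg_value_def[abs_def] by (rule ring_hom_ring.the_elem_hom[OF fract_value_hom])

lemma alg_value_add: "u \<in> carrier A \<Longrightarrow> v \<in> carrier A \<Longrightarrow> alg_value (u \<oplus>\<^bsub>A\<^esub> v) = alg_value u + alg_value v"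
  and alg_value_mult: "u \<in> carrier A \<Longrightarrow> v \<in> carrier A \<Longrightarrow> alg_value (u \<otimes>\<^bsub>A\<^esub> v) = alg_value u * alg_value v"
  and alg_value_one: "alg_value \<one>\<^bsub>A\<^esub> = 1"
  using alg_value_hom by (simp_all add: local_algebra_simps ring_hom_def ring_of_type_algebra_def)

lemma alg_value_zero: "alg_value \<zero>\<^bsub>A\<^esub> = 0"
proof -
  interpret A: abelian_monoid A by (rule abelian_monoid_local_algebra)
  have "alg_value \<zero>\<^bsub>A\<^esub> = alg_value \<zero>\<^bsub>A\<^esub> + alg_value \<zero>\<^bsub>A\<^esub>"
    using alg_value_add[of "\<zero>\<^bsub>A\<^esub>" "\<zero>\<^bsub>A\<^esub>"] by simp
  then show ?thesis by (simp only: add_cancel_right_right)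
qed

lemma smult_in_A: "u \<in> carrier A \<Longrightarrow> c \<odot>\<^bsub>A\<^esub> u \<in> carrier A"
  using monoid.m_closed[of "loc Quot fiber_ideal" "res (mconst c)" u] res_in_A[of "mconst c"] quot_cring
  by (auto simp: local_algebra_simps dest: cring.axioms ring.is_monoid)

lemma mult_in_A: "u \<in> carrier A \<Longrightarrow> v \<in> carrier A \<Longrightarrow> u \<otimes>\<^bsub>A\<^esub> v \<in> carrier A"
  using monoid.m_closed[of "loc Quot fiber_ideal" u v] quot_cring
  by (auto simp: local_algebra_simps dest: cring.axioms ring.is_monoid)

lemma one_in_A: "\<one>\<^bsub>A\<^esub> \<in> carrier A"
  using monoid.one_closed[of "loc Quot fiber_ideal"] quot_cring
  by (auto simp: local_algebra_simps dest: cring.axioms ring.is_monoid)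

lemma alg_value_smult: "u \<in> carrier A \<Longrightarrow> alg_value (c \<odot>\<^bsub>A\<^esub> u) = to_ac c * alg_value u"
  using alg_value_mult[of "res (mconst c)" u] res_in_A[of "mconst c"] alg_value_res[of "mconst c"]
  by (simp add: local_algebra_simps)

lemma alg_value_bij: "bij_betw alg_value (carrier A) point_field"
  unfolding bij_betw_def
proof
  show "inj_on alg_value (carrier A)"
    unfolding local_algebra_simps zero_ideal_eq_kernel alg_value_def[abs_def]
    by (rule inj_onI) (rule ring_hom_ring.the_elem_inj[OF fract_value_hom])
  show "alg_value ` carrier A = point_field"
  proof (intro equalityI subsetI)
    fix w assume "w \<in> alg_value ` carrier A"
    then obtain z where z: "z \<in> carrier loc" "w = fract_value z"
      by (auto elim!: A_cases simp: alg_value_coset)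
    obtain g h where gh: "z = Fract g h" "g \<in> polys n" "h \<in> polys n" "ev h \<noteq> 0" "h \<noteq> 0"
      using z(1) by (rule loc_cases)
    then show "w \<in> point_field" using z(2) by (simp add: fract_value_Fract point_fieldI)
  next
    fix w assume "w \<in> point_field"
    then obtain g h where gh: "w = ev g / ev h" "g \<in> polys n" "h \<in> polys n" "ev h \<noteq> 0"
      unfolding point_field_def by blast
    then have "w = alg_value (fiber_ideal +>\<^bsub>loc\<^esub> Fract g h)"
      by (simp add: alg_value_coset Fract_in_loc fract_value_Fract)
    then show "w \<in> alg_value ` carrier A" using gh by (auto intro!: coset_in_A Fract_in_loc)
  qed
qed

end


context simple_zero
begin

subsection \<open>The Scheja--Storch form is a scaled trace form\<close>

text \<open>The hypothesis J = c d^2 reflects that the rank-one class depends on J only up to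
  squares. Carried over to L, \<open>\<eta>\<close> becomes \<theta> with Tr(w) = \<theta>(w J);
  hence Tr(c z w) = \<theta>(c J z w), which a scaling of L turns into \<theta>(z w).\<close>

lemma scheja_storch_form:
  assumes \<Delta>: "difference_coeffs n f \<Delta>"
    and \<eta>: "scheja_storch_functional n point_ideal f \<Delta> \<eta>"
    and cd: "c \<in> point_field" "d \<in> point_field" "jacobian = c * d\<^sup>2"
  shows "gw_class A (\<lambda>u v. \<eta> (u \<otimes>\<^bsub>A\<^esub> v)) = gw_trace point_field (rank_one_form c)"
proof -
  note L = subspace_point_field
  obtain gs hs where lin: "linear_functional A \<eta>"
    and gh: "length gs = length hs" "set gs \<subseteq> polys n" "set hs \<subseteq> polys n"
    and det: "det (mat n n (\<lambda>(i, j). \<Delta> (Suc i) (Suc j))) = (\<Sum>l<length gs. gs ! l * in_Y n (hs ! l))"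
    and unit: "(\<Oplus>\<^bsub>A\<^esub>l\<in>{..<length gs}. \<eta> (res (gs ! l)) \<odot>\<^bsub>A\<^esub> res (hs ! l)) = \<one>\<^bsub>A\<^esub>"
    using \<eta> unfolding scheja_storch_functional_def Let_def by blast
  define N where "N = length gs"
  define a where "a l = ev (gs ! l)" for l
  define b where "b l = ev (hs ! l)" for l
  have gl: "gs ! l \<in> polys n" "hs ! l \<in> polys n" if "l < N" for l
    using that gh by (auto simp: N_def subset_iff)
  have ab: "a l \<in> point_field" "b l \<in> point_field" if "l < N" for l
    using gl[OF that] by (simp_all add: a_def b_def ev_in_point_field)
  have J: "(\<Sum>l<N. a l * b l) = jacobian"
    using ev_contract_det[OF \<Delta> gh(2,3,1) det] by (simp only: N_def a_def b_def)
  have inj: "inj_on alg_value (carrier A)" and im: "alg_value ` carrier A = point_field"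
    using alg_value_bij by (auto simp: bij_betw_def)
  define \<theta> where "\<theta> z = \<eta> (inv_into (carrier A) alg_value z)" for z
  have \<theta>: "\<theta> (alg_value u) = \<eta> u" if "u \<in> carrier A" for u
    unfolding \<theta>_def inv_into_f_f[OF inj that] ..
  interpret A: abelian_monoid A by (rule abelian_monoid_local_algebra)
  have \<theta>lin: "ac_linear_on point_field \<theta>"
    unfolding ac_linear_on_def im[symmetric]
  proof (intro conjI ballI allI)
    fix z w assume "z \<in> alg_value ` carrier A" "w \<in> alg_value ` carrier A"
    then obtain u v where uv: "z = alg_value u" "w = alg_value v" "u \<in> carrier A" "v \<in> carrier A" by blast
    have "\<theta> (alg_value (u \<oplus>\<^bsub>A\<^esub> v)) = \<eta> u + \<eta> v"
      using lin uv(3,4) \<theta>[OF A.a_closed[OF uv(3,4)]] by (simp add: linear_functional_def)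
    then show "\<theta> (z + w) = \<theta> z + \<theta> w" using uv \<theta> by (simp add: alg_value_add)
  next
    fix c z assume "z \<in> alg_value ` carrier A"
    then obtain u where u: "z = alg_value u" "u \<in> carrier A" by blast
    have "\<theta> (alg_value (c \<odot>\<^bsub>A\<^esub> u)) = c * \<eta> u"
      using lin u(2) \<theta>[OF smult_in_A[OF u(2)]] by (simp add: linear_functional_def)
    then show "\<theta> (to_ac c * z) = c * \<theta> z" using u \<theta> by (simp add: alg_value_smult)
  qed
  have \<theta>a: "\<theta> (a l) = \<eta> (res (gs ! l))" if "l < N" for l
    using \<theta>[OF res_in_A] alg_value_res gl[OF that] by (simp add: a_def)
  have unit': "(\<Sum>l<N. to_ac (\<theta> (a l)) * b l) = 1"
  proof -
    have "alg_value (\<Oplus>\<^bsub>A\<^esub>l\<in>{..<N}. \<eta> (res (gs ! l)) \<odot>\<^bsub>A\<^esub> res (hs ! l)) =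
        (\<Sum>l<N. alg_value (\<eta> (res (gs ! l)) \<odot>\<^bsub>A\<^esub> res (hs ! l)))"
      using gl by (intro linear_bij_finsum[OF abelian_monoid_local_algebra alg_value_add alg_value_zero])
        (auto intro: smult_in_A res_in_A)
    also have "\<dots> = (\<Sum>l<N. to_ac (\<theta> (a l)) * b l)"
      using gl \<theta>a by (intro sum.cong refl) (simp add: alg_value_smult res_in_A alg_value_res b_def)
    finally show ?thesis using unit alg_value_one by (simp add: N_def)
  qed
  obtain \<mu> where \<mu>: "ac_linear_on UNIV \<mu>" "\<And>z. z \<in> point_field \<Longrightarrow> \<mu> z = \<theta> z"
    using ac_linear_extend[OF L \<theta>lin] by blast
  have central: "(\<Sum>l<N. a l * to_ac (\<theta> (b l * z))) = z * (\<Sum>l<N. a l * to_ac (\<theta> (b l)))"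
    if z: "z \<in> point_field" for z
  proof -
    have "(\<Sum>l<N. a l * to_ac (\<mu> (b l * z))) = z * (\<Sum>l<N. a l * to_ac (\<mu> (b l)))"
      using central[OF \<Delta> gh(2,3,1) det \<mu>(1) z] by (simp only: N_def a_def b_def)
    moreover have "\<mu> (b l * z) = \<theta> (b l * z)" "\<mu> (b l) = \<theta> (b l)" if "l < N" for l
      using \<mu>(2) ab(2)[OF that] point_field_mult[OF ab(2)[OF that] z] by auto
    ultimately show ?thesis by (simp cong: sum.cong_simp)
  qed
  have "\<exists>l<N. \<theta> (a l) \<noteq> 0"
  proof (rule ccontr)
    assume "\<not> ?thesis"
    then have "(\<Sum>l<N. to_ac (\<theta> (a l)) * b l) = 0" by (intro sum.neutral) auto
    then show False using unit' by simp
  qed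
  then obtain l0 where l0: "l0 < N" "\<theta> (a l0) \<noteq> 0" by blast
  \<comment> \<open>The unit condition contracts the first factor;
    \<open>field_trace_dual_system\<close> needs the contraction of the second. The element a_l0
    witnesses that \<theta> is not zero on L.\<close>
  have one: "(\<Sum>l<N. a l * to_ac (\<theta> (b l))) = 1"
    using contraction_symmetric[OF L point_field_mult point_field_inverse \<theta>lin ab central ab(1)[OF l0(1)] l0(2)]
      unit' by simp
  have dual: "(\<Sum>l<N. a l * to_ac (\<theta> (b l * z))) = z" if "z \<in> point_field" for z
    using central[OF that] one by simp
  note basis = field_trace_dual_system(1)[OF L point_field_mult \<theta>lin ab dual]
  have tr: "field_trace point_field w = \<theta> (w * jacobian)" if "w \<in> point_field" for w
    using field_trace_dual_system(2)[OF L point_field_mult \<theta>lin ab dual that] unfolding J .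
  have c0: "c \<noteq> 0" and d0: "d \<noteq> 0" using cd(3) jacobian_nonzero by auto
  \<comment> \<open>The scaling is chosen so that c J e^2 = 1.\<close>
  define e where "e = inverse (c * d)"
  have e: "e \<in> point_field" "e \<noteq> 0"
    using cd c0 d0 by (simp_all add: e_def point_field_inverse point_field_mult)
  define \<beta> where "\<beta> z w = field_trace point_field (c * z * w)" for z w
  have \<beta>: "\<beta> z w = \<theta> (c * jacobian * z * w)" if "z \<in> point_field" "w \<in> point_field" for z w
    unfolding \<beta>_def using tr[of "c * z * w"] cd(1) that by (simp only: point_field_mult mult_ac)
  have jL: "jacobian \<in> point_field" unfolding cd(3) power2_eq_square using cd by (intro point_field_mult)
  have nd: "nondegenerate_form point_field \<beta>"
    unfolding nondegenerate_form_def
  proof (intro conjI ballI impI)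
    fix z assume z: "z \<in> point_field"
    define k where "k = c * jacobian * z"
    have k: "k \<in> point_field" unfolding k_def using cd(1) jL z by (intro point_field_mult)
    have bk: "\<beta> z w = \<theta> (k * w)" if "w \<in> point_field" for w
      unfolding k_def using \<beta>[OF z that] .
    show "ac_linear_on point_field (\<beta> z)"
      unfolding ac_linear_on_def
    proof (intro conjI ballI allI)
      fix v w assume v: "v \<in> point_field" and w: "w \<in> point_field"
      show "\<beta> z (v + w) = \<beta> z v + \<beta> z w"
        using \<theta>lin point_field_mult[OF k v] point_field_mult[OF k w] point_field_add[OF v w] v w
        by (simp add: bk distrib_left ac_linear_on_def)
    next
      fix r v assume v: "v \<in> point_field"
      have "k * (to_ac r * v) = to_ac r * (k * v)" by (simp only: mult_ac)
      moreover have "\<theta> (to_ac r * (k * v)) = r * \<theta> (k * v)"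
        using \<theta>lin point_field_mult[OF k v] unfolding ac_linear_on_def by blast
      ultimately show "\<beta> z (to_ac r * v) = r * \<beta> z v"
        unfolding bk[OF v] bk[OF point_field_mult[OF to_ac_in_point_field v]] by (simp only:)
    qed
    show "\<beta> z w = \<beta> w z" for w unfolding \<beta>_def by (simp only: mult_ac)
    assume zero: "\<forall>w\<in>point_field. \<beta> z w = 0"
    show "z = 0"
    proof (rule ccontr)
      assume "z \<noteq> 0"
      then have k0: "k \<noteq> 0" using c0 jacobian_nonzero by (simp add: k_def)
      \<comment> \<open>For invertible k the vector w = a_l0 / k pairs with z to \<theta>(a_l0)
        \<noteq> 0, so z is not in the radical.\<close>
      have "\<theta> (a l0) = \<beta> z (inverse k * a l0)"
        using k0 bk[OF point_field_mult[OF point_field_inverse[OF k] ab(1)[OF l0(1)]]]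
        by (simp add: mult.assoc[symmetric])
      then show False using zero l0 point_field_mult[OF point_field_inverse[OF k] ab(1)[OF l0(1)]] by simp
    qed
  qed
  have "gw_class A (\<lambda>u v. \<eta> (u \<otimes>\<^bsub>A\<^esub> v)) = gw_class (field_extension point_field) \<beta>"
  proof (rule gw_class_transport[OF abelian_monoid_local_algebra L smult_in_A _ _ _ _ _ nd basis])
    let ?\<psi> = "\<lambda>u. e * alg_value u"
    show "?\<psi> (u \<oplus>\<^bsub>A\<^esub> v) = ?\<psi> u + ?\<psi> v" if "u \<in> carrier A" "v \<in> carrier A" for u v
      unfolding alg_value_add[OF that] by (rule distrib_left)
    show "?\<psi> \<zero>\<^bsub>A\<^esub> = 0" by (simp add: alg_value_zero)
    show "?\<psi> (r \<odot>\<^bsub>A\<^esub> v) = to_ac r * ?\<psi> v" if "v \<in> carrier A" for r v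
      unfolding alg_value_smult[OF that] by (rule mult.left_commute)
    have "bij_betw (\<lambda>z. e * z) point_field point_field"
      by (rule bij_betw_byWitness[of _ "\<lambda>z. inverse e * z"])
        (use e in \<open>auto simp: mult.assoc[symmetric] point_field_mult point_field_inverse\<close>)
    then show "bij_betw ?\<psi> (carrier A) point_field"
      using bij_betw_trans[OF alg_value_bij] by (simp add: comp_def)
    fix u v assume u: "u \<in> carrier A" and v: "v \<in> carrier A"
    have uL: "alg_value u \<in> point_field" and vL: "alg_value v \<in> point_field" using u v im by auto
    have "c * d * e = 1" unfolding e_def using c0 d0 by (intro right_inverse) simp
    moreover have "c * (c * d\<^sup>2) * e * e = (c * d * e) * (c * d * e)"
      by (simp only: power2_eq_square mult_ac)
    ultimately have one: "c * jacobian * e * e = 1" unfolding cd(3) by simp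
    have "\<beta> (?\<psi> u) (?\<psi> v) = \<theta> (c * jacobian * (e * alg_value u) * (e * alg_value v))"
      using \<beta> uL vL e(1) point_field_mult by blast
    also have "c * jacobian * (e * alg_value u) * (e * alg_value v) =
        (c * jacobian * e * e) * (alg_value u * alg_value v)" by (simp only: mult_ac)
    also have "\<dots> = alg_value (u \<otimes>\<^bsub>A\<^esub> v)" unfolding one alg_value_mult[OF u v] by simp
    also have "\<theta> (alg_value (u \<otimes>\<^bsub>A\<^esub> v)) = \<eta> (u \<otimes>\<^bsub>A\<^esub> v)" by (rule \<theta>[OF mult_in_A[OF u v]])
    finally show "\<eta> (u \<otimes>\<^bsub>A\<^esub> v) = \<beta> (?\<psi> u) (?\<psi> v)" ..
  qed
  then show ?thesis
    unfolding gw_trace_def rank_one_form_def \<beta>_def[abs_def] .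
qed

text \<open>J \<noteq> 0 supplies a functional \<mu> whose contraction q of \<Sum> a_l \<otimes> b_l
  is nonzero. Twisting \<mu> by 1/q normalizes the contraction of the second factor to 1, and by
  symmetry that of the first.\<close>

lemma scheja_storch_exists:
  obtains \<Delta> \<eta> where "difference_coeffs n f \<Delta>" "scheja_storch_functional n point_ideal f \<Delta> \<eta>"
proof -
  note L = subspace_point_field
  obtain \<Delta> where \<Delta>: "difference_coeffs n f \<Delta>" using difference_coeffs_exist f_polys by blast
  obtain gs hs where gh: "length gs = length hs" "set gs \<subseteq> polys n" "set hs \<subseteq> polys n"
    and det: "det (mat n n (\<lambda>(i, j). \<Delta> (Suc i) (Suc j))) = (\<Sum>l<length gs. gs ! l * in_Y n (hs ! l))"
    using tensor_decomposition[OF det_difference_coeffs_polys[OF \<Delta>]] by blast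
  define N where "N = length gs"
  define a where "a l = ev (gs ! l)" for l
  define b where "b l = ev (hs ! l)" for l
  have gl: "gs ! l \<in> polys n" "hs ! l \<in> polys n" if "l < N" for l
    using that gh by (auto simp: N_def subset_iff)
  have ab: "a l \<in> point_field" "b l \<in> point_field" if "l < N" for l
    using gl[OF that] by (simp_all add: a_def b_def ev_in_point_field)
  have "(\<Sum>l<N. a l * b l) \<noteq> 0"
    using ev_contract_det[OF \<Delta> gh(2,3,1) det] jacobian_nonzero by (simp add: N_def a_def b_def)
  then obtain \<mu> where \<mu>: "ac_linear_on UNIV \<mu>" "(\<Sum>l<N. a l * to_ac (\<mu> (b l))) \<noteq> 0"
    by (rule ac_linear_nonvanishing)
  define q where "q = (\<Sum>l<N. a l * to_ac (\<mu> (b l)))"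
  have "q = (\<Sum>l<N. to_ac (\<mu> (b l)) * a l)" by (simp add: q_def mult.commute)
  then have q: "q \<in> point_field" "q \<noteq> 0"
    using \<mu>(2) ab subfield_sum_closed[OF L point_field_mult, of N a] by (auto simp: q_def)
  \<comment> \<open>By \<open>central\<close> with z = 1/q, the sum \<Sum> a_l \<theta>(b_l) is
    (1/q) q = 1.\<close>
  define \<theta> where "\<theta> z = \<mu> (z * inverse q)" for z
  have \<theta>: "ac_linear_on UNIV \<theta>" unfolding \<theta>_def by (rule ac_linear_mult[OF \<mu>(1)])
  have central: "(\<Sum>l<N. a l * to_ac (\<nu> (b l * z))) = z * (\<Sum>l<N. a l * to_ac (\<nu> (b l)))"
    if "z \<in> point_field" "ac_linear_on UNIV \<nu>" for z \<nu>
    using central[OF \<Delta> gh(2,3,1) det that(2,1)] by (simp only: N_def a_def b_def)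
  have one: "(\<Sum>l<N. a l * to_ac (\<theta> (b l))) = 1"
    using central[OF point_field_inverse[OF q(1)] \<mu>(1)] q(2) by (simp add: \<theta>_def q_def)
  have "\<exists>l<N. \<theta> (b l) \<noteq> 0"
  proof (rule ccontr)
    assume "\<not> ?thesis"
    then have "(\<Sum>l<N. a l * to_ac (\<theta> (b l))) = 0" by (intro sum.neutral) auto
    then show False using one by simp
  qed
  then obtain l0 where l0: "l0 < N" "\<theta> (b l0) \<noteq> 0" by blast
  have sym: "(\<Sum>l<N. to_ac (\<theta> (a l)) * b l) = 1"
    using contraction_symmetric[OF L point_field_mult point_field_inverse
        ac_linear_on_subset[OF \<theta> subset_UNIV] ab central[OF _ \<theta>] ab(2)[OF l0(1)] l0(2)] one by simp
  interpret A: abelian_monoid A by (rule abelian_monoid_local_algebra)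
  define \<eta> where "\<eta> u = \<theta> (alg_value u)" for u
  have "linear_functional A \<eta>"
    unfolding linear_functional_def \<eta>_def
    using \<theta> by (simp add: alg_value_add alg_value_smult ac_linear_on_def)
  moreover have "(\<Oplus>\<^bsub>A\<^esub>l\<in>{..<N}. \<eta> (res (gs ! l)) \<odot>\<^bsub>A\<^esub> res (hs ! l)) = \<one>\<^bsub>A\<^esub>"
  proof -
    have in_A: "(\<lambda>l. \<eta> (res (gs ! l)) \<odot>\<^bsub>A\<^esub> res (hs ! l)) \<in> {..<N} \<rightarrow> carrier A"
      using gl by (auto intro: smult_in_A res_in_A)
    have "alg_value (\<Oplus>\<^bsub>A\<^esub>l\<in>{..<N}. \<eta> (res (gs ! l)) \<odot>\<^bsub>A\<^esub> res (hs ! l)) =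
        (\<Sum>l<N. alg_value (\<eta> (res (gs ! l)) \<odot>\<^bsub>A\<^esub> res (hs ! l)))"
      by (rule linear_bij_finsum[OF abelian_monoid_local_algebra alg_value_add alg_value_zero _ in_A]) simp_all
    also have "\<dots> = (\<Sum>l<N. to_ac (\<theta> (a l)) * b l)"
      using gl by (intro sum.cong refl) (simp add: alg_value_smult res_in_A alg_value_res a_def b_def \<eta>_def)
    also have "\<dots> = alg_value \<one>\<^bsub>A\<^esub>" using sym alg_value_one by simp
    finally show ?thesis
      using alg_value_bij A.finsum_closed[OF in_A] one_in_A by (auto simp: bij_betw_def dest: inj_onD)
  qed
  ultimately have "scheja_storch_functional n point_ideal f \<Delta> \<eta>"
    unfolding scheja_storch_functional_def Let_def N_def using gh det by blast
  then show thesis using that \<Delta> by blast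
qed

text \<open>By \<open>scheja_storch_form\<close> every admissible pair (\<open>\<Delta>\<close>,
  \<open>\<eta>\<close>) leads to a class that mentions neither of them, which is the uniqueness
  that the description needs.\<close>

theorem local_A1_degree_simple_zero:
  assumes "c \<in> point_field" "d \<in> point_field" "jacobian = c * d\<^sup>2"
  shows "local_A1_degree n point_ideal f = gw_trace point_field (rank_one_form c)"
  unfolding local_A1_degree_def
proof (rule the_equality)
  obtain \<Delta> \<eta> where *: "difference_coeffs n f \<Delta>" "scheja_storch_functional n point_ideal f \<Delta> \<eta>"
    by (rule scheja_storch_exists)
  then show "\<exists>\<Delta> \<eta>. difference_coeffs n f \<Delta> \<and> scheja_storch_functional n point_ideal f \<Delta> \<eta> \<and>
      gw_trace point_field (rank_one_form c) = gw_class A (\<lambda>u v. \<eta> (u \<otimes>\<^bsub>A\<^esub> v))"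
    using scheja_storch_form[OF * assms, symmetric] by blast
qed (use scheja_storch_form assms in blast)

end


section \<open>The tangency quadrics\<close>

text \<open>The homomorphism is general because three are used: \<open>to_ac\<close> for values,
  \<open>mconst\<close> for dehomogenization, and constants into univariate polynomials for
  derivatives.\<close>

lemma meval_tangency_quadric:
  assumes "comm_ring_hom \<phi>"
  defines "c \<equiv> \<lambda>p. \<phi> (center_x p)" and "d \<equiv> \<lambda>p. \<phi> (center_y p)" and "r \<equiv> \<lambda>p. \<phi> (radius_sq p)"
  shows "meval \<phi> \<tau> (tangency_quadric p) =
    (c p * (\<tau> 1 + 2 * c p * \<tau> 0) + d p * (\<tau> 2 + 2 * d p * \<tau> 0)
       + (\<tau> 3 - ((c p)\<^sup>2 + (d p)\<^sup>2 - r p) * \<tau> 0))\<^sup>2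
    - r p * ((\<tau> 1 + 2 * c p * \<tau> 0)\<^sup>2 + (\<tau> 2 + 2 * d p * \<tau> 0)\<^sup>2)"
proof -
  interpret \<phi>: comm_ring_hom \<phi> by fact
  interpret m: comm_ring_hom "meval \<phi> \<tau>" by (rule \<phi>.meval_hom)
  have "\<phi> 2 = 2" using \<phi>.hom_add[of 1 1] by simp
  then show ?thesis
    by (simp add: tangency_quadric_def Let_def m.hom_minus m.hom_power m.hom_add m.hom_mult
        c_def d_def r_def \<phi>.hom_minus \<phi>.hom_power \<phi>.hom_add \<phi>.hom_mult)
qed

lemma meval_dehomogenize:
  assumes "comm_ring_hom \<phi>"
  shows "meval \<phi> \<tau> (dehomogenize q) = meval \<phi> (\<lambda>i. if i = 0 then 1 else \<tau> i) q"
proof -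
  interpret \<phi>: comm_ring_hom \<phi> by fact
  interpret m: comm_ring_hom "meval \<phi> \<tau>" by (rule \<phi>.meval_hom)
  have "(\<lambda>i. meval \<phi> \<tau> (if i = 0 then 1 else mvar i)) = (\<lambda>i. if i = 0 then 1 else \<tau> i)"
    by auto
  then show ?thesis unfolding dehomogenize_def m.hom_meval[OF mconst_hom] by simp
qed

lemma meval_mpderiv_dehomogenize:
  fixes \<phi> :: "'a::field \<Rightarrow> 'b::idom"
  assumes \<phi>: "comm_ring_hom \<phi>" and "\<tau> 0 = 1" "j \<noteq> 0"
  shows "meval \<phi> \<tau> (mpderiv j (dehomogenize q)) = meval \<phi> \<tau> (mpderiv j q)"
proof -
  interpret \<phi>: comm_ring_hom \<phi> by fact
  have c: "comm_ring_hom (\<lambda>c. [:\<phi> c:])"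
    by unfold_locales (simp_all add: \<phi>.hom_add \<phi>.hom_mult one_pCons)
  have "(\<lambda>i. if i = 0 then 1 else [:\<tau> i, if i = j then 1 else 0:]) =
      (\<lambda>i. [:\<tau> i, if i = j then 1 else 0:])"
    using assms by (auto simp: one_pCons)
  then show ?thesis unfolding meval_mpderiv[OF \<phi>] meval_dehomogenize[OF c] by simp
qed

lemma dehomogenize_tangency_quadric_polys: "dehomogenize (tangency_quadric p) \<in> polys 3"
  for p :: "nat \<Rightarrow> 'k::field"
proof -
  have "(2 :: 'k mpoly) \<in> polys 3" using polys_add[of "1 :: 'k mpoly" 3 1] by simp
  then show ?thesis
    unfolding dehomogenize_def meval_tangency_quadric[OF mconst_hom]
    by (intro polys_diff polys_mult polys_add)
      (auto simp: power2_eq_square intro!: polys_mvar polys_mult polys_add polys_diff)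
qed

text \<open>The quadric has the form L^2 - r (U^2 + V^2) with linear forms L, U, V. Differentiating
  along e_j replaces one factor of each square by the value of the form at e_j, whose coordinates
  are the \<delta> j i.\<close>

lemma meval_mpderiv_tangency_quadric:
  fixes \<phi> :: "'a::field \<Rightarrow> 'b::idom"
  assumes \<phi>: "comm_ring_hom \<phi>"
  defines "c \<equiv> \<lambda>p. \<phi> (center_x p)" and "d \<equiv> \<lambda>p. \<phi> (center_y p)" and "r \<equiv> \<lambda>p. \<phi> (radius_sq p)"
    and "\<delta> \<equiv> \<lambda>j i. if i = j then 1 else 0"
  shows "meval \<phi> \<tau> (mpderiv j (tangency_quadric p)) =
    2 * (c p * (\<tau> 1 + 2 * c p * \<tau> 0) + d p * (\<tau> 2 + 2 * d p * \<tau> 0)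
       + (\<tau> 3 - ((c p)\<^sup>2 + (d p)\<^sup>2 - r p) * \<tau> 0))
     * (c p * (\<delta> j 1 + 2 * c p * \<delta> j 0) + d p * (\<delta> j 2 + 2 * d p * \<delta> j 0)
       + (\<delta> j 3 - ((c p)\<^sup>2 + (d p)\<^sup>2 - r p) * \<delta> j 0))
    - 2 * r p * ((\<tau> 1 + 2 * c p * \<tau> 0) * (\<delta> j 1 + 2 * c p * \<delta> j 0)
       + (\<tau> 2 + 2 * d p * \<tau> 0) * (\<delta> j 2 + 2 * d p * \<delta> j 0))"
proof -
  interpret \<phi>: comm_ring_hom \<phi> by fact
  have ch: "comm_ring_hom (\<lambda>c. [:\<phi> c:])"
    by unfold_locales (simp_all add: \<phi>.hom_add \<phi>.hom_mult one_pCons)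
  have sq: "poly (pderiv (P\<^sup>2)) 0 = 2 * poly P 0 * poly (pderiv P) 0" for P :: "'b poly"
    by (simp add: power2_eq_square pderiv_mult)
  have two: "(2 :: 'b poly) = [:2:]" by (simp add: numeral_poly)
  have sc: "poly (pderiv ([:k:] * P)) 0 = k * poly (pderiv P) 0" for k and P :: "'b poly"
    by (simp add: pderiv_smult)
  have lin: "pderiv [:u, v:] = [:v:]" for u v :: 'b by (simp add: pderiv_pCons)
  show ?thesis
    unfolding meval_mpderiv[OF \<phi>] meval_tangency_quadric[OF ch]
    by (simp only: pderiv_diff pderiv_add poly_diff poly_add sq sc \<delta>_def c_def d_def r_def)
      (simp add: lin two pderiv_diff pderiv_add pderiv_smult power2_eq_square algebra_simps)
qed

subsection \<open>Three by three determinants\<close>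

lemma det_mat_2:
  fixes F :: "nat \<times> nat \<Rightarrow> 'a::comm_ring_1"
  shows "det (mat 2 2 F) = F (0, 0) * F (1, 1) - F (1, 0) * F (0, 1)"
proof -
  have 1: "det (mat (Suc 0) (Suc 0) G) = G (0, 0)" for G :: "nat \<times> nat \<Rightarrow> 'a"
    by (subst det_single) auto
  have "det (mat 2 2 F) = (\<Sum>i<2. mat 2 2 F $$ (i, 0) * cofactor (mat 2 2 F) i 0)"
    by (rule laplace_expansion_column) auto
  then show ?thesis
    by (simp add: cofactor_def mat_delete_def eval_nat_numeral lessThan_Suc 1)
qed

lemma det_mat_3:
  fixes F :: "nat \<times> nat \<Rightarrow> 'a::comm_ring_1"
  shows "det (mat 3 3 F) =
      F (0, 0) * (F (1, 1) * F (2, 2) - F (2, 1) * F (1, 2))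
    - F (1, 0) * (F (0, 1) * F (2, 2) - F (2, 1) * F (0, 2))
    + F (2, 0) * (F (0, 1) * F (1, 2) - F (1, 1) * F (0, 2))"
proof -
  have "det (mat 3 3 F) = (\<Sum>i<3. mat 3 3 F $$ (i, 0) * cofactor (mat 3 3 F) i 0)"
    by (rule laplace_expansion_column) auto
  also have "\<dots> = F (0, 0) * cofactor (mat 3 3 F) 0 0 + F (1, 0) * cofactor (mat 3 3 F) 1 0
      + F (2, 0) * cofactor (mat 3 3 F) 2 0"
    by (simp add: eval_nat_numeral lessThan_Suc ac_simps)
  finally show ?thesis
    unfolding cofactor_def mat_delete_def by (simp add: det_mat_2 numeral_2_eq_2[symmetric]) (simp add: algebra_simps)
qed

subsection \<open>Tangent circles\<close>

lemma sum_1_3: "(\<Sum>i\<in>{1..3}. F i) = F 1 + F 2 + F (3::nat)"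
  by (simp add: eval_nat_numeral)

lemma sum_triples:
  "(\<Sum>(i, m, n) \<in> {(i, m, n). {i, m, n} = {1, 2, 3} \<and> m < n}. F i m n) =
    F 1 2 3 + F 2 1 3 + F 3 1 (2::nat)"
proof -
  have "{(i, m, n). {i, m, n} = {1, 2, 3} \<and> m < n} = {(1, 2, 3), (2, 1, 3), (3, 1, 2::nat)}"
    (is "?S = ?T")
  proof
    show "?T \<subseteq> ?S" by auto
    show "?S \<subseteq> ?T"
    proof
      fix t assume "t \<in> ?S"
      then obtain i m n where t: "t = (i, m, n)" "{i, m, n} = {1, 2, 3}" "m < n" by blast
      then have "1 \<in> {i, m, n}" "2 \<in> {i, m, n}" "3 \<in> {i, m, n}" by blast+
      then have "i = 1 \<and> m = 2 \<and> n = 3 \<or> i = 2 \<and> m = 1 \<and> n = 3 \<or> i = 3 \<and> m = 1 \<and> n = 2"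
        using t(3) unfolding insert_iff empty_iff by (elim disjE) simp_all
      then show "t \<in> ?T" using t(1) by auto
    qed
  qed
  then show ?thesis by (simp add: add.assoc)
qed

text \<open>For the plane vectors (p, q) and (d, e), these are polarization, Lagrange's identity,
  and four expansions that become proportionalities as soon as the cross product p e - q d
  vanishes.\<close>

lemma plane_identities:
  fixes p q d e c :: "'b::comm_ring_1"
  shows plane_norm_diff: "d\<^sup>2 + e\<^sup>2 + (p\<^sup>2 + q\<^sup>2) - ((p - d)\<^sup>2 + (q - e)\<^sup>2) = 2 * (p * d + q * e)"
    and plane_lagrange: "(2 * (p * d + q * e))\<^sup>2 - 4 * (p\<^sup>2 + q\<^sup>2) * (d\<^sup>2 + e\<^sup>2) = - (4 * (p * e - q * d)\<^sup>2)"
    and plane_cross1: "(p * d + q * e) * c + (p\<^sup>2 + q\<^sup>2) * d = (p * d + q * e) * (p + c) - (p * e - q * d) * q"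
    and plane_cross2: "(p * d + q * e) * c + (p\<^sup>2 + q\<^sup>2) * e = (p * d + q * e) * (q + c) + (p * e - q * d) * p"
    and plane_cross3: "(p * d + q * e) * (p - d) = (p * (p - d) + q * (q - e)) * d + (p * e - q * d) * q"
    and plane_cross4: "(p * d + q * e) * (q - e) = (p * (p - d) + q * (q - e)) * e - (p * e - q * d) * p"
  by (simp_all add: power2_eq_square algebra_simps)

text \<open>
  Let \<open>p\<close> and \<open>d\<close> be the vectors from the center \<open>(a, b)\<close> of a circle of radius squared \<open>r\<close> to a
  point \<open>(x, y)\<close> common to a second circle, and to the center \<open>(a', b')\<close> of that circle. The tangency
  equation says that \<open>p\<close> and \<open>d\<close> are parallel; \<open>u\<close> and \<open>v\<close> below are \<open>\<langle>p, d\<rangle>\<close> and \<open>\<langle>p, d\<rangle> - r\<close>.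
\<close>

lemma tangent_circles:
  fixes a b a' b' x y r r' :: "'b::field"
  assumes two: "(2 :: 'b) \<noteq> 0"
    and C: "(x - a)\<^sup>2 + (y - b)\<^sup>2 = r" and S: "(x - a')\<^sup>2 + (y - b')\<^sup>2 = r'"
    and tangent: "((a - a')\<^sup>2 + (b - b')\<^sup>2 + r - r')\<^sup>2 - 4 * r * ((a - a')\<^sup>2 + (b - b')\<^sup>2) = 0"
  defines "u \<equiv> (a - x) * (a - a') + (b - y) * (b - b')"
    and "v \<equiv> (a - x) * (x - a') + (b - y) * (y - b')"
  shows "(a - a')\<^sup>2 + (b - b')\<^sup>2 + r - r' = 2 * u"
    and "u * a - r * (a - a') = u * x" and "u * b - r * (b - b') = u * y"
    and "u * (x - a') = v * (a - a')" and "u * (y - b') = v * (b - b')"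
proof -
  define p where "p = x - a"
  define q where "q = y - b"
  define d where "d = a' - a"
  define e where "e = b' - b"
  define k where "k = p * e - q * d"
  have diffs: "x - a = p" "y - b = q" "a - x = - p" "b - y = - q" "a - a' = - d" "b - b' = - e"
    "x - a' = p - d" "y - b' = q - e" and xy: "x = p + a" "y = q + b"
    by (simp_all add: p_def q_def d_def e_def)
  have r: "r = p\<^sup>2 + q\<^sup>2" "r' = (p - d)\<^sup>2 + (q - e)\<^sup>2" using C S unfolding diffs by auto
  have u: "u = p * d + q * e" and v: "v = - (p * (p - d) + q * (q - e))"
    unfolding u_def v_def diffs by simp_all
  show L: "(a - a')\<^sup>2 + (b - b')\<^sup>2 + r - r' = 2 * u"
    unfolding diffs r u plane_norm_diff[symmetric] by (simp only: power2_minus add_diff_eq)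
  \<comment> \<open>By Lagrange's identity the left-hand side is -4 k^2, so the tangency equation
    forces the cross product k to vanish when 2 \<noteq> 0.\<close>
  have "(2 * u)\<^sup>2 - 4 * r * (d\<^sup>2 + e\<^sup>2) = 0"
    using tangent unfolding L unfolding diffs by (simp only: power2_minus)
  then have "4 * k\<^sup>2 = 0" unfolding u r plane_lagrange k_def[symmetric] by simp
  moreover have "(4 :: 'b) = 2 * 2" by simp
  ultimately have k: "p * e - q * d = 0" using two unfolding k_def by (metis mult_eq_0_iff power2_eq_square)
  show "u * a - r * (a - a') = u * x"
    using plane_cross1[of p d q e a] unfolding diffs u r xy(1) k by simp
  show "u * b - r * (b - b') = u * y"
    using plane_cross2[of p d q e b] unfolding diffs u r xy(2) k by simp
  show "u * (x - a') = v * (a - a')"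
    using plane_cross3[of p d q e] unfolding diffs u v k
    by (simp only: minus_mult_minus mult_zero_left add_0_right diff_0_right)
  show "u * (y - b') = v * (b - b')"
    using plane_cross4[of p d q e] unfolding diffs u v k
    by (simp only: minus_mult_minus mult_zero_left add_0_right diff_0_right)
qed

lemma circle_of_center:
  fixes p :: "nat \<Rightarrow> 'b::field"
  assumes two: "(2 :: 'b) \<noteq> 0"
  shows "p 1 / p 0 = - 2 * center_x p" "p 2 / p 0 = - 2 * center_y p"
    "p 3 / p 0 = (center_x p)\<^sup>2 + (center_y p)\<^sup>2 - radius_sq p"
  using two by (simp_all add: center_x_def center_y_def radius_sq_def)

lemma complete_squares:
  fixes h u v w x y :: "'b::comm_ring_1"
  shows "h * (x\<^sup>2 + y\<^sup>2) + 1 * (h * (- 2 * u) * x + h * (- 2 * v) * y + h * (u\<^sup>2 + v\<^sup>2 - w) * 1) =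
    h * ((x - u)\<^sup>2 + (y - v)\<^sup>2 - w)"
  by (simp add: power2_eq_square algebra_simps)

lemma circle_form_center:
  fixes p :: "nat \<Rightarrow> 'b::field"
  assumes two: "(2 :: 'b) \<noteq> 0" and p0: "p 0 \<noteq> 0"
  shows "circle_form p x y 1 = p 0 * ((x - center_x p)\<^sup>2 + (y - center_y p)\<^sup>2 - radius_sq p)"
proof -
  note p = circle_of_center[OF two, of p]
  have "p 1 = p 0 * (p 1 / p 0)" "p 2 = p 0 * (p 2 / p 0)" "p 3 = p 0 * (p 3 / p 0)"
    using p0 by simp_all
  then have coeffs: "p 1 = p 0 * (- 2 * center_x p)" "p 2 = p 0 * (- 2 * center_y p)"
    "p 3 = p 0 * ((center_x p)\<^sup>2 + (center_y p)\<^sup>2 - radius_sq p)"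
    unfolding p .
  have "circle_form p x y 1 = p 0 * (x\<^sup>2 + y\<^sup>2) + 1 * (p 1 * x + p 2 * y + p 3 * 1)"
    by (simp only: circle_form_def)
  also have "\<dots> = p 0 * ((x - center_x p)\<^sup>2 + (y - center_y p)\<^sup>2 - radius_sq p)"
    by (subst coeffs(1), subst coeffs(2), subst coeffs(3), rule complete_squares)
  finally show ?thesis .
qed

lemma center_radius_to_ac:
  "center_x (to_ac \<circ> p) = to_ac (center_x p)" "center_y (to_ac \<circ> p) = to_ac (center_y p)"
  "radius_sq (to_ac \<circ> p) = to_ac (radius_sq p)"
  by (simp_all add: center_x_def center_y_def radius_sq_def)

subsection \<open>The residue field\<close>

lemma ring_of_type_algebra_simps:
  "\<zero>\<^bsub>ring_of_type_algebra\<^esub> = (0 :: 'b::field)" "\<one>\<^bsub>ring_of_type_algebra\<^esub> = (1 :: 'b)"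
  "u \<oplus>\<^bsub>ring_of_type_algebra\<^esub> v = (u + v :: 'b)" "u \<otimes>\<^bsub>ring_of_type_algebra\<^esub> v = u * v"
  "carrier ring_of_type_algebra = (UNIV :: 'b set)"
  by (simp_all add: ring_of_type_algebra_def)

lemma a_inv_ring_of_type_algebra: "\<ominus>\<^bsub>ring_of_type_algebra\<^esub> u = (- u :: 'b::field)"
proof -
  interpret K: field "ring_of_type_algebra :: 'b ring" by (rule field_from_type_algebra)
  show ?thesis by (rule K.minus_equality) (simp_all add: ring_of_type_algebra_simps)
qed

lemma m_inv_ring_of_type_algebra:
  assumes "u \<noteq> (0 :: 'b::field)"
  shows "inv\<^bsub>ring_of_type_algebra\<^esub> u = inverse u"
proof -
  interpret K: field "ring_of_type_algebra :: 'b ring" by (rule field_from_type_algebra)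
  show ?thesis using assms by (intro K.comm_inv_char) (simp_all add: ring_of_type_algebra_simps)
qed

lemma (in simple_zero) point_field_uminus: "u \<in> point_field \<Longrightarrow> - u \<in> point_field"
  using ac.subspace_neg[OF subspace_point_field] .

text \<open>Homogeneous ratios and chart coordinates generate the same field because s i / s j = (s
  i / s 0) / (s j / s 0). \<open>point_field\<close> is closed under the field operations, and its
  elements are built from the generators by these operations.\<close>

lemma residue_field_eq_point_field:
  assumes "simple_zero 3 f (\<lambda>i. s i / s 0)" and s0: "s 0 \<noteq> (0 :: 'k::field alg_closure)"
  shows "residue_field s = simple_zero.point_field 3 (\<lambda>i. s i / s 0)"
proof
  interpret simple_zero 3 f "\<lambda>i. s i / s 0" by fact
  define G where "G = range to_ac \<union> {s i / s j | i j. i \<le> 3 \<and> j \<le> 3 \<and> s j \<noteq> 0}"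
  have coord: "s i / s 0 \<in> point_field" if "i \<le> 3" for i
  proof (cases "i = 0")
    case True then show ?thesis using ev_in_point_field[of 1] s0 by simp
  next
    case False
    then have "mvar i \<in> polys 3" using that by (intro polys_mvar) auto
    then show ?thesis
      using ev_in_point_field[of "mvar i"] by (simp add: comm_ring_hom.meval_mvar[OF to_ac_hom])
  qed
  have G: "h \<in> point_field" if h: "h \<in> G" for h
  proof (cases "h \<in> range to_ac")
    case True then show ?thesis using to_ac_in_point_field by auto
  next
    case False
    then obtain i j where ij: "h = s i / s j" "i \<le> 3" "j \<le> 3" "s j \<noteq> 0" using h by (auto simp: G_def)
    then have "h = (s i / s 0) / (s j / s 0)" using s0 by simp
    then show ?thesis using point_field_divide[OF coord coord] ij by metis
  qed
  have "h \<in> point_field" if "h \<in> generate_field ring_of_type_algebra G" for h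
    using that
  proof (induction rule: generate_field.induct)
    case one then show ?case using ev_in_point_field[of 1] by (simp add: ring_of_type_algebra_simps)
  next
    case (incl h) then show ?case by (rule G)
  next
    case (a_inv h) then show ?case unfolding a_inv_ring_of_type_algebra by (intro point_field_uminus)
  next
    case (m_inv h)
    then have "h \<noteq> 0" by (simp add: ring_of_type_algebra_simps)
    then show ?case
      using point_field_inverse[OF m_inv(3)] by (simp only: m_inv_ring_of_type_algebra[OF \<open>h \<noteq> 0\<close>])
  next
    case (eng_add h h')
    then show ?case unfolding ring_of_type_algebra_simps by (intro point_field_add)
  next
    case (eng_mult h h')
    then show ?case unfolding ring_of_type_algebra_simps by (intro point_field_mult)
  qed
  then show "residue_field s \<subseteq> point_field" unfolding residue_field_def G_def by blast
  have poly: "ev g \<in> generate_field ring_of_type_algebra G" if "g \<in> polys 3" for g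
    using that
  proof (induction rule: polys_induct)
    case (const c) then show ?case by (auto simp: G_def intro: generate_field.incl)
  next
    case (var i)
    then have "s i / s 0 \<in> G" using s0 unfolding G_def by (intro UnI2) auto
    then show ?case
      using generate_field.incl by (simp add: comm_ring_hom.meval_mvar[OF to_ac_hom])
  next
    case (add g h)
    then show ?case
      using generate_field.eng_add[of "ev g" ring_of_type_algebra G "ev h"]
      by (simp only: ring_of_type_algebra_simps ev.hom_add)
  next
    case (mult g h)
    then show ?case
      using generate_field.eng_mult[of "ev g" ring_of_type_algebra G "ev h"]
      by (simp only: ring_of_type_algebra_simps ev.hom_mult)
  qed
  show "point_field \<subseteq> residue_field s"
  proof
    fix z assume "z \<in> point_field"
    then obtain g h where gh: "z = ev g / ev h" "g \<in> polys 3" "h \<in> polys 3" "ev h \<noteq> 0"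
      unfolding point_field_def by blast
    have "inverse (ev h) \<in> generate_field ring_of_type_algebra G"
      using generate_field.m_inv[OF poly[OF gh(3)]] gh(4)
      by (simp add: ring_of_type_algebra_simps m_inv_ring_of_type_algebra)
    then have in_G: "ev g * inverse (ev h) \<in> generate_field ring_of_type_algebra G"
      using generate_field.eng_mult[OF poly[OF gh(2)]] by (simp only: ring_of_type_algebra_simps)
    have "z = ev g * inverse (ev h)" unfolding gh(1) by (rule divide_inverse)
    then show "z \<in> residue_field s" unfolding residue_field_def G_def[symmetric] using in_G by (simp only:)
  qed
qed

subsection \<open>Algebraic identities\<close>

text \<open>Each linear form in the quadric scales by h. This carries the tangency of s over to its
  representative with c_0 = 1.\<close>

lemma tangency_quadric_homogeneous:
  assumes \<phi>: "comm_ring_hom \<phi>"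
  shows "meval \<phi> (\<lambda>i. h * \<tau> i) (tangency_quadric p) = h\<^sup>2 * meval \<phi> \<tau> (tangency_quadric p)"
proof -
  have "(c * (h * t1 + 2 * c * (h * t0)) + d * (h * t2 + 2 * d * (h * t0)) + (h * t3 - m * (h * t0)))\<^sup>2
      - r * ((h * t1 + 2 * c * (h * t0))\<^sup>2 + (h * t2 + 2 * d * (h * t0))\<^sup>2) =
      h\<^sup>2 * ((c * (t1 + 2 * c * t0) + d * (t2 + 2 * d * t0) + (t3 - m * t0))\<^sup>2
      - r * ((t1 + 2 * c * t0)\<^sup>2 + (t2 + 2 * d * t0)\<^sup>2))" for c d r m h t0 t1 t2 t3 :: 'b
  proof -
    have e: "c * (h * t1 + 2 * c * (h * t0)) + d * (h * t2 + 2 * d * (h * t0)) + (h * t3 - m * (h * t0)) =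
        h * (c * (t1 + 2 * c * t0) + d * (t2 + 2 * d * t0) + (t3 - m * t0))"
      "h * t1 + 2 * c * (h * t0) = h * (t1 + 2 * c * t0)"
      "h * t2 + 2 * d * (h * t0) = h * (t2 + 2 * d * t0)"
      by (simp_all add: algebra_simps)
    have "(h * l)\<^sup>2 - r * ((h * u)\<^sup>2 + (h * v)\<^sup>2) = h\<^sup>2 * (l\<^sup>2 - r * (u\<^sup>2 + v\<^sup>2))" for l u v
      by (simp add: power2_eq_square algebra_simps)
    then show ?thesis unfolding e(1) unfolding e(2,3) .
  qed
  then show ?thesis unfolding meval_tangency_quadric[OF \<phi>] .
qed

text \<open>L, U, V and m enter as parameters with defining equations, so that they can stay
  unexpanded and be replaced by simplified values in the applications.\<close>

lemma tangency_quadric_partials: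
  fixes \<phi> :: "'a::field \<Rightarrow> 'b::idom" and p :: "nat \<Rightarrow> 'a"
  assumes \<phi>: "comm_ring_hom \<phi>"
    and L: "L = \<phi> (center_x p) * U + \<phi> (center_y p) * V + (\<tau> 3 - m * \<tau> 0)"
    and U: "U = \<tau> 1 + 2 * \<phi> (center_x p) * \<tau> 0" and V: "V = \<tau> 2 + 2 * \<phi> (center_y p) * \<tau> 0"
    and m: "m = (\<phi> (center_x p))\<^sup>2 + (\<phi> (center_y p))\<^sup>2 - \<phi> (radius_sq p)"
  shows "meval \<phi> \<tau> (tangency_quadric p) = L\<^sup>2 - \<phi> (radius_sq p) * (U\<^sup>2 + V\<^sup>2)"
    and "meval \<phi> \<tau> (mpderiv 0 (tangency_quadric p)) =
      2 * L * (\<phi> (center_x p) * (2 * \<phi> (center_x p)) + \<phi> (center_y p) * (2 * \<phi> (center_y p)) - m)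
      - 2 * \<phi> (radius_sq p) * (U * (2 * \<phi> (center_x p)) + V * (2 * \<phi> (center_y p)))"
    and "meval \<phi> \<tau> (mpderiv 1 (tangency_quadric p)) = 2 * L * \<phi> (center_x p) - 2 * \<phi> (radius_sq p) * U"
    and "meval \<phi> \<tau> (mpderiv 2 (tangency_quadric p)) = 2 * L * \<phi> (center_y p) - 2 * \<phi> (radius_sq p) * V"
    and "meval \<phi> \<tau> (mpderiv 3 (tangency_quadric p)) = 2 * L"
  unfolding meval_tangency_quadric[OF \<phi>] meval_mpderiv_tangency_quadric[OF \<phi>]
    U[symmetric] V[symmetric] m[symmetric] L[symmetric] by simp_all

text \<open>Euler's relation in degree 2. At a zero with c_0 = 1 it expresses the partial derivative
  in direction c_0 through the other three.\<close>

lemma tangency_quadric_euler: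
  fixes \<phi> :: "'a::field \<Rightarrow> 'b::idom" and p :: "nat \<Rightarrow> 'a"
  assumes \<phi>: "comm_ring_hom \<phi>"
  shows "\<tau> 0 * meval \<phi> \<tau> (mpderiv 0 (tangency_quadric p)) + \<tau> 1 * meval \<phi> \<tau> (mpderiv 1 (tangency_quadric p))
      + \<tau> 2 * meval \<phi> \<tau> (mpderiv 2 (tangency_quadric p)) + \<tau> 3 * meval \<phi> \<tau> (mpderiv 3 (tangency_quadric p)) =
    2 * meval \<phi> \<tau> (tangency_quadric p)"
proof -
  define m where "m = (\<phi> (center_x p))\<^sup>2 + (\<phi> (center_y p))\<^sup>2 - \<phi> (radius_sq p)"
  define U where "U = \<tau> 1 + 2 * \<phi> (center_x p) * \<tau> 0"
  define V where "V = \<tau> 2 + 2 * \<phi> (center_y p) * \<tau> 0"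
  define L where "L = \<phi> (center_x p) * U + \<phi> (center_y p) * V + (\<tau> 3 - m * \<tau> 0)"
  have id: "t0 * (2 * l * (c * (2 * c) + d * (2 * d) - m) - 2 * r * (u * (2 * c) + v * (2 * d)))
      + t1 * (2 * l * c - 2 * r * u) + t2 * (2 * l * d - 2 * r * v) + t3 * (2 * l) =
      2 * (l * (c * (t1 + 2 * c * t0) + d * (t2 + 2 * d * t0) + (t3 - m * t0))
      - r * (u * (t1 + 2 * c * t0) + v * (t2 + 2 * d * t0)))" for c d r m l u v t0 t1 t2 t3 :: 'b
    by (simp add: algebra_simps)
  show ?thesis
    unfolding tangency_quadric_partials[OF \<phi> L_def U_def V_def m_def] id
      U_def[symmetric] V_def[symmetric] L_def[symmetric] power2_eq_square ..
qed

text \<open>The matrix has columns 4 u_i (x_i, y_i, 1). Subtracting c and d times the last row from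
  the first two, that is translating the points by (c, d), leaves the determinant unchanged; the
  three factors 4 give 64 = 8^2.\<close>

lemma det_scaled_points:
  fixes u1 u2 u3 x1 x2 x3 y1 y2 y3 c d :: "'b::comm_ring_1"
  shows "(4 * (u1 * x1)) * ((4 * (u2 * y2)) * (4 * u3) - (4 * u2) * (4 * (u3 * y3)))
    - (4 * (u1 * y1)) * ((4 * (u2 * x2)) * (4 * u3) - (4 * u2) * (4 * (u3 * x3)))
    + (4 * u1) * ((4 * (u2 * x2)) * (4 * (u3 * y3)) - (4 * (u2 * y2)) * (4 * (u3 * x3))) =
    (u1 * ((u2 * (x2 - c)) * (u3 * (y3 - d)) - (u3 * (x3 - c)) * (u2 * (y2 - d)))
    - u2 * ((u1 * (x1 - c)) * (u3 * (y3 - d)) - (u3 * (x3 - c)) * (u1 * (y1 - d)))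
    + u3 * ((u1 * (x1 - c)) * (u2 * (y2 - d)) - (u2 * (x2 - c)) * (u1 * (y1 - d)))) * 8\<^sup>2"
  by (simp add: algebra_simps)

lemma power_of_circle:
  fixes a b c d r r' :: "'b::comm_ring_1"
  shows "a * (2 * (a - c)) + b * (2 * (b - d)) + (c\<^sup>2 + d\<^sup>2 - r' - (a\<^sup>2 + b\<^sup>2 - r) * 1) =
    (a - c)\<^sup>2 + (b - d)\<^sup>2 + r - r'"
  by (simp add: power2_eq_square algebra_simps)

text \<open>At the chart point U = 2 (a - c), V = 2 (b - d) and L = 2 u, where (c, d) is the center
  of S. So the partial 2 L a - 2 r U equals 4 (u a - r (a - c)), which
  \<open>tangent_circles\<close> identifies as 4 u x; the y-direction is alike.\<close>

lemma tangent_circle_gradient: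
  fixes p :: "nat \<Rightarrow> 'k::field" and s :: "nat \<Rightarrow> 'k alg_closure" and x y :: "'k alg_closure"
  assumes two: "(2 :: 'k) \<noteq> 0" and p0: "p 0 \<noteq> 0" and s0: "s 0 \<noteq> 0" and cone: "s \<in> tangency_cone p"
    and point: "circle_form (to_ac \<circ> p) x y 1 = 0" "circle_form s x y 1 = 0"
  defines "u \<equiv> (to_ac (center_x p) - x) * (to_ac (center_x p) - center_x s)
      + (to_ac (center_y p) - y) * (to_ac (center_y p) - center_y s)"
    and "v \<equiv> (to_ac (center_x p) - x) * (x - center_x s) + (to_ac (center_y p) - y) * (y - center_y s)"
    and "\<sigma> \<equiv> \<lambda>i. s i / s 0"
  shows "meval to_ac \<sigma> (tangency_quadric p) = 0"
    and "meval to_ac \<sigma> (mpderiv 1 (tangency_quadric p)) = 4 * (u * x)"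
    and "meval to_ac \<sigma> (mpderiv 2 (tangency_quadric p)) = 4 * (u * y)"
    and "meval to_ac \<sigma> (mpderiv 3 (tangency_quadric p)) = 4 * u"
    and "u * (x - center_x s) = v * (to_ac (center_x p) - center_x s)"
    and "u * (y - center_y s) = v * (to_ac (center_y p) - center_y s)"
proof -
  define a where "a = to_ac (center_x p)"
  define b where "b = to_ac (center_y p)"
  define r where "r = to_ac (radius_sq p)"
  define c where "c = center_x s"
  define d where "d = center_y s"
  define r' where "r' = radius_sq s"
  have two': "(2 :: 'k alg_closure) \<noteq> 0"
    using two to_ac_eq_0_iff[of "2 :: 'k"] by simp
  have \<sigma>: "\<sigma> 0 = 1" "\<sigma> 1 = - 2 * c" "\<sigma> 2 = - 2 * d" "\<sigma> 3 = c\<^sup>2 + d\<^sup>2 - r'"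
    using circle_of_center[OF two', of s] s0 by (simp_all add: \<sigma>_def c_def d_def r'_def)
  define m where "m = a\<^sup>2 + b\<^sup>2 - r"
  define U where "U = \<sigma> 1 + 2 * a * \<sigma> 0"
  define V where "V = \<sigma> 2 + 2 * b * \<sigma> 0"
  define L where "L = a * U + b * V + (\<sigma> 3 - m * \<sigma> 0)"
  note partials = tangency_quadric_partials[OF to_ac_hom, where p = p and \<tau> = \<sigma>,
      OF L_def[unfolded a_def b_def] U_def[unfolded a_def] V_def[unfolded b_def] m_def[unfolded a_def b_def r_def],
      folded a_def b_def r_def]
  have UV: "U = 2 * (a - c)" "V = 2 * (b - d)" unfolding U_def V_def \<sigma> by (simp_all add: algebra_simps)
  have L: "L = (a - c)\<^sup>2 + (b - d)\<^sup>2 + r - r'"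
    unfolding L_def UV \<sigma> m_def by (rule power_of_circle)
  have "s = (\<lambda>i. s 0 * \<sigma> i)" using s0 by (auto simp: \<sigma>_def)
  then have "(s 0)\<^sup>2 * meval to_ac \<sigma> (tangency_quadric p) = meval to_ac s (tangency_quadric p)"
    using tangency_quadric_homogeneous[OF to_ac_hom, of "s 0" \<sigma> p] by simp
  then show q: "meval to_ac \<sigma> (tangency_quadric p) = 0"
    using cone s0 by (simp add: tangency_cone_def)
  have C: "(x - a)\<^sup>2 + (y - b)\<^sup>2 = r"
    using point(1) p0 circle_form_center[OF two', of "to_ac \<circ> p" x y]
    by (simp add: center_radius_to_ac a_def b_def r_def)
  have S: "(x - c)\<^sup>2 + (y - d)\<^sup>2 = r'"
    using point(2) s0 circle_form_center[OF two', of s x y] by (simp add: c_def d_def r'_def)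
  \<comment> \<open>The quadric is L^2 - r (U^2 + V^2), so its vanishing at the chart point is the
    equation that \<open>tangent_circles\<close> expects.\<close>
  have "((a - c)\<^sup>2 + (b - d)\<^sup>2 + r - r')\<^sup>2 - 4 * r * ((a - c)\<^sup>2 + (b - d)\<^sup>2) = 0"
  proof -
    have "4 * r * ((a - c)\<^sup>2 + (b - d)\<^sup>2) = r * (U\<^sup>2 + V\<^sup>2)"
      unfolding UV power_mult_distrib by (simp add: distrib_left mult.left_commute)
    then show ?thesis using q unfolding partials(1) L by (simp only:)
  qed
  note tangent = tangent_circles[OF two' C S this, unfolded a_def b_def c_def d_def, folded u_def v_def,
      folded a_def b_def]
  have L2: "L = 2 * u" using tangent(1) unfolding L a_def b_def c_def d_def .
  have four: "2 * (2 * w) * z - 2 * r * (2 * t) = 4 * (w * z - r * t)" for w z t :: "'k alg_closure"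
  proof -
    have "2 * (2 * w) * z - 2 * r * (2 * t) = (2 * 2) * (w * z - r * t)"
      by (simp only: right_diff_distrib mult_ac)
    then show ?thesis by simp
  qed
  show "meval to_ac \<sigma> (mpderiv 1 (tangency_quadric p)) = 4 * (u * x)"
    unfolding partials(3) L2 UV four using tangent(2) by (simp only: a_def c_def)
  show "meval to_ac \<sigma> (mpderiv 2 (tangency_quadric p)) = 4 * (u * y)"
    unfolding partials(4) L2 UV four using tangent(3) by (simp only: b_def d_def)
  show "meval to_ac \<sigma> (mpderiv 3 (tangency_quadric p)) = 4 * u"
    unfolding partials(5) L2 by simp
  show "u * (x - center_x s) = v * (to_ac (center_x p) - center_x s)"
    "u * (y - center_y s) = v * (to_ac (center_y p) - center_y s)"
    using tangent(4,5) by (simp_all only: a_def b_def)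
qed

text \<open>Distributing v_m and v_n over the 2 by 2 determinant turns each v_i (a_i - c) into u_i
  (x_i - c), and likewise for y. The result is the determinant of \<open>det_scaled_points\<close>
  expanded along the row of the u_i.\<close>

lemma area_numerator:
  fixes a b x y :: "nat \<Rightarrow> 'b::field"
  assumes "\<And>i. i \<in> {1..3} \<Longrightarrow> area_u a b c d x y i * (x i - c) = area_v a b c d x y i * (a i - c)"
    and "\<And>i. i \<in> {1..3} \<Longrightarrow> area_u a b c d x y i * (y i - d) = area_v a b c d x y i * (b i - d)"
  defines "u \<equiv> area_u a b c d x y"
  shows "area a b c d x y =
      u 1 * ((u 2 * (x 2 - c)) * (u 3 * (y 3 - d)) - (u 3 * (x 3 - c)) * (u 2 * (y 2 - d)))
    - u 2 * ((u 1 * (x 1 - c)) * (u 3 * (y 3 - d)) - (u 3 * (x 3 - c)) * (u 1 * (y 1 - d)))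
    + u 3 * ((u 1 * (x 1 - c)) * (u 2 * (y 2 - d)) - (u 2 * (x 2 - c)) * (u 1 * (y 1 - d)))"
proof -
  define v where "v = area_v a b c d x y"
  have uv: "u i * (x i - c) = v i * (a i - c)" "u i * (y i - d) = v i * (b i - d)" if "i \<in> {1, 2, 3}" for i
    using assms(1,2)[of i] that by (auto simp: u_def v_def)
  have alg: "e * w * v1 * v2 * (a1 * b2 - a2 * b1) = e * (w * ((v1 * a1) * (v2 * b2) - (v2 * a2) * (v1 * b1)))"
    for e w v1 v2 a1 b1 a2 b2 :: 'b
    by (simp only: right_diff_distrib mult_ac)
  have "area a b c d x y =
      (- 1) ^ (1 + 1) * u 1 * v 2 * v 3 * ((a 2 - c) * (b 3 - d) - (a 3 - c) * (b 2 - d))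
    + (- 1) ^ (2 + 1) * u 2 * v 1 * v 3 * ((a 1 - c) * (b 3 - d) - (a 3 - c) * (b 1 - d))
    + (- 1) ^ (3 + 1) * u 3 * v 1 * v 2 * ((a 1 - c) * (b 2 - d) - (a 2 - c) * (b 1 - d))"
    unfolding area_def Let_def sum_triples u_def v_def ..
  also have "\<dots> = (- 1) ^ (1 + 1) * (u 1 * ((u 2 * (x 2 - c)) * (u 3 * (y 3 - d)) - (u 3 * (x 3 - c)) * (u 2 * (y 2 - d))))
    + (- 1) ^ (2 + 1) * (u 2 * ((u 1 * (x 1 - c)) * (u 3 * (y 3 - d)) - (u 3 * (x 3 - c)) * (u 1 * (y 1 - d))))
    + (- 1) ^ (3 + 1) * (u 3 * ((u 1 * (x 1 - c)) * (u 2 * (y 2 - d)) - (u 2 * (x 2 - c)) * (u 1 * (y 1 - d))))"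
    unfolding alg by (simp only: uv insert_iff simp_thms)
  finally show ?thesis by simp
qed

theorem theorem1p3:
  fixes C :: "nat \<Rightarrow> nat \<Rightarrow> 'k::field"
    and s :: "nat \<Rightarrow> 'k alg_closure"
    and x y :: "nat \<Rightarrow> 'k alg_closure"
  assumes char_not_2: "(2 :: 'k) \<noteq> 0"
    and nondegenerate: "\<forall>i\<in>{1..3}. C i 0 \<noteq> 0"
    and centers_not_collinear:
      "\<not> (\<exists>\<alpha> \<beta> \<gamma> :: 'k. (\<alpha>, \<beta>, \<gamma>) \<noteq> (0, 0, 0) \<and>
            (\<forall>i\<in>{1..3}. \<alpha> * center_x (C i) + \<beta> * center_y (C i) + \<gamma> = 0))"
    and not_tangent: "\<forall>i\<in>{1..3}. \<forall>j\<in>{1..3}. i \<noteq> j \<longrightarrow> to_ac \<circ> C j \<notin> tangency_cone (C i)"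
    and transverse: "meet_transversely C"
    and S_nondegenerate: "s 0 \<noteq> 0"
    and S_tangent: "\<forall>i\<in>{1..3}. s \<in> tangency_cone (C i)"
    and separable: "separable_extension (residue_field s)"
    and tangency_points: "\<forall>i\<in>{1..3}.
      circle_form (to_ac \<circ> C i) (x i) (y i) 1 = 0 \<and> circle_form s (x i) (y i) 1 = 0"
  shows "local_index C s =
    gw_trace (residue_field s)
      (rank_one_form
        (area (\<lambda>i. to_ac (center_x (C i))) (\<lambda>i. to_ac (center_y (C i)))
          (center_x s) (center_y s) x y))"
proof -
  define \<sigma> where "\<sigma> = (\<lambda>i. s i / s 0)"
  define f where "f = (\<lambda>i. dehomogenize (tangency_quadric (C i)))"
  define g where "g k i = meval to_ac \<sigma> (mpderiv k (tangency_quadric (C i)))" for k i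
  define a where "a = (\<lambda>i. to_ac (center_x (C i)))"
  define b where "b = (\<lambda>i. to_ac (center_y (C i)))"
  define u where "u = area_u a b (center_x s) (center_y s) x y"
  define Area where "Area = area a b (center_x s) (center_y s) x y"
  have two: "(2 :: 'k alg_closure) \<noteq> 0"
    using char_not_2 to_ac_eq_0_iff[of "2 :: 'k"] by simp
  note gradient = tangent_circle_gradient[OF char_not_2, where s = s, folded \<sigma>_def]
  have q: "meval to_ac \<sigma> (tangency_quadric (C i)) = 0"
    and g: "g 1 i = 4 * (u i * x i)" "g 2 i = 4 * (u i * y i)" "g 3 i = 4 * u i"
    and uv: "u i * (x i - center_x s) = area_v a b (center_x s) (center_y s) x y i * (a i - center_x s)"
      "u i * (y i - center_y s) = area_v a b (center_x s) (center_y s) x y i * (b i - center_y s)"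
    if "i \<in> {1..3}" for i
    unfolding g_def u_def area_u_def area_v_def a_def b_def
    by (rule gradient; use that nondegenerate S_nondegenerate S_tangent tangency_points in blast)+
  have \<sigma>0: "\<sigma> 0 = 1" using S_nondegenerate by (simp add: \<sigma>_def)
  have jac: "mat 3 3 (\<lambda>(i, j). meval to_ac \<sigma> (mpderiv (Suc i) (f (Suc j)))) =
      mat 3 3 (\<lambda>(i, j). g (Suc i) (Suc j))"
    unfolding f_def g_def by (intro eq_matI) (simp_all add: meval_mpderiv_dehomogenize[OF to_ac_hom, where \<tau> = \<sigma>] \<sigma>0)
  have det_nz: "det (mat 3 3 (\<lambda>(i, j). g (Suc i) (Suc j))) \<noteq> 0"
  proof
    assume "det (mat 3 3 (\<lambda>(i, j). g (Suc i) (Suc j))) = 0"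
    then obtain w where w: "w \<in> carrier_vec 3" "w \<noteq> 0\<^sub>v 3"
      "mat 3 3 (\<lambda>(i, j). g (Suc i) (Suc j)) *\<^sub>v w = 0\<^sub>v 3"
      using det_0_iff_vec_prod_zero_field[of "mat 3 3 (\<lambda>(i, j). g (Suc i) (Suc j))" 3] by auto
    \<comment> \<open>Vector entries are counted from 0 and circles from 1. A kernel vector of the
      Jacobian is to become a linear relation among the three gradients, against
      transversality.\<close>
    define t where "t i = w $ (i - 1)" for i
    have rows: "(\<Sum>i\<in>{1..3}. t i * g (Suc k) i) = 0" if "k < 3" for k
    proof -
      have "(\<Sum>i\<in>{1..3}. t i * g (Suc k) i) = (\<Sum>j<3. g (Suc k) (Suc j) * w $ j)"
        by (simp add: t_def sum_1_3 eval_nat_numeral lessThan_Suc mult.commute add_ac)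
      also have "\<dots> = (mat 3 3 (\<lambda>(i, j). g (Suc i) (Suc j)) *\<^sub>v w) $ k"
        using that w(1) by (simp add: scalar_prod_def lessThan_atLeast0)
      finally show ?thesis using w(3) that by simp
    qed
    have euler: "g 0 i = - (\<sigma> 1 * g 1 i + \<sigma> 2 * g 2 i + \<sigma> 3 * g 3 i)" if "i \<in> {1..3}" for i
    proof -
      have "1 * g 0 i + \<sigma> 1 * g 1 i + \<sigma> 2 * g 2 i + \<sigma> 3 * g 3 i = 2 * 0"
        using tangency_quadric_euler[OF to_ac_hom, of \<sigma> "C i"] unfolding g_def \<sigma>0 q[OF that] .
      then show ?thesis by (simp only: eq_neg_iff_add_eq_0 mult_1_left mult_zero_right add.assoc)
    qed
    have row: "(\<Sum>i\<in>{1..3}. t i * g k i) = 0" if "k \<in> {1, 2, 3}" for k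
      using that rows[of 0] rows[of 1] rows[of 2] by (auto simp: eval_nat_numeral)
    have "(\<Sum>i\<in>{1..3}. t i * g 0 i) =
        (\<Sum>i\<in>{1..3}. - (\<sigma> 1 * (t i * g 1 i) + \<sigma> 2 * (t i * g 2 i) + \<sigma> 3 * (t i * g 3 i)))"
      by (intro sum.cong refl) (simp only: euler mult_minus_right distrib_left mult.left_commute)
    also have "\<dots> = - (\<sigma> 1 * (\<Sum>i\<in>{1..3}. t i * g 1 i) + \<sigma> 2 * (\<Sum>i\<in>{1..3}. t i * g 2 i)
        + \<sigma> 3 * (\<Sum>i\<in>{1..3}. t i * g 3 i))"
      by (simp only: sum_negf sum.distrib sum_distrib_left)
    also have "\<dots> = 0" using row[of 1] row[of 2] row[of 3] by simp
    finally have row0: "(\<Sum>i\<in>{1..3}. t i * g 0 i) = 0" .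
    have "\<forall>j\<in>{0..3}. (\<Sum>i\<in>{1..3}. t i * g j i) = 0"
    proof
      fix j :: nat assume "j \<in> {0..3}"
      then have "j = 0 \<or> j \<in> {1, 2, 3}" by auto
      then show "(\<Sum>i\<in>{1..3}. t i * g j i) = 0" using row row0 by blast
    qed
    \<comment> \<open>The tuple \<sigma> is s rescaled to \<sigma> 0 = 1, hence another
      representative of the same projective point, at which transversality is applied.\<close>
    moreover have "\<sigma> \<in> (\<Inter>i\<in>{1..3}. tangency_cone (C i))"
      using q \<sigma>0 by (auto simp: tangency_cone_def intro!: bexI[of _ 0])
    ultimately have t0: "\<forall>i\<in>{1..3}. t i = 0"
      using transverse unfolding meet_transversely_def g_def by blast
    have "w = 0\<^sub>v 3"
    proof (rule eq_vecI)
      fix i assume i: "i < dim_vec (0\<^sub>v 3 :: 'k alg_closure vec)"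
      then have "t (Suc i) = 0" using t0 by simp
      then show "w $ i = 0\<^sub>v 3 $ i" using i by (simp add: t_def)
    qed (use w(1) in auto)
    then show False using w(2) by simp
  qed
  interpret simple_zero 3 f \<sigma>
  proof
    fix j :: nat assume j: "j \<in> {1..3}"
    show "f j \<in> polys 3" unfolding f_def by (rule dehomogenize_tangency_quadric_polys)
    have "(\<lambda>i. if i = 0 then 1 else \<sigma> i) = \<sigma>" using \<sigma>0 by auto
    then show "meval to_ac \<sigma> (f j) = 0"
      unfolding f_def meval_dehomogenize[OF to_ac_hom] using q[OF j] by simp
  next
    show "det (mat 3 3 (\<lambda>(i, j). meval to_ac \<sigma> (mpderiv (Suc i) (f (Suc j))))) \<noteq> 0"
      unfolding jac by (rule det_nz)
  qed
  have J: "jacobian = Area * 8\<^sup>2"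
  proof -
    have "jacobian = g 1 1 * (g 2 2 * g 3 3 - g 3 2 * g 2 3) - g 2 1 * (g 1 2 * g 3 3 - g 3 2 * g 1 3)
        + g 3 1 * (g 1 2 * g 2 3 - g 2 2 * g 1 3)"
      unfolding jac det_mat_3 by (simp add: eval_nat_numeral)
    also have "\<dots> = Area * 8\<^sup>2"
    proof -
      have i: "1 \<in> {1..3 :: nat}" "2 \<in> {1..3 :: nat}" "3 \<in> {1..3 :: nat}" by auto
      show ?thesis
        unfolding g[OF i(1)] g[OF i(2)] g[OF i(3)] Area_def
          det_scaled_points[where c = "center_x s" and d = "center_y s"] u_def
        by (subst area_numerator) (rule refl uv[unfolded u_def] | assumption)+
    qed
    finally show ?thesis .
  qed
  have eight: "(8 :: 'k alg_closure) \<in> point_field" "(8 :: 'k alg_closure) \<noteq> 0"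
  proof -
    show "(8 :: 'k alg_closure) \<in> point_field" using to_ac_in_point_field[of 8] by simp
    have "(8 :: 'k alg_closure) = 2 * (2 * 2)" by simp
    then show "(8 :: 'k alg_closure) \<noteq> 0" using two by (metis mult_eq_0_iff)
  qed
  \<comment> \<open>The tangency points are given only in the closure. That Area(s) lies in k(s) is
    read off from Area(s) = J / 64, where J is a sum of products of values of polynomials over k at
    the chart point.\<close>
  have "jacobian \<in> point_field"
  proof -
    obtain \<Delta> where \<Delta>: "difference_coeffs 3 f \<Delta>" using difference_coeffs_exist f_polys by blast
    obtain gs hs where gh: "length gs = length hs" "set gs \<subseteq> polys 3" "set hs \<subseteq> polys 3"
      "det (mat 3 3 (\<lambda>(i, j). \<Delta> (Suc i) (Suc j))) = (\<Sum>l<length gs. gs ! l * in_Y 3 (hs ! l))"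
      using tensor_decomposition[OF det_difference_coeffs_polys[OF \<Delta>]] by blast
    have "(\<Sum>l<length gs. ev (gs ! l) * ev (hs ! l)) \<in> point_field"
      using gh by (intro ac.subspace_sum[OF subspace_point_field] point_field_mult ev_in_point_field)
        (auto simp: subset_iff)
    then show ?thesis unfolding ev_contract_det[OF \<Delta> gh(2,3,1,4)] .
  qed
  then have "jacobian / 8\<^sup>2 \<in> point_field"
    using eight(1) by (simp only: power2_eq_square point_field_divide point_field_mult)
  moreover have "Area = jacobian / 8\<^sup>2" unfolding J using eight(2) by (intro nonzero_mult_div_cancel_right[symmetric] power_not_zero)
  ultimately have "Area \<in> point_field" by (simp only:)
  then have "local_A1_degree 3 point_ideal f = gw_trace point_field (rank_one_form Area)"
    using local_A1_degree_simple_zero eight(1) J by blast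
  moreover have "local_index C s = local_A1_degree 3 point_ideal f"
    unfolding local_index_def chart_point_ideal_def point_ideal_def f_def unfolding \<sigma>_def ..
  moreover have "residue_field s = point_field"
    using residue_field_eq_point_field[of f s] simple_zero_axioms S_nondegenerate
    unfolding \<sigma>_def by blast
  ultimately show ?thesis unfolding Area_def a_def b_def by simp
qed

end
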